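(* Let $L/K$ be a finite cyclic extension of number fields with Galois group $G$, and let $S$ be a finite set of primes of $K$ containing all infinite primes. Then there is an isomorphism $$C_{L,S}^{G}/C_{K,S}\cong \text{Ш}_{S}^1(G,U_{L,S}).$$
   Context: We also write $S$ for the set of primes of $L$ above primes in $S$. For $F=K$ or $L$: $U_{F,S}$ is the $S$-unit group, $I_{F,S}=\prod_{v\in S}F_v^\times\times\prod_{v\notin S}U_v$ the $S$-idèle group ($U_v$ the units of the completion $F_v$), containing $U_{F,S}$ diagonally, and $C_{F,S}=I_{F,S}/U_{F,S}$; $C_{K,S}$ is regarded as a subgroup of $C_{L,S}^G$ via the natural map. For each prime $v$ of $K$ fix a prime $w$ of $L$ above $v$, with decomposition group $G_w=\mathrm{Gal}(L_w/K_v)$ and unit group $U_w\subset L_w^\times$. For $i=1,2$ the localization map $$\lambda_S^i:H^i(G,U_{L,S})\to\bigoplus_{v\in S}H^i(G_w,L_w^\times)\times\bigoplus_{v\notin S}H^i(G_w,U_w)$$ is induced by the inclusions $U_{L,S}\subset L_w^\times$ ($v\in S$) and $U_{L,S}\subset U_w$ ($v\notin S$) (equivalently, it is the map $H^i(G,U_{L,S})\to H^i(G,I_{L,S})$ via Shapiro's lemma). Define $\text{Ш}_S^i(G,U_{L,S})=\ker\lambda_S^i$ and $\text{Б}_S^i(G,U_{L,S})=\operatorname{coker}\lambda_S^i$. *)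

theory Defs
  imports Complex_Main "HOL-Algebra.Algebra"
begin

section \<open>Number fields and their extensions\<close>

definition number_field :: "'f::field_char_0 itself \<Rightarrow> bool" where
  "number_field (_ :: 'f itself) \<longleftrightarrow>
     (\<exists>B :: 'f set. finite B \<and> module.span (\<lambda>q x. of_rat q * x) B = UNIV)"

definition field_hom :: "('k::field \<Rightarrow> 'l::field) \<Rightarrow> bool" where
  "field_hom f \<longleftrightarrow> f 1 = 1 \<and> (\<forall>x y. f (x + y) = f x + f y) \<and> (\<forall>x y. f (x * y) = f x * f y)"

text \<open>An extension \<open>L/K\<close> is given by a field embedding \<open>\<iota> : K \<rightarrow> L\<close>; both fields are types.\<close>

definition finite_extension :: "('k::field \<Rightarrow> 'l::field) \<Rightarrow> bool" where
  "finite_extension \<iota> \<longleftrightarrow>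
     field_hom \<iota> \<and> (\<exists>B. finite B \<and> module.span (\<lambda>a x. \<iota> a * x) B = UNIV)"

definition galois_group :: "('k::field \<Rightarrow> 'l::field) \<Rightarrow> ('l \<Rightarrow> 'l) monoid" where
  "galois_group \<iota> =
     \<lparr>carrier = {\<sigma>. bij \<sigma> \<and> field_hom \<sigma> \<and> (\<forall>x. \<sigma> (\<iota> x) = \<iota> x)}, monoid.mult = (\<circ>), one = id\<rparr>"

definition galois_extension :: "('k::field \<Rightarrow> 'l::field) \<Rightarrow> bool" where
  "galois_extension \<iota> \<longleftrightarrow>
     finite_extension \<iota> \<and> {y. \<forall>\<sigma>\<in>carrier (galois_group \<iota>). \<sigma> y = y} = range \<iota>"

definition cyclic_extension :: "('k::field \<Rightarrow> 'l::field) \<Rightarrow> bool" where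
  "cyclic_extension \<iota> \<longleftrightarrow> galois_extension \<iota> \<and> cyclic_group (galois_group \<iota>)"


section \<open>Primes\<close>

text \<open>A prime (place) is an equivalence class of nontrivial absolute values; it is infinite if these
  are archimedean.\<close>

definition absolute_value :: "('f::field \<Rightarrow> real) \<Rightarrow> bool" where
  "absolute_value a \<longleftrightarrow>
     (\<forall>x. a x \<ge> 0) \<and> (\<forall>x. a x = 0 \<longleftrightarrow> x = 0) \<and>
     (\<forall>x y. a (x * y) = a x * a y) \<and> (\<forall>x y. a (x + y) \<le> a x + a y)"

definition nontrivial_absolute_values :: "('f::field \<Rightarrow> real) set" where
  "nontrivial_absolute_values = {a. absolute_value a \<and> (\<exists>x. x \<noteq> 0 \<and> a x \<noteq> 1)}"

definition absolute_value_equiv :: "(('f::field \<Rightarrow> real) \<times> ('f \<Rightarrow> real)) set" where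
  "absolute_value_equiv =
     {(a, b). a \<in> nontrivial_absolute_values \<and> b \<in> nontrivial_absolute_values \<and>
              (\<exists>s>0. \<forall>x. b x = a x powr s)}"

type_synonym 'f place = "('f \<Rightarrow> real) set"

definition places :: "'f::field place set" where
  "places = nontrivial_absolute_values // absolute_value_equiv"

definition infinite_places :: "'f::field place set" where
  "infinite_places = {v \<in> places. \<exists>a\<in>v. \<not> (\<forall>x y. a (x + y) \<le> max (a x) (a y))}"

definition place_abs :: "'f::field place \<Rightarrow> 'f \<Rightarrow> real" where
  "place_abs v = (SOME a. a \<in> v)"

text \<open>The prime of \<open>K\<close> below a prime \<open>w\<close> of \<open>L\<close>.\<close>

definition place_below :: "('k::field \<Rightarrow> 'l::field) \<Rightarrow> 'l place \<Rightarrow> 'k place" where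
  "place_below \<iota> w = (\<Union>a\<in>w. absolute_value_equiv `` {a \<circ> \<iota>})"

definition places_above :: "('k::field \<Rightarrow> 'l::field) \<Rightarrow> 'k place set \<Rightarrow> 'l place set" where
  "places_above \<iota> S = {w \<in> places. place_below \<iota> w \<in> S}"

text \<open>The Galois action on primes: the absolute value of \<open>\<sigma>w\<close> is that of \<open>w\<close> composed with the
  inverse of \<open>\<sigma>\<close>.\<close>

definition place_act :: "('l::field \<Rightarrow> 'l) \<Rightarrow> 'l place \<Rightarrow> 'l place" where
  "place_act \<sigma> w = (\<lambda>a. a \<circ> inv_into UNIV \<sigma>) ` w"

definition decomposition_group ::
  "('k::field \<Rightarrow> 'l::field) \<Rightarrow> 'l place \<Rightarrow> ('l \<Rightarrow> 'l) monoid" where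
  "decomposition_group \<iota> w =
     (galois_group \<iota>)\<lparr>carrier := {\<sigma> \<in> carrier (galois_group \<iota>). place_act \<sigma> w = w}\<rparr>"


section \<open>Completions\<close>

definition cauchy_ring :: "'f::field place \<Rightarrow> (nat \<Rightarrow> 'f) ring" where
  "cauchy_ring v =
     \<lparr>carrier = {x. \<forall>e>0. \<exists>N. \<forall>m\<ge>N. \<forall>n\<ge>N. place_abs v (x m - x n) < e},
      monoid.mult = (\<lambda>x y n. x n * y n), one = (\<lambda>n. 1), ring.zero = (\<lambda>n. 0), ring.add = (\<lambda>x y n. x n + y n)\<rparr>"

definition null_ideal :: "'f::field place \<Rightarrow> (nat \<Rightarrow> 'f) set" where
  "null_ideal v = {x. (\<lambda>n. place_abs v (x n)) \<longlonglongrightarrow> 0}"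

definition completion :: "'f::field place \<Rightarrow> (nat \<Rightarrow> 'f) set ring" where
  "completion v = cauchy_ring v Quot null_ideal v"

definition completion_abs :: "'f::field place \<Rightarrow> (nat \<Rightarrow> 'f) set \<Rightarrow> real" where
  "completion_abs v \<xi> = (THE r. \<forall>x\<in>\<xi>. (\<lambda>n. place_abs v (x n)) \<longlonglongrightarrow> r)"

text \<open>This is a ring only for finite primes; it is not used for infinite ones.\<close>

definition valuation_ring :: "'f::field place \<Rightarrow> (nat \<Rightarrow> 'f) set ring" where
  "valuation_ring v =
     (completion v)\<lparr>carrier := {\<xi> \<in> carrier (completion v). completion_abs v \<xi> \<le> 1}\<rparr>"

definition completion_embed :: "'f::field place \<Rightarrow> 'f \<Rightarrow> (nat \<Rightarrow> 'f) set" where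
  "completion_embed v x = null_ideal v +>\<^bsub>cauchy_ring v\<^esub> (\<lambda>n. x)"

text \<open>The map of completions induced by a field embedding \<open>f\<close>, with values in the completion at
  \<open>w\<close>; its source is the completion at the prime induced by \<open>w\<close> through \<open>f\<close>. It is used for
  \<open>f = \<iota>\<close>, giving the map from the completion of \<open>K\<close> at \<open>v\<close> to that of \<open>L\<close> at \<open>w\<close>, and for
  \<open>f = \<sigma>\<close>, giving the map from the completion of \<open>L\<close> at the inverse image of \<open>w\<close> under \<open>\<sigma>\<close> to
  that at \<open>w\<close>.\<close>

definition completion_map ::
  "('k::field \<Rightarrow> 'l::field) \<Rightarrow> 'l place \<Rightarrow> (nat \<Rightarrow> 'k) set \<Rightarrow> (nat \<Rightarrow> 'l) set" where
  "completion_map f w \<xi> = (\<Union>x\<in>\<xi>. null_ideal w +>\<^bsub>cauchy_ring w\<^esub> (f \<circ> x))"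


section \<open>\<open>S\<close>-units, \<open>S\<close>-ideles and \<open>S\<close>-idele classes\<close>

definition S_units :: "'f::field place set \<Rightarrow> 'f monoid" where
  "S_units S =
     \<lparr>carrier = {x. x \<noteq> 0 \<and> (\<forall>v \<in> places - S. place_abs v x = 1)}, monoid.mult = (*), one = 1\<rparr>"

definition local_factor :: "'f::field place set \<Rightarrow> 'f place \<Rightarrow> (nat \<Rightarrow> 'f) set monoid" where
  "local_factor S v =
     (if v \<in> S then units_of (completion v) else units_of (valuation_ring v))"

definition S_ideles :: "'f::field place set \<Rightarrow> ('f place \<Rightarrow> (nat \<Rightarrow> 'f) set) monoid" where
  "S_ideles S = product_group places (local_factor S)"

definition principal_ideles ::
  "'f::field place set \<Rightarrow> ('f place \<Rightarrow> (nat \<Rightarrow> 'f) set) set" where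
  "principal_ideles S = (\<lambda>x. \<lambda>v\<in>places. completion_embed v x) ` carrier (S_units S)"

definition S_idele_classes ::
  "'f::field place set \<Rightarrow> ('f place \<Rightarrow> (nat \<Rightarrow> 'f) set) set monoid" where
  "S_idele_classes S = S_ideles S Mod principal_ideles S"

definition idele_act ::
  "('l::field \<Rightarrow> 'l) \<Rightarrow> ('l place \<Rightarrow> (nat \<Rightarrow> 'l) set) \<Rightarrow> 'l place \<Rightarrow> (nat \<Rightarrow> 'l) set" where
  "idele_act \<sigma> x =
     (\<lambda>w\<in>places. completion_map \<sigma> w (x (place_act (inv_into UNIV \<sigma>) w)))"

definition idele_map :: "('k::field \<Rightarrow> 'l::field) \<Rightarrow>
    ('k place \<Rightarrow> (nat \<Rightarrow> 'k) set) \<Rightarrow> 'l place \<Rightarrow> (nat \<Rightarrow> 'l) set" where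
  "idele_map \<iota> x = (\<lambda>w\<in>places. completion_map \<iota> w (x (place_below \<iota> w)))"

definition idele_class_map :: "('k::field \<Rightarrow> 'l::field) \<Rightarrow> 'k place set \<Rightarrow>
    ('k place \<Rightarrow> (nat \<Rightarrow> 'k) set) set \<Rightarrow> ('l place \<Rightarrow> (nat \<Rightarrow> 'l) set) set" where
  "idele_class_map \<iota> S \<xi> =
     (\<Union>x\<in>\<xi>. principal_ideles (places_above \<iota> S)
               #>\<^bsub>S_ideles (places_above \<iota> S)\<^esub> idele_map \<iota> x)"

definition fixed_points ::
  "'g monoid \<Rightarrow> ('g \<Rightarrow> 'a \<Rightarrow> 'a) \<Rightarrow> 'a monoid \<Rightarrow> 'a monoid" where
  "fixed_points G act A = A\<lparr>carrier := {x \<in> carrier A. \<forall>g\<in>carrier G. act g x = x}\<rparr>"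

definition invariant_idele_classes :: "('k::field \<Rightarrow> 'l::field) \<Rightarrow> 'k place set \<Rightarrow>
    ('l place \<Rightarrow> (nat \<Rightarrow> 'l) set) set monoid" where
  "invariant_idele_classes \<iota> S =
     fixed_points (galois_group \<iota>) (\<lambda>\<sigma> \<xi>. idele_act \<sigma> ` \<xi>) (S_idele_classes (places_above \<iota> S))"


section \<open>First cohomology and the localization map\<close>

definition cocycles1 ::
  "'g monoid \<Rightarrow> 'a monoid \<Rightarrow> ('g \<Rightarrow> 'a \<Rightarrow> 'a) \<Rightarrow> ('g \<Rightarrow> 'a) monoid" where
  "cocycles1 G A act =
     \<lparr>carrier = {f \<in> carrier G \<rightarrow>\<^sub>E carrier A.
        \<forall>g\<in>carrier G. \<forall>h\<in>carrier G. f (g \<otimes>\<^bsub>G\<^esub> h) = f g \<otimes>\<^bsub>A\<^esub> act g (f h)},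
      monoid.mult = (\<lambda>f f'. \<lambda>g\<in>carrier G. f g \<otimes>\<^bsub>A\<^esub> f' g),
      one = (\<lambda>g\<in>carrier G. \<one>\<^bsub>A\<^esub>)\<rparr>"

definition coboundaries1 ::
  "'g monoid \<Rightarrow> 'a monoid \<Rightarrow> ('g \<Rightarrow> 'a \<Rightarrow> 'a) \<Rightarrow> ('g \<Rightarrow> 'a) set" where
  "coboundaries1 G A act =
     (\<lambda>a. \<lambda>g\<in>carrier G. act g a \<otimes>\<^bsub>A\<^esub> inv\<^bsub>A\<^esub> a) ` carrier A"

definition H1 ::
  "'g monoid \<Rightarrow> 'a monoid \<Rightarrow> ('g \<Rightarrow> 'a \<Rightarrow> 'a) \<Rightarrow> ('g \<Rightarrow> 'a) set monoid" where
  "H1 G A act = cocycles1 G A act Mod coboundaries1 G A act"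

text \<open>Restriction to the group \<open>G\<close>, followed by the coefficient map \<open>\<phi>\<close> into the \<open>G\<close>-module
  \<open>A\<close>, on classes of cocycles.\<close>

definition H1_map :: "'g monoid \<Rightarrow> 'b monoid \<Rightarrow> ('g \<Rightarrow> 'b \<Rightarrow> 'b) \<Rightarrow> ('a \<Rightarrow> 'b) \<Rightarrow>
    ('g \<Rightarrow> 'a) set \<Rightarrow> ('g \<Rightarrow> 'b) set" where
  "H1_map G A act \<phi> \<xi> =
     (\<Union>f\<in>\<xi>. coboundaries1 G A act #>\<^bsub>cocycles1 G A act\<^esub> (\<lambda>g\<in>carrier G. \<phi> (f g)))"

definition H1_S_units ::
  "('k::field \<Rightarrow> 'l::field) \<Rightarrow> 'k place set \<Rightarrow> (('l \<Rightarrow> 'l) \<Rightarrow> 'l) set monoid" where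
  "H1_S_units \<iota> S =
     H1 (galois_group \<iota>) (S_units (places_above \<iota> S)) (\<lambda>\<sigma> x. \<sigma> x)"

definition H1_local :: "('k::field \<Rightarrow> 'l::field) \<Rightarrow> 'k place set \<Rightarrow> 'l place \<Rightarrow>
    (('l \<Rightarrow> 'l) \<Rightarrow> (nat \<Rightarrow> 'l) set) set monoid" where
  "H1_local \<iota> S w =
     H1 (decomposition_group \<iota> w) (local_factor (places_above \<iota> S) w)
        (\<lambda>\<sigma>. completion_map \<sigma> w)"

text \<open>Here \<open>pl v\<close> is the chosen prime of \<open>L\<close> above the prime \<open>v\<close> of \<open>K\<close>.\<close>

definition localization1 :: "('k::field \<Rightarrow> 'l::field) \<Rightarrow> 'k place set \<Rightarrow> ('k place \<Rightarrow> 'l place) \<Rightarrow>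
    (('l \<Rightarrow> 'l) \<Rightarrow> 'l) set \<Rightarrow> 'k place \<Rightarrow> (('l \<Rightarrow> 'l) \<Rightarrow> (nat \<Rightarrow> 'l) set) set" where
  "localization1 \<iota> S pl \<xi> =
     (\<lambda>v\<in>places. H1_map (decomposition_group \<iota> (pl v)) (local_factor (places_above \<iota> S) (pl v))
                   (\<lambda>\<sigma>. completion_map \<sigma> (pl v)) (completion_embed (pl v)) \<xi>)"

definition Sha1 :: "('k::field \<Rightarrow> 'l::field) \<Rightarrow> 'k place set \<Rightarrow> ('k place \<Rightarrow> 'l place) \<Rightarrow>
    (('l \<Rightarrow> 'l) \<Rightarrow> 'l) set monoid" where
  "Sha1 \<iota> S pl =
     (H1_S_units \<iota> S)\<lparr>carrier :=
        kernel (H1_S_units \<iota> S) (sum_group places (\<lambda>v. H1_local \<iota> S (pl v)))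
               (localization1 \<iota> S pl)\<rparr>"

end

theory Submission
  imports Defs "HOL-Computational_Algebra.Polynomial"
begin

text \<open>The exact sequence \<open>1 \<rightarrow> U\<^sub>L \<rightarrow> I\<^sub>L \<rightarrow> C\<^sub>L \<rightarrow> 1\<close> of \<open>G\<close>-modules identifies \<open>C\<^sub>L\<^sup>G / I\<^sub>L\<^sup>G\<close> with the
  kernel of \<open>H\<^sup>1(G, U\<^sub>L) \<rightarrow> H\<^sup>1(G, I\<^sub>L)\<close>, and by Shapiro's lemma a class dies in \<open>H\<^sup>1(G, I\<^sub>L)\<close> iff it
  dies at one prime above each prime of \<open>K\<close>. That \<open>G\<close> is transitive on the primes above a prime of
  \<open>K\<close> and that \<open>I\<^sub>L\<^sup>G = I\<^sub>K\<close> both follow from weak approximation: averaging over \<open>G\<close> turns an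
  approximation by elements of \<open>L\<close> of an invariant family of local elements into an approximation
  by elements of \<open>K\<close>.\<close>


section \<open>Cohomology of an equivariant embedding\<close>

text \<open>The obstacle is that \<open>G\<close> moves the primes. A conjugate of \<open>y\<close>
  is close to the prescribed element at \<open>w\<close> only if \<open>y\<close> is close to the
  right element at the prime from which the conjugation came, so an average over \<open>G\<close> is
  controlled at \<open>w\<close> only when \<open>y\<close> approximates at the whole orbit of
  \<open>w\<close> simultaneously. This is why approximation at several inequivalent primes is
  required. Completions are classes of Cauchy sequences, so the averaged sequence of elements of K
  is itself a representative of the wanted element of the completion of K. The representatives of
  the primes above and below are unrelated choices, and everything is reduced to notions that
  survive passing to a positive power: null sequences, Cauchy sequences, and value at most 1. A
  class dying in the cohomology of the ideles is kept in the form: every cocycle \<open>f\<close> in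
  it has an idele \<open>a\<close> on which each \<open>g\<close> acts as multiplication by
  \<open>f g\<close>. The connecting map recovers \<open>f\<close> from such an \<open>a\<close>,
  and \<open>a\<close> can be glued from local solutions.\<close>

locale group_module = group G + A: comm_group A
  for G :: "'g monoid" (structure) and A :: "'a monoid" +
  fixes act :: "'g \<Rightarrow> 'a \<Rightarrow> 'a"
  assumes act_hom: "g \<in> carrier G \<Longrightarrow> act g \<in> hom A A"
    and act_one: "a \<in> carrier A \<Longrightarrow> act \<one> a = a"
    and act_mult: "\<lbrakk>g \<in> carrier G; h \<in> carrier G; a \<in> carrier A\<rbrakk> \<Longrightarrow> act (g \<otimes> h) a = act g (act h a)"
begin

lemma act_closed [simp, intro]: "g \<in> carrier G \<Longrightarrow> a \<in> carrier A \<Longrightarrow> act g a \<in> carrier A"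
  using act_hom by (auto simp: hom_def)

lemma act_distrib: "\<lbrakk>g \<in> carrier G; a \<in> carrier A; b \<in> carrier A\<rbrakk> \<Longrightarrow>
    act g (a \<otimes>\<^bsub>A\<^esub> b) = act g a \<otimes>\<^bsub>A\<^esub> act g b"
  using act_hom by (auto simp: hom_def)

lemma act_group_hom: "g \<in> carrier G \<Longrightarrow> group_hom A A (act g)"
  using act_hom by (simp add: group_hom_def group_hom_axioms_def)

lemma act_unit: "g \<in> carrier G \<Longrightarrow> act g \<one>\<^bsub>A\<^esub> = \<one>\<^bsub>A\<^esub>"
  by (rule group_hom.hom_one[OF act_group_hom])

lemma act_inv: "g \<in> carrier G \<Longrightarrow> a \<in> carrier A \<Longrightarrow> act g (inv\<^bsub>A\<^esub> a) = inv\<^bsub>A\<^esub> act g a"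
  by (rule group_hom.hom_inv[OF act_group_hom])

lemma act_inv_cancel:
  assumes "g \<in> carrier G" "a \<in> carrier A"
  shows "act g (act (inv g) a) = a"
  using act_mult[of g "inv g" a] assms by (simp add: act_one)

lemma cocycles1_iff: "f \<in> carrier (cocycles1 G A act) \<longleftrightarrow>
    f \<in> carrier G \<rightarrow>\<^sub>E carrier A \<and>
    (\<forall>g\<in>carrier G. \<forall>h\<in>carrier G. f (g \<otimes> h) = f g \<otimes>\<^bsub>A\<^esub> act g (f h))"
  by (simp add: cocycles1_def)

lemma cocycles1_mult: "f \<otimes>\<^bsub>cocycles1 G A act\<^esub> f' = (\<lambda>g\<in>carrier G. f g \<otimes>\<^bsub>A\<^esub> f' g)"
  by (simp add: cocycles1_def)

lemma cocycles1_one: "\<one>\<^bsub>cocycles1 G A act\<^esub> = (\<lambda>g\<in>carrier G. \<one>\<^bsub>A\<^esub>)"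
  by (simp add: cocycles1_def)

lemma cocycles1_closed [simp]:
  "f \<in> carrier (cocycles1 G A act) \<Longrightarrow> g \<in> carrier G \<Longrightarrow> f g \<in> carrier A"
  by (auto simp: cocycles1_iff)

lemma cocycles1_comm_group: "comm_group (cocycles1 G A act)"
proof (rule comm_groupI)
  fix f f' assume f: "f \<in> carrier (cocycles1 G A act)" and f': "f' \<in> carrier (cocycles1 G A act)"
  show "f \<otimes>\<^bsub>cocycles1 G A act\<^esub> f' \<in> carrier (cocycles1 G A act)"
    unfolding cocycles1_iff cocycles1_mult
    using f f' by (auto simp: cocycles1_iff act_distrib A.m_ac PiE_mem)
  show "f \<otimes>\<^bsub>cocycles1 G A act\<^esub> f' = f' \<otimes>\<^bsub>cocycles1 G A act\<^esub> f"
    unfolding cocycles1_mult using f f' by (auto simp: A.m_comm)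
next
  fix f f' f'' assume "f \<in> carrier (cocycles1 G A act)" "f' \<in> carrier (cocycles1 G A act)"
    "f'' \<in> carrier (cocycles1 G A act)"
  then show "f \<otimes>\<^bsub>cocycles1 G A act\<^esub> f' \<otimes>\<^bsub>cocycles1 G A act\<^esub> f'' =
      f \<otimes>\<^bsub>cocycles1 G A act\<^esub> (f' \<otimes>\<^bsub>cocycles1 G A act\<^esub> f'')"
    unfolding cocycles1_mult by (auto simp: A.m_assoc intro!: restrict_ext)
next
  show "\<one>\<^bsub>cocycles1 G A act\<^esub> \<in> carrier (cocycles1 G A act)"
    by (auto simp: cocycles1_iff cocycles1_one act_unit)
next
  fix f assume f: "f \<in> carrier (cocycles1 G A act)"
  then show "\<one>\<^bsub>cocycles1 G A act\<^esub> \<otimes>\<^bsub>cocycles1 G A act\<^esub> f = f"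
    by (intro extensionalityI[of _ "carrier G"])
      (auto simp: cocycles1_iff cocycles1_one cocycles1_mult PiE_iff)
  have "(\<lambda>g\<in>carrier G. inv\<^bsub>A\<^esub> f g) \<in> carrier (cocycles1 G A act)"
    using f by (auto simp: cocycles1_iff PiE_mem act_inv A.inv_mult)
  moreover have "(\<lambda>g\<in>carrier G. inv\<^bsub>A\<^esub> f g) \<otimes>\<^bsub>cocycles1 G A act\<^esub> f = \<one>\<^bsub>cocycles1 G A act\<^esub>"
    using f by (auto simp: cocycles1_mult cocycles1_one A.l_inv intro!: restrict_ext)
  ultimately show "\<exists>y\<in>carrier (cocycles1 G A act). y \<otimes>\<^bsub>cocycles1 G A act\<^esub> f = \<one>\<^bsub>cocycles1 G A act\<^esub>"
    by blast
qed

sublocale cocycles: comm_group "cocycles1 G A act"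
  by (rule cocycles1_comm_group)

text \<open>Moving the inverse to the other side gives the multiplicative equation in which
  trivialisations of cocycles are written from here on. Extensionality appears because cochains are
  stored as functions that are \<open>undefined\<close> off the group.\<close>

lemma coboundaries1_iff:
  "f \<in> coboundaries1 G A act \<longleftrightarrow> f \<in> extensional (carrier G) \<and>
     (\<exists>a\<in>carrier A. \<forall>g\<in>carrier G. f g \<in> carrier A \<and> act g a = f g \<otimes>\<^bsub>A\<^esub> a)" (is "?l \<longleftrightarrow> ?r")
proof
  assume ?l
  then show ?r by (force simp: coboundaries1_def A.m_assoc)
next
  assume ?r
  then obtain a where a: "a \<in> carrier A" "\<forall>g\<in>carrier G. f g \<in> carrier A \<and> act g a = f g \<otimes>\<^bsub>A\<^esub> a"
      "f \<in> extensional (carrier G)" by blast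
  have "f = (\<lambda>g\<in>carrier G. act g a \<otimes>\<^bsub>A\<^esub> inv\<^bsub>A\<^esub> a)"
    using a by (intro extensionalityI[of f "carrier G"]) (auto simp: A.m_assoc)
  then show ?l using a(1) unfolding coboundaries1_def by blast
qed

lemma coboundaries1_subset: "coboundaries1 G A act \<subseteq> carrier (cocycles1 G A act)"
proof
  fix f assume "f \<in> coboundaries1 G A act"
  then obtain a where a: "a \<in> carrier A" and f: "f = (\<lambda>g\<in>carrier G. act g a \<otimes>\<^bsub>A\<^esub> inv\<^bsub>A\<^esub> a)"
    by (auto simp: coboundaries1_def)
  have "act (g \<otimes> h) a \<otimes>\<^bsub>A\<^esub> inv\<^bsub>A\<^esub> a =
      act g a \<otimes>\<^bsub>A\<^esub> inv\<^bsub>A\<^esub> a \<otimes>\<^bsub>A\<^esub> act g (act h a \<otimes>\<^bsub>A\<^esub> inv\<^bsub>A\<^esub> a)"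
    if "g \<in> carrier G" "h \<in> carrier G" for g h
  proof -
    \<comment> \<open>In the product of the two values, \<open>act g a\<close> from the first meets
      its inverse from the second; this telescoping is the cocycle identity.\<close>
    have "act g a \<otimes>\<^bsub>A\<^esub> inv\<^bsub>A\<^esub> a \<otimes>\<^bsub>A\<^esub> (act g (act h a) \<otimes>\<^bsub>A\<^esub> inv\<^bsub>A\<^esub> act g a) =
        act g (act h a) \<otimes>\<^bsub>A\<^esub> inv\<^bsub>A\<^esub> a \<otimes>\<^bsub>A\<^esub> (act g a \<otimes>\<^bsub>A\<^esub> inv\<^bsub>A\<^esub> act g a)"
      using that a by (simp only: A.m_ac A.inv_closed A.m_closed act_closed)
    also have "\<dots> = act g (act h a) \<otimes>\<^bsub>A\<^esub> inv\<^bsub>A\<^esub> a" using that a by simp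
    finally show ?thesis using that a by (simp only: act_mult act_distrib act_inv act_closed A.inv_closed)
  qed
  then show "f \<in> carrier (cocycles1 G A act)"
    using a unfolding f by (auto simp: cocycles1_iff)
qed

lemma coboundaries1_subgroup: "subgroup (coboundaries1 G A act) (cocycles1 G A act)"
proof (rule cocycles.subgroupI)
  show "coboundaries1 G A act \<subseteq> carrier (cocycles1 G A act)" by (rule coboundaries1_subset)
  show "coboundaries1 G A act \<noteq> {}"
    unfolding coboundaries1_def by (auto intro: A.one_closed)
next
  fix f f' assume "f \<in> coboundaries1 G A act" "f' \<in> coboundaries1 G A act"
  then obtain a b where a: "a \<in> carrier A" "f = (\<lambda>g\<in>carrier G. act g a \<otimes>\<^bsub>A\<^esub> inv\<^bsub>A\<^esub> a)"
    and b: "b \<in> carrier A" "f' = (\<lambda>g\<in>carrier G. act g b \<otimes>\<^bsub>A\<^esub> inv\<^bsub>A\<^esub> b)"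
    by (auto simp: coboundaries1_def)
  have "f \<otimes>\<^bsub>cocycles1 G A act\<^esub> f' =
      (\<lambda>g\<in>carrier G. act g (a \<otimes>\<^bsub>A\<^esub> b) \<otimes>\<^bsub>A\<^esub> inv\<^bsub>A\<^esub> (a \<otimes>\<^bsub>A\<^esub> b))"
    using a b by (auto simp: cocycles1_mult act_distrib A.inv_mult A.m_ac intro!: restrict_ext)
  then show "f \<otimes>\<^bsub>cocycles1 G A act\<^esub> f' \<in> coboundaries1 G A act"
    using a b unfolding coboundaries1_def by blast
next
  fix f assume f: "f \<in> coboundaries1 G A act"
  then obtain a where a: "a \<in> carrier A" "f = (\<lambda>g\<in>carrier G. act g a \<otimes>\<^bsub>A\<^esub> inv\<^bsub>A\<^esub> a)"
    by (auto simp: coboundaries1_def)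
  define f' where "f' = (\<lambda>g\<in>carrier G. act g (inv\<^bsub>A\<^esub> a) \<otimes>\<^bsub>A\<^esub> inv\<^bsub>A\<^esub> (inv\<^bsub>A\<^esub> a))"
  have f': "f' \<in> coboundaries1 G A act"
    using a unfolding coboundaries1_def f'_def by blast
  have "f' \<otimes>\<^bsub>cocycles1 G A act\<^esub> f = \<one>\<^bsub>cocycles1 G A act\<^esub>"
    unfolding cocycles1_mult cocycles1_one
  proof (rule restrict_ext)
    fix g assume g: "g \<in> carrier G"
    have "inv\<^bsub>A\<^esub> act g a \<otimes>\<^bsub>A\<^esub> a \<otimes>\<^bsub>A\<^esub> (act g a \<otimes>\<^bsub>A\<^esub> inv\<^bsub>A\<^esub> a) =
        (inv\<^bsub>A\<^esub> act g a \<otimes>\<^bsub>A\<^esub> act g a) \<otimes>\<^bsub>A\<^esub> (a \<otimes>\<^bsub>A\<^esub> inv\<^bsub>A\<^esub> a)"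
      using a g by (simp add: A.m_ac)
    then show "f' g \<otimes>\<^bsub>A\<^esub> f g = \<one>\<^bsub>A\<^esub>"
      using a g by (simp add: f'_def act_inv A.l_inv A.r_inv)
  qed
  then have "inv\<^bsub>cocycles1 G A act\<^esub> f = f'"
    using f f' coboundaries1_subset by (intro cocycles.inv_equality) auto
  then show "inv\<^bsub>cocycles1 G A act\<^esub> f \<in> coboundaries1 G A act" using f' by simp
qed

lemma coboundaries1_normal: "coboundaries1 G A act \<lhd> cocycles1 G A act"
  by (rule cocycles.subgroup_imp_normal[OF coboundaries1_subgroup])

lemma H1_group: "group (H1 G A act)"
  unfolding H1_def by (rule normal.factorgroup_is_group[OF coboundaries1_normal])

text \<open>Classes are literally sets of cocycles, so any member can replace the representative
  with which a class was formed.\<close>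

lemma H1_coset:
  assumes "\<xi> \<in> carrier (H1 G A act)" "f \<in> \<xi>"
  shows "f \<in> carrier (cocycles1 G A act)"
    "\<xi> = coboundaries1 G A act #>\<^bsub>cocycles1 G A act\<^esub> f"
proof -
  obtain f0 where f0: "f0 \<in> carrier (cocycles1 G A act)"
      "\<xi> = coboundaries1 G A act #>\<^bsub>cocycles1 G A act\<^esub> f0"
    using assms(1) by (auto simp: H1_def carrier_FactGroup)
  show "f \<in> carrier (cocycles1 G A act)"
    using assms(2) f0 coboundaries1_subset cocycles.r_coset_subset_G by blast
  show "\<xi> = coboundaries1 G A act #>\<^bsub>cocycles1 G A act\<^esub> f"
    using assms(2) f0 cocycles.repr_independence coboundaries1_subgroup by blast
qed

lemma H1_class_nonempty: "\<xi> \<in> carrier (H1 G A act) \<Longrightarrow> \<xi> \<noteq> {}"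
  using cocycles.rcos_self[OF _ coboundaries1_subgroup] by (fastforce simp: H1_def carrier_FactGroup)

end

section \<open>The connecting homomorphism of an equivariant embedding\<close>

locale equivariant_embedding =
    U: group_module G U actU + I: group_module G I actI
  for G :: "'g monoid" (structure)
    and U :: "'u monoid" and I :: "'a monoid" and actU actI +
  fixes j :: "'u \<Rightarrow> 'a"
  assumes j_hom: "j \<in> hom U I"
    and j_inj: "inj_on j (carrier U)"
    and j_act: "\<lbrakk>g \<in> carrier G; u \<in> carrier U\<rbrakk> \<Longrightarrow> j (actU g u) = actI g (j u)"
begin

sublocale j: group_hom U I j
  using j_hom by unfold_locales

lemma range_subgroup: "subgroup (j ` carrier U) I"
  by (rule j.img_is_subgroup)

lemma range_coset_iff: "x \<in> carrier I \<Longrightarrow>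
    y \<in> j ` carrier U #>\<^bsub>I\<^esub> x \<longleftrightarrow> (\<exists>u\<in>carrier U. y = j u \<otimes>\<^bsub>I\<^esub> x)"
  by (auto simp: r_coset_def)

text \<open>This is the preimage in \<open>I\<close> of the invariants of the quotient by
  \<open>U\<close>. It allows the connecting map to be defined on elements before passing to
  cosets.\<close>

definition invariant_mod :: "'a set" where
  "invariant_mod = {x \<in> carrier I. \<forall>g\<in>carrier G. \<exists>u\<in>carrier U. actI g x = j u \<otimes>\<^bsub>I\<^esub> x}"

lemma invariant_mod_subgroup: "subgroup invariant_mod I"
proof (rule I.A.subgroupI)
  show "invariant_mod \<noteq> {}"
    by (auto simp: invariant_mod_def I.act_unit intro!: exI[of _ "\<one>\<^bsub>I\<^esub>"] bexI[of _ "\<one>\<^bsub>U\<^esub>"])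
  fix x assume x: "x \<in> invariant_mod"
  then have xc: "x \<in> carrier I" by (simp add: invariant_mod_def)
  have "\<exists>u\<in>carrier U. actI g (inv\<^bsub>I\<^esub> x) = j u \<otimes>\<^bsub>I\<^esub> inv\<^bsub>I\<^esub> x" if g: "g \<in> carrier G" for g
  proof -
    obtain u where "u \<in> carrier U" "actI g x = j u \<otimes>\<^bsub>I\<^esub> x"
      using x g by (auto simp: invariant_mod_def)
    then show ?thesis using g xc
      by (intro bexI[of _ "inv\<^bsub>U\<^esub> u"]) (auto simp: I.act_inv I.A.inv_mult)
  qed
  then show "inv\<^bsub>I\<^esub> x \<in> invariant_mod" using xc by (simp add: invariant_mod_def)
  fix y assume y: "y \<in> invariant_mod"
  then have yc: "y \<in> carrier I" by (simp add: invariant_mod_def)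
  have "\<exists>u\<in>carrier U. actI g (x \<otimes>\<^bsub>I\<^esub> y) = j u \<otimes>\<^bsub>I\<^esub> (x \<otimes>\<^bsub>I\<^esub> y)" if g: "g \<in> carrier G" for g
  proof -
    obtain u u' where "u \<in> carrier U" "actI g x = j u \<otimes>\<^bsub>I\<^esub> x" "u' \<in> carrier U" "actI g y = j u' \<otimes>\<^bsub>I\<^esub> y"
      using x y g by (fastforce simp: invariant_mod_def)
    then show ?thesis using g xc yc
      by (intro bexI[of _ "u \<otimes>\<^bsub>U\<^esub> u'"]) (auto simp: I.act_distrib I.A.m_ac)
  qed
  then show "x \<otimes>\<^bsub>I\<^esub> y \<in> invariant_mod" using xc yc by (simp add: invariant_mod_def)
qed (simp add: invariant_mod_def)

text \<open>The group acts on a coset by taking its image, so invariance is an equality of sets. As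
  the image of \<open>U\<close> is stable under \<open>G\<close>, one representative decides the
  inclusion, and the inverse of \<open>g\<close> supplies the opposite inclusion.\<close>

lemma coset_invariant_iff:
  assumes x: "x \<in> carrier I"
  shows "(\<forall>g\<in>carrier G. actI g ` (j ` carrier U #>\<^bsub>I\<^esub> x) = j ` carrier U #>\<^bsub>I\<^esub> x) \<longleftrightarrow>
    x \<in> invariant_mod" (is "(\<forall>g\<in>carrier G. actI g ` ?N = ?N) \<longleftrightarrow> _")
proof
  assume L: "\<forall>g\<in>carrier G. actI g ` ?N = ?N"
  have "x \<in> ?N" using x range_subgroup I.A.rcos_self by blast
  then have "\<forall>g\<in>carrier G. actI g x \<in> ?N" using L by blast
  then show "x \<in> invariant_mod" using x by (simp add: invariant_mod_def range_coset_iff)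
next
  assume R: "x \<in> invariant_mod"
  have sub: "actI g ` ?N \<subseteq> ?N" if g: "g \<in> carrier G" for g
  proof clarify
    fix y assume "y \<in> ?N"
    then obtain u where u: "u \<in> carrier U" "y = j u \<otimes>\<^bsub>I\<^esub> x" using x by (auto simp: range_coset_iff)
    obtain u' where u': "u' \<in> carrier U" "actI g x = j u' \<otimes>\<^bsub>I\<^esub> x"
      using R g by (auto simp: invariant_mod_def)
    have "actI g y = j (actU g u \<otimes>\<^bsub>U\<^esub> u') \<otimes>\<^bsub>I\<^esub> x"
      using u u' g x by (simp add: I.act_distrib j_act I.A.m_assoc)
    moreover have "actU g u \<otimes>\<^bsub>U\<^esub> u' \<in> carrier U" using u u' g by simp
    ultimately show "actI g y \<in> ?N" using x range_coset_iff by blast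
  qed
  have "?N \<subseteq> actI g ` ?N" if g: "g \<in> carrier G" for g
  proof
    fix y assume y: "y \<in> ?N"
    have "actI g (actI (inv g) y) = y"
      using y x g by (intro I.act_inv_cancel) (auto simp: range_coset_iff)
    moreover have "actI (inv g) y \<in> ?N" using sub[of "inv g"] g y by blast
    ultimately show "y \<in> actI g ` ?N" by (metis imageI)
  qed
  then show "\<forall>g\<in>carrier G. actI g ` ?N = ?N" using sub by blast
qed

text \<open>The product of cosets sees only the multiplication of \<open>I\<close>, which
  restricting the carrier leaves alone. Hence this is an equality of records and not merely an
  isomorphism, and it can be used to rewrite the goal.\<close>

lemma fixed_points_FactGroup:
  "fixed_points G (\<lambda>g \<xi>. actI g ` \<xi>) (I Mod j ` carrier U) =
     I\<lparr>carrier := invariant_mod\<rparr> Mod j ` carrier U"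
proof -
  have "{\<xi> \<in> (\<lambda>x. j ` carrier U #>\<^bsub>I\<^esub> x) ` carrier I. \<forall>g\<in>carrier G. actI g ` \<xi> = \<xi>} =
      (\<lambda>x. j ` carrier U #>\<^bsub>I\<^esub> x) ` invariant_mod"
    using coset_invariant_iff by (auto simp: invariant_mod_def)
  then show ?thesis
    unfolding fixed_points_def FactGroup_def RCOSETS_def
    by (simp add: UNION_singleton_eq_range r_coset_def set_mult_def fun_eq_iff)
qed

text \<open>The cochain of the snake lemma. The function is total, but the preimage under
  \<open>j\<close> that it selects is meaningful only for \<open>x\<close> in
  \<open>invariant_mod\<close>.\<close>

definition connecting_cocycle :: "'a \<Rightarrow> 'g \<Rightarrow> 'u" where
  "connecting_cocycle x = (\<lambda>g\<in>carrier G. inv_into (carrier U) j (actI g x \<otimes>\<^bsub>I\<^esub> inv\<^bsub>I\<^esub> x))"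

text \<open>Injectivity of \<open>j\<close> lets the defining equation determine the cochain. Later
  cocycles are computed by exhibiting a solution, which avoids reasoning about
  \<open>inv_into\<close>.\<close>

lemma connecting_cocycleI:
  assumes "x \<in> carrier I" "f \<in> extensional (carrier G)"
    "\<And>g. g \<in> carrier G \<Longrightarrow> f g \<in> carrier U \<and> actI g x = j (f g) \<otimes>\<^bsub>I\<^esub> x"
  shows "connecting_cocycle x = f"
proof (rule extensionalityI[of _ "carrier G"])
  fix g assume g: "g \<in> carrier G"
  then have "actI g x \<otimes>\<^bsub>I\<^esub> inv\<^bsub>I\<^esub> x = j (f g)"
    using assms by (simp add: I.A.m_assoc)
  then show "connecting_cocycle x g = f g"
    using g assms j_inj by (simp add: connecting_cocycle_def)
qed (use assms in \<open>auto simp: connecting_cocycle_def\<close>)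

lemma connecting_cocycle:
  assumes "x \<in> invariant_mod" "g \<in> carrier G"
  shows "connecting_cocycle x g \<in> carrier U" "actI g x = j (connecting_cocycle x g) \<otimes>\<^bsub>I\<^esub> x"
proof -
  have x: "x \<in> carrier I" using assms by (simp add: invariant_mod_def)
  obtain u where u: "u \<in> carrier U" "actI g x = j u \<otimes>\<^bsub>I\<^esub> x"
    using assms by (auto simp: invariant_mod_def)
  then have "connecting_cocycle x g = u"
    using x assms j_inj by (simp add: connecting_cocycle_def I.A.m_assoc)
  then show "connecting_cocycle x g \<in> carrier U" "actI g x = j (connecting_cocycle x g) \<otimes>\<^bsub>I\<^esub> x"
    using u by auto
qed

lemma connecting_cocycle_extensional [simp]: "connecting_cocycle x \<in> extensional (carrier G)"
  by (simp add: connecting_cocycle_def)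

text \<open>Let a product \<open>g h\<close> act on \<open>x\<close> directly and in two stages, and
  cancel \<open>x\<close>; injectivity of \<open>j\<close> then brings the identity back into
  \<open>U\<close>.\<close>

lemma connecting_cocycle_mem:
  assumes x: "x \<in> invariant_mod"
  shows "connecting_cocycle x \<in> carrier (cocycles1 G U actU)"
  unfolding U.cocycles1_iff
proof (intro conjI ballI)
  have xc: "x \<in> carrier I" using x by (simp add: invariant_mod_def)
  show "connecting_cocycle x \<in> carrier G \<rightarrow>\<^sub>E carrier U"
    using connecting_cocycle(1)[OF x] by (auto simp: PiE_iff)
  fix g h assume g: "g \<in> carrier G" and h: "h \<in> carrier G"
  let ?c = "connecting_cocycle x"
  have "j (?c (g \<otimes> h)) \<otimes>\<^bsub>I\<^esub> x = actI g (actI h x)"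
    using connecting_cocycle(2)[OF x, of "g \<otimes> h"] g h xc by (simp add: I.act_mult)
  also have "\<dots> = actI g (j (?c h) \<otimes>\<^bsub>I\<^esub> x)"
    by (metis connecting_cocycle(2)[OF x] h)
  also have "\<dots> = j (actU g (?c h)) \<otimes>\<^bsub>I\<^esub> actI g x"
    using g h xc connecting_cocycle(1)[OF x] by (simp add: I.act_distrib j_act)
  also have "\<dots> = j (actU g (?c h)) \<otimes>\<^bsub>I\<^esub> (j (?c g) \<otimes>\<^bsub>I\<^esub> x)"
    by (metis connecting_cocycle(2)[OF x] g)
  also have "\<dots> = j (?c g \<otimes>\<^bsub>U\<^esub> actU g (?c h)) \<otimes>\<^bsub>I\<^esub> x"
    using g h xc connecting_cocycle(1)[OF x] by (simp add: I.A.m_ac)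
  finally have "j (?c (g \<otimes> h)) = j (?c g \<otimes>\<^bsub>U\<^esub> actU g (?c h))"
    using g h xc connecting_cocycle(1)[OF x] by simp
  then show "?c (g \<otimes> h) = ?c g \<otimes>\<^bsub>U\<^esub> actU g (?c h)"
    using g h connecting_cocycle(1)[OF x] by (intro inj_onD[OF j_inj]) auto
qed

lemma connecting_cocycle_mult:
  assumes x: "x \<in> invariant_mod" and y: "y \<in> invariant_mod"
  shows "connecting_cocycle (x \<otimes>\<^bsub>I\<^esub> y) =
    connecting_cocycle x \<otimes>\<^bsub>cocycles1 G U actU\<^esub> connecting_cocycle y"
proof (rule connecting_cocycleI)
  have xc: "x \<in> carrier I" "y \<in> carrier I" using x y by (auto simp: invariant_mod_def)
  then show "x \<otimes>\<^bsub>I\<^esub> y \<in> carrier I" by simp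
  show "connecting_cocycle x \<otimes>\<^bsub>cocycles1 G U actU\<^esub> connecting_cocycle y \<in> extensional (carrier G)"
    by (simp add: U.cocycles1_mult)
  fix g assume g: "g \<in> carrier G"
  have "actI g (x \<otimes>\<^bsub>I\<^esub> y) = (j (connecting_cocycle x g) \<otimes>\<^bsub>I\<^esub> x) \<otimes>\<^bsub>I\<^esub> (j (connecting_cocycle y g) \<otimes>\<^bsub>I\<^esub> y)"
    using connecting_cocycle(2)[OF x g] connecting_cocycle(2)[OF y g] g xc I.act_distrib by metis
  then show "(connecting_cocycle x \<otimes>\<^bsub>cocycles1 G U actU\<^esub> connecting_cocycle y) g \<in> carrier U \<and>
      actI g (x \<otimes>\<^bsub>I\<^esub> y) =
      j ((connecting_cocycle x \<otimes>\<^bsub>cocycles1 G U actU\<^esub> connecting_cocycle y) g) \<otimes>\<^bsub>I\<^esub> (x \<otimes>\<^bsub>I\<^esub> y)"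
    using g xc connecting_cocycle(1)[OF x g] connecting_cocycle(1)[OF y g]
    by (simp add: U.cocycles1_mult I.A.m_ac)
qed

text \<open>Together with multiplicativity this shows that changing \<open>x\<close> within its
  coset changes the cocycle by a coboundary only, so the class depends on the coset alone.\<close>

lemma connecting_cocycle_j:
  assumes u: "u \<in> carrier U"
  shows "j u \<in> invariant_mod" "connecting_cocycle (j u) \<in> coboundaries1 G U actU"
proof -
  have eq: "actI g (j u) = j (actU g u \<otimes>\<^bsub>U\<^esub> inv\<^bsub>U\<^esub> u) \<otimes>\<^bsub>I\<^esub> j u" if "g \<in> carrier G" for g
    using that u by (simp add: I.A.m_assoc flip: j_act)
  then show "j u \<in> invariant_mod"
    using u by (auto simp: invariant_mod_def intro!: bexI[of _ "actU _ u \<otimes>\<^bsub>U\<^esub> inv\<^bsub>U\<^esub> u"])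
  have "connecting_cocycle (j u) = (\<lambda>g\<in>carrier G. actU g u \<otimes>\<^bsub>U\<^esub> inv\<^bsub>U\<^esub> u)"
    using u eq by (intro connecting_cocycleI) auto
  then show "connecting_cocycle (j u) \<in> coboundaries1 G U actU"
    using u by (auto simp: coboundaries1_def)
qed

text \<open>This is the part \<open>I\<^sup>G \<rightarrow> (I/U)\<^sup>G \<rightarrow> H\<^sup>1(G, U) \<rightarrow> H\<^sup>1(G, I)\<close> of the long exact sequence.\<close>

theorem invariants_quotient_iso:
  "fixed_points G (\<lambda>g \<xi>. actI g ` \<xi>) (I Mod j ` carrier U) Mod
       ((\<lambda>x. j ` carrier U #>\<^bsub>I\<^esub> x) ` carrier (fixed_points G actI I))
     \<cong> (H1 G U actU)\<lparr>carrier := {\<xi> \<in> carrier (H1 G U actU).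
          \<forall>f\<in>\<xi>. \<exists>a\<in>carrier I. \<forall>g\<in>carrier G. actI g a = j (f g) \<otimes>\<^bsub>I\<^esub> a}\<rparr>"
proof -
  let ?Z = "cocycles1 G U actU" and ?B = "coboundaries1 G U actU" and ?N = "j ` carrier U"
  let ?D = "I\<lparr>carrier := invariant_mod\<rparr>"
  let ?d = "\<lambda>x. ?B #>\<^bsub>?Z\<^esub> connecting_cocycle x"
  interpret D: group ?D
    by (rule I.A.subgroup_imp_group[OF invariant_mod_subgroup])
  have DI: "invariant_mod \<subseteq> carrier I" by (auto simp: invariant_mod_def)
  interpret H: group "H1 G U actU" by (rule U.H1_group)
  have d_hom: "?d \<in> hom ?D (H1 G U actU)"
    using connecting_cocycle_mem
    by (auto simp: hom_def H1_def carrier_FactGroup connecting_cocycle_mult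
        normal.rcos_sum[OF U.coboundaries1_normal])
  have sub: "?N \<subseteq> invariant_mod" using connecting_cocycle_j by auto
  have Dcomm: "comm_group ?D"
    using DI by (intro D.group_comm_groupI) (auto simp: I.A.m_comm subset_iff)
  have "subgroup ?N ?D"
    using range_subgroup sub invariant_mod_subgroup by (simp add: I.A.subgroup_incl)
  then have normal: "?N \<lhd> ?D" using Dcomm comm_group.subgroup_imp_normal by blast
  interpret d: group_hom ?D "H1 G U actU" ?d
    using d_hom by unfold_locales
  have "?N \<subseteq> kernel ?D (H1 G U actU) ?d"
  proof
    fix y assume "y \<in> ?N"
    then obtain u where u: "u \<in> carrier U" "y = j u" by blast
    have "?d y = ?B"
      using connecting_cocycle_j[OF u(1)] connecting_cocycle_mem U.coboundaries1_subgroup u(2)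
        U.cocycles.coset_join2 by simp
    then show "y \<in> kernel ?D (H1 G U actU) ?d"
      using connecting_cocycle_j[OF u(1)] u(2) by (simp add: kernel_def H1_def)
  qed
  then obtain \<delta> where \<delta>_hom: "\<delta> \<in> hom (?D Mod ?N) (H1 G U actU)"
    and \<delta>: "\<And>x. x \<in> invariant_mod \<Longrightarrow> \<delta> (?N #>\<^bsub>?D\<^esub> x) = ?d x"
    using d.FactGroup_universal_kernel[OF normal] by auto
  have coset_eq: "?N #>\<^bsub>?D\<^esub> x = ?N #>\<^bsub>I\<^esub> x" for x by (simp add: r_coset_def)
  have carrier: "carrier (?D Mod ?N) = (\<lambda>x. ?N #>\<^bsub>I\<^esub> x) ` invariant_mod"
    by (simp add: carrier_FactGroup coset_eq)
  have \<delta>': "\<delta> (?N #>\<^bsub>I\<^esub> x) = ?d x" if "x \<in> invariant_mod" for x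
    using \<delta>[OF that] by (simp add: coset_eq)
  interpret Q: group "?D Mod ?N" by (rule normal.factorgroup_is_group[OF normal])
  interpret \<delta>: group_hom "?D Mod ?N" "H1 G U actU" \<delta>
    using \<delta>_hom by unfold_locales
  \<comment> \<open>With the image as target the map is onto, and the first isomorphism theorem
    leaves two tasks: identifying the kernel and identifying the image.\<close>
  let ?H = "(H1 G U actU)\<lparr>carrier := \<delta> ` carrier (?D Mod ?N)\<rparr>"
  have "group ?H" by (rule H.subgroup_imp_group[OF \<delta>.img_is_subgroup])
  then have "group_hom (?D Mod ?N) ?H \<delta>"
    using \<delta>_hom Q.is_group by (auto simp: group_hom_def group_hom_axioms_def hom_def)
  then have iso: "?D Mod ?N Mod kernel (?D Mod ?N) ?H \<delta> \<cong> ?H"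
    by (rule group_hom.FactGroup_iso) simp

  have fixed: "carrier (fixed_points G actI I) = {x \<in> carrier I. \<forall>g\<in>carrier G. actI g x = x}"
    by (simp add: fixed_points_def)
  have kernel: "kernel (?D Mod ?N) ?H \<delta> =
      (\<lambda>x. ?N #>\<^bsub>I\<^esub> x) ` carrier (fixed_points G actI I)" (is "?l = ?r")
  proof
    show "?l \<subseteq> ?r"
    proof
      fix \<xi> assume "\<xi> \<in> ?l"
      then obtain x where x: "x \<in> invariant_mod" "\<xi> = ?N #>\<^bsub>I\<^esub> x" and "?d x = ?B"
        by (auto simp: kernel_def carrier \<delta>' H1_def)
      then have "connecting_cocycle x \<in> ?B"
        using U.cocycles.coset_join1 connecting_cocycle_mem U.coboundaries1_subgroup by blast
      then obtain u where u: "u \<in> carrier U"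
        "\<forall>g\<in>carrier G. actU g u = connecting_cocycle x g \<otimes>\<^bsub>U\<^esub> u"
        by (auto simp: U.coboundaries1_iff)
      have xc: "x \<in> carrier I" using x DI by blast
      \<comment> \<open>The cocycle of \<open>x\<close> is the coboundary of \<open>u\<close>, so
        dividing \<open>x\<close> by \<open>j u\<close> gives an invariant element in the same
        coset.\<close>
      let ?y = "inv\<^bsub>I\<^esub> (j u) \<otimes>\<^bsub>I\<^esub> x"
      have "actI g ?y = ?y" if g: "g \<in> carrier G" for g
      proof -
        let ?c = "connecting_cocycle x g"
        have c: "?c \<in> carrier U" "actI g x = j ?c \<otimes>\<^bsub>I\<^esub> x" using connecting_cocycle[OF x(1) g] by blast+
        have "actI g (j u) = j ?c \<otimes>\<^bsub>I\<^esub> j u" using u c g j_act[of g u] by simp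
        then have "actI g ?y = inv\<^bsub>I\<^esub> (j ?c \<otimes>\<^bsub>I\<^esub> j u) \<otimes>\<^bsub>I\<^esub> (j ?c \<otimes>\<^bsub>I\<^esub> x)"
          using g u xc c by (simp add: I.act_distrib I.act_inv)
        also have "\<dots> = (inv\<^bsub>I\<^esub> j ?c \<otimes>\<^bsub>I\<^esub> j ?c) \<otimes>\<^bsub>I\<^esub> ?y"
          using c u xc by (simp add: I.A.inv_mult I.A.m_ac del: I.A.l_inv I.A.r_inv)
        finally show ?thesis using c u xc by simp
      qed
      then have "?y \<in> carrier (fixed_points G actI I)" using u xc by (simp add: fixed)
      moreover have "\<xi> = ?N #>\<^bsub>I\<^esub> ?y"
        unfolding x(2)
      proof (rule I.A.repr_independence[OF _ xc range_subgroup])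
        show "?y \<in> ?N #>\<^bsub>I\<^esub> x"
          using u xc by (auto simp: range_coset_iff intro!: bexI[of _ "inv\<^bsub>U\<^esub> u"])
      qed
      ultimately show "\<xi> \<in> ?r" by blast
    qed
    show "?r \<subseteq> ?l"
    proof clarify
      fix x assume "x \<in> carrier (fixed_points G actI I)"
      then have x: "x \<in> carrier I" "\<forall>g\<in>carrier G. actI g x = x" by (auto simp: fixed)
      then have D: "x \<in> invariant_mod"
        by (auto simp: invariant_mod_def intro!: bexI[of _ "\<one>\<^bsub>U\<^esub>"])
      have "connecting_cocycle x = \<one>\<^bsub>?Z\<^esub>"
        using x by (intro connecting_cocycleI) (auto simp: U.cocycles1_one)
      then have "?d x = ?B"
        using U.cocycles.coset_mult_one[OF U.coboundaries1_subset] by simp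
      then show "?N #>\<^bsub>I\<^esub> x \<in> ?l" using D by (auto simp: kernel_def carrier \<delta>' H1_def)
    qed
  qed
  have image: "\<delta> ` carrier (?D Mod ?N) = {\<xi> \<in> carrier (H1 G U actU).
          \<forall>f\<in>\<xi>. \<exists>a\<in>carrier I. \<forall>g\<in>carrier G. actI g a = j (f g) \<otimes>\<^bsub>I\<^esub> a}" (is "?l = ?r")
  proof
    show "?l \<subseteq> ?r"
    proof (unfold carrier, clarify, intro CollectI conjI ballI)
      fix x assume x: "x \<in> invariant_mod"
      then have xc: "x \<in> carrier I" using DI by blast
      show "\<delta> (?N #>\<^bsub>I\<^esub> x) \<in> carrier (H1 G U actU)"
        using x connecting_cocycle_mem by (auto simp: \<delta>' H1_def carrier_FactGroup)
      fix f assume "f \<in> \<delta> (?N #>\<^bsub>I\<^esub> x)"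
      then obtain b where b: "b \<in> ?B" "f = (\<lambda>g\<in>carrier G. b g \<otimes>\<^bsub>U\<^esub> connecting_cocycle x g)"
        unfolding \<delta>'[OF x] by (auto simp: r_coset_def U.cocycles1_mult)
      then obtain u where u: "u \<in> carrier U"
        "\<forall>g\<in>carrier G. b g \<in> carrier U \<and> actU g u = b g \<otimes>\<^bsub>U\<^esub> u"
        by (auto simp: U.coboundaries1_iff)
      \<comment> \<open>A member \<open>f\<close> of the class differs from the cocycle of
        \<open>x\<close> by the coboundary of \<open>u\<close>; multiplying \<open>x\<close> by
        \<open>j u\<close> absorbs that difference.\<close>
      have "actI g (j u \<otimes>\<^bsub>I\<^esub> x) = j (f g) \<otimes>\<^bsub>I\<^esub> (j u \<otimes>\<^bsub>I\<^esub> x)" if g: "g \<in> carrier G" for g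
      proof -
        let ?c = "connecting_cocycle x g"
        have c: "?c \<in> carrier U" "actI g x = j ?c \<otimes>\<^bsub>I\<^esub> x" using connecting_cocycle[OF x g] by blast+
        have "actI g (j u) = j (b g) \<otimes>\<^bsub>I\<^esub> j u" using u g j_act[of g u] by simp
        then have "actI g (j u \<otimes>\<^bsub>I\<^esub> x) = (j (b g) \<otimes>\<^bsub>I\<^esub> j u) \<otimes>\<^bsub>I\<^esub> (j ?c \<otimes>\<^bsub>I\<^esub> x)"
          using u g xc c by (simp add: I.act_distrib)
        then show ?thesis using u g xc c b by (simp add: I.A.m_ac)
      qed
      then show "\<exists>a\<in>carrier I. \<forall>g\<in>carrier G. actI g a = j (f g) \<otimes>\<^bsub>I\<^esub> a"
        using u xc by (intro bexI[of _ "j u \<otimes>\<^bsub>I\<^esub> x"]) auto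
    qed
    show "?r \<subseteq> ?l"
    proof clarify
      fix \<xi> assume \<xi>: "\<xi> \<in> carrier (H1 G U actU)"
        and *: "\<forall>f\<in>\<xi>. \<exists>a\<in>carrier I. \<forall>g\<in>carrier G. actI g a = j (f g) \<otimes>\<^bsub>I\<^esub> a"
      obtain f where f: "f \<in> \<xi>" using U.H1_class_nonempty[OF \<xi>] by blast
      note f' = U.H1_coset[OF \<xi> f]
      obtain a where a: "a \<in> carrier I" "\<forall>g\<in>carrier G. actI g a = j (f g) \<otimes>\<^bsub>I\<^esub> a"
        using * f by blast
      \<comment> \<open>The trivialising element is already the required preimage.\<close>
      have "connecting_cocycle a = f"
        using a f'(1) by (intro connecting_cocycleI) (auto simp: U.cocycles1_iff PiE_iff)
      moreover have "a \<in> invariant_mod"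
        using a U.cocycles1_closed[OF f'(1)] by (auto simp: invariant_mod_def)
      ultimately show "\<xi> \<in> ?l" using f'(2) by (force simp: carrier \<delta>')
    qed
  qed
  show ?thesis
    using iso unfolding kernel unfolding image fixed_points_FactGroup .
qed

end


section \<open>Absolute values and weak approximation\<close>

locale abs_value =
  fixes a :: "'f::field \<Rightarrow> real"
  assumes absolute_value: "absolute_value a"
begin

lemma nonneg [simp]: "a x \<ge> 0"
  and eq_0_iff [simp]: "a x = 0 \<longleftrightarrow> x = 0"
  and mult: "a (x * y) = a x * a y"
  and triangle: "a (x + y) \<le> a x + a y"
  using absolute_value by (auto simp: absolute_value_def)

lemma zero [simp]: "a 0 = 0" by simp

lemma pos_iff [simp]: "a x > 0 \<longleftrightarrow> x \<noteq> 0"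
  by (simp add: less_le)

lemma one [simp]: "a 1 = 1"
  using mult[of 1 1] eq_0_iff[of 1] by simp

lemma power: "a (x ^ n) = a x ^ n"
  by (induction n) (auto simp: mult)

lemma minus [simp]: "a (- x) = a x"
proof -
  have "(a (-1))\<^sup>2 = 1" by (simp add: power[symmetric])
  then have "a (-1) = 1" using nonneg[of "-1"] by (simp add: power2_eq_1_iff)
  then show ?thesis using mult[of "-1" x] by simp
qed

lemma inverse: "a (inverse x) = inverse (a x)"
proof (cases "x = 0")
  case False
  then have "a x * a (inverse x) = 1" by (simp add: mult[symmetric])
  then show ?thesis by (simp add: inverse_unique)
qed auto

lemma divide: "a (x / y) = a x / a y"
  by (simp add: divide_inverse mult inverse)

lemma power_int: "a (x powi m) = a x powi m"
  by (simp add: power_int_def power inverse)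

lemma diff: "a (x - y) \<le> a x + a y"
  using triangle[of x "- y"] by simp

lemma diff_commute: "a (x - y) = a (y - x)"
  using minus[of "x - y"] by simp

lemma reverse_triangle: "\<bar>a x - a y\<bar> \<le> a (x - y)"
  using triangle[of "x - y" y] triangle[of "y - x" x] diff_commute[of x y] by simp

lemma sum: "a (\<Sum>i\<in>I. f i) \<le> (\<Sum>i\<in>I. a (f i))"
proof (induction I rule: infinite_finite_induct)
  case (insert i I)
  then show ?case using triangle[of "f i" "sum f I"] by simp
qed auto

text \<open>A value above 1 has unbounded powers, so every value is at most 1; the inverse of
  \<open>x\<close> gives the opposite bound.\<close>

lemma bounded_imp_trivial:
  assumes bound: "\<And>x. a x \<le> M" and "x \<noteq> 0"
  shows "a x = 1"
proof -
  have le: "a y \<le> 1" for y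
  proof (rule ccontr)
    assume "\<not> a y \<le> 1"
    then obtain n where "M < a y ^ n" using real_arch_pow[of "a y" M] by auto
    then show False using bound[of "y ^ n"] by (simp add: power)
  qed
  have "inverse (a x) \<le> 1" using le[of "inverse x"] by (simp add: inverse)
  then show ?thesis
    using le[of x] \<open>x \<noteq> 0\<close> by (metis antisym inverse_le_1_iff not_le pos_iff)
qed

text \<open>The fraction formed from the powers of \<open>x\<close> tends to 0 where
  \<open>x\<close> has value below 1 and, by the next lemma, to 1 where the value exceeds 1. It
  serves as an approximate idempotent in weak approximation. Here the denominator has value at least
  1 minus a null sequence.\<close>

lemma tendsto_power_fraction_0:
  assumes "a x < 1"
  shows "(\<lambda>n. a (x ^ n / (1 + x ^ n))) \<longlonglongrightarrow> 0"
proof (rule tendsto_sandwich[OF _ _ tendsto_const])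
  have p: "(\<lambda>n. a x ^ n) \<longlonglongrightarrow> 0" using assms by (intro LIMSEQ_realpow_zero) auto
  then have "(\<lambda>n. a x ^ n / (1 - a x ^ n)) \<longlonglongrightarrow> 0 / (1 - 0)"
    by (intro tendsto_divide tendsto_diff tendsto_const) auto
  then show "(\<lambda>n. a x ^ n / (1 - a x ^ n)) \<longlonglongrightarrow> 0" by simp
  have "eventually (\<lambda>n. a x ^ n < 1) sequentially"
    by (rule order_tendstoD(2)[OF p]) simp
  then show "eventually (\<lambda>n. a (x ^ n / (1 + x ^ n)) \<le> a x ^ n / (1 - a x ^ n)) sequentially"
  proof eventually_elim
    case (elim n)
    have "1 - a x ^ n \<le> a (1 + x ^ n)"
      using reverse_triangle[of 1 "- (x ^ n)"] by (simp add: power)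
    then show ?case using elim by (auto simp: divide power intro!: divide_left_mono mult_pos_pos)
  qed
qed auto

text \<open>Up to sign, the distance of the fraction from 1 is the same fraction formed from the
  inverse of \<open>x\<close>, which has value below 1.\<close>

lemma tendsto_power_fraction_1:
  assumes "a x > 1"
  shows "(\<lambda>n. a (x ^ n / (1 + x ^ n) - 1)) \<longlonglongrightarrow> 0"
proof -
  have x: "x \<noteq> 0" using assms by auto
  have "a (inverse x) < 1" using assms by (simp add: inverse inverse_less_1_iff)
  then have p: "(\<lambda>n. a (inverse x ^ n / (1 + inverse x ^ n))) \<longlonglongrightarrow> 0"
    by (rule tendsto_power_fraction_0)
  have "eventually (\<lambda>n. a (inverse x ^ n / (1 + inverse x ^ n)) = a (x ^ n / (1 + x ^ n) - 1)) sequentially"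
    using eventually_gt_at_top[of 0]
  proof eventually_elim
    case (elim n)
    \<comment> \<open>For \<open>n = 0\<close> the denominator is 2, which may vanish in a general
      field; hence only positive \<open>n\<close> are considered.\<close>
    have ne: "1 + x ^ n \<noteq> 0"
    proof
      assume "1 + x ^ n = 0"
      then have "x ^ n = - 1" by (simp add: eq_neg_iff_add_eq_0 add.commute)
      then have "a x ^ n = 1" by (simp flip: power)
      then show False using one_less_power[OF assms elim] by simp
    qed
    have "inverse x ^ n / (1 + inverse x ^ n) = 1 / (1 + x ^ n)"
      using x ne by (simp add: field_simps)
    also have "\<dots> = - (x ^ n / (1 + x ^ n) - 1)" using ne by (simp add: field_simps)
    finally show ?case by (metis minus)
  qed
  then show ?thesis using p by (rule Lim_transform_eventually[rotated])
qed

end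

section \<open>Primes as classes of absolute values\<close>

lemma nontrivial_absolute_value_gt_1:
  assumes "a \<in> nontrivial_absolute_values"
  obtains x where "a x > 1"
proof -
  interpret abs_value a
    using assms by unfold_locales (simp add: nontrivial_absolute_values_def)
  obtain x where x: "x \<noteq> 0" "a x \<noteq> 1" using assms by (auto simp: nontrivial_absolute_values_def)
  show thesis
  proof (cases "a x > 1")
    case False
    then have "a (inverse x) > 1" using x by (simp add: inverse one_less_inverse_iff)
    then show thesis by (rule that)
  qed (rule that)
qed

lemma ln_power_int: "x > 0 \<Longrightarrow> ln (x powi m) = real_of_int m * ln x"
  by (simp add: ln_powr flip: powr_real_of_int')

text \<open>The logarithms of \<open>a\<close> and \<open>b\<close> are proportional. If the ratios
  of logarithms of \<open>x\<close> and \<open>y\<close> differed in the wrong direction, a rational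
  \<open>m / n\<close> strictly between them would make \<open>x ^ n / y powi m\<close> of
  \<open>a\<close>-value below 1 and \<open>b\<close>-value above 1, against \<open>less\<close>.
  The other direction follows with the inverse of \<open>x\<close>, and the exponent is the quotient
  of the logarithms at \<open>y\<close>.\<close>

lemma absolute_value_powr_of_less_1:
  assumes a: "absolute_value a" and b: "absolute_value b"
    and y: "a y > 1"
    and less: "\<And>x. a x < 1 \<Longrightarrow> b x < 1"
  shows "\<exists>s>0. \<forall>x. b x = a x powr s"
proof -
  interpret a: abs_value a by unfold_locales (rule a)
  interpret b: abs_value b by unfold_locales (rule b)
  have y0: "y \<noteq> 0" using y by auto
  have "b (inverse y) < 1" by (rule less) (use y in \<open>simp add: a.inverse inverse_less_1_iff\<close>)
  then have by1: "b y > 1" using y0 by (simp add: b.inverse inverse_less_1_iff split: if_splits)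
       (metis b.nonneg b.pos_iff not_le)
  define s where "s = ln (b y) / ln (a y)"
  have lny: "ln (a y) > 0" "ln (b y) > 0" using y by1 by (auto intro: ln_gt_zero simp del: ln_gt_zero_iff)
  have le: "ln (b x) / ln (b y) \<le> ln (a x) / ln (a y)" if x: "x \<noteq> 0" for x
  proof (rule ccontr)
    assume "\<not> ?thesis"
    then obtain q where "q \<in> \<rat>" and q: "ln (a x) / ln (a y) < q" "q < ln (b x) / ln (b y)"
      using Rats_dense_in_real by (meson not_le)
    then obtain m n where mn: "n > 0" "q = real_of_int m / real n"
      unfolding Rats_eq_int_div_nat by auto
    let ?z = "x ^ n / y powi m"
    have lna: "ln (a ?z) = real n * ln (a x) - real_of_int m * ln (a y)"
      using x y0 y by (simp add: a.divide a.power a.power_int ln_div ln_realpow ln_power_int)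
    have lnb: "ln (b ?z) = real n * ln (b x) - real_of_int m * ln (b y)"
      using x y0 by1 by (simp add: b.divide b.power b.power_int ln_div ln_realpow ln_power_int)
    have z0: "?z \<noteq> 0" using x y0 by simp
    have "ln (a ?z) < 0" using q(1) lny mn by (simp add: lna field_simps)
    then have "a ?z < 1" using z0 by (metis a.pos_iff ln_less_zero_iff)
    then have "b ?z < 1" by (rule less)
    then have "ln (b ?z) < 0" using z0 by (metis b.pos_iff ln_less_zero_iff)
    moreover have "ln (b ?z) > 0" using q(2) lny mn by (simp add: lnb field_simps)
    ultimately show False by simp
  qed
  have eq: "ln (b x) = s * ln (a x)" if x: "x \<noteq> 0" for x
  proof -
    have "- (ln (b x) / ln (b y)) \<le> - (ln (a x) / ln (a y))"
      using le[of "inverse x"] x by (simp add: a.inverse b.inverse ln_inverse)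
    then have "ln (b x) / ln (b y) = ln (a x) / ln (a y)" using le[OF x] by simp
    then show ?thesis using lny by (simp add: s_def field_simps)
  qed
  have "b x = a x powr s" for x
  proof (cases "x = 0")
    case False
    then have "b x = exp (ln (b x))" by simp
    then show ?thesis using eq[OF False] False by (simp add: powr_def)
  qed auto
  moreover have "s > 0" using lny by (simp add: s_def)
  ultimately show ?thesis by blast
qed

lemma equiv_absolute_value_equiv: "equiv nontrivial_absolute_values absolute_value_equiv"
proof (rule equivI)
  have nn: "a x \<ge> 0" if "a \<in> nontrivial_absolute_values" for a :: "'a \<Rightarrow> real" and x
    using that by (auto simp: nontrivial_absolute_values_def absolute_value_def)
  show "absolute_value_equiv \<subseteq> nontrivial_absolute_values \<times> nontrivial_absolute_values"
    by (auto simp: absolute_value_equiv_def)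
  show "refl_on (nontrivial_absolute_values :: ('a \<Rightarrow> real) set) absolute_value_equiv"
  proof (rule refl_onI)
    fix a :: "'a \<Rightarrow> real" assume a: "a \<in> nontrivial_absolute_values"
    then have "(1::real) > 0 \<and> (\<forall>x. a x = a x powr 1)" by (simp add: nn)
    then show "(a, a) \<in> absolute_value_equiv" using a unfolding absolute_value_equiv_def by blast
  qed
  show "sym (absolute_value_equiv :: (('a \<Rightarrow> real) \<times> ('a \<Rightarrow> real)) set)"
  proof (rule symI)
    fix a b :: "'a \<Rightarrow> real" assume "(a, b) \<in> absolute_value_equiv"
    then obtain s where *: "a \<in> nontrivial_absolute_values" "b \<in> nontrivial_absolute_values"
      "s > 0" "\<forall>x. b x = a x powr s" by (auto simp: absolute_value_equiv_def)
    then have "1 / s > 0 \<and> (\<forall>x. a x = b x powr (1 / s))" by (simp add: powr_powr nn)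
    then show "(b, a) \<in> absolute_value_equiv" using * unfolding absolute_value_equiv_def by blast
  qed
  show "trans (absolute_value_equiv :: (('a \<Rightarrow> real) \<times> ('a \<Rightarrow> real)) set)"
  proof (rule transI)
    fix a b c :: "'a \<Rightarrow> real" assume "(a, b) \<in> absolute_value_equiv" "(b, c) \<in> absolute_value_equiv"
    then obtain s t where *: "a \<in> nontrivial_absolute_values" "c \<in> nontrivial_absolute_values"
      "s > 0" "\<forall>x. b x = a x powr s" "t > 0" "\<forall>x. c x = b x powr t"
      by (auto simp: absolute_value_equiv_def)
    then have "s * t > 0 \<and> (\<forall>x. c x = a x powr (s * t))" by (simp add: powr_powr)
    then show "(a, c) \<in> absolute_value_equiv" using * unfolding absolute_value_equiv_def by blast
  qed
qed

lemma absolute_value_equiv_class_in_places: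
  "a \<in> nontrivial_absolute_values \<Longrightarrow> absolute_value_equiv `` {a} \<in> places"
  by (simp add: places_def quotientI)

lemma place_eq_class:
  assumes "v \<in> places" "a \<in> v"
  shows "a \<in> nontrivial_absolute_values" "v = absolute_value_equiv `` {a}"
proof -
  obtain b where "v = absolute_value_equiv `` {b}" "b \<in> nontrivial_absolute_values"
    using assms(1) by (auto simp: places_def elim: quotientE)
  then have b: "(b, a) \<in> absolute_value_equiv" "v = absolute_value_equiv `` {b}" using assms(2) by auto
  then show "a \<in> nontrivial_absolute_values" by (auto simp: absolute_value_equiv_def)
  show "v = absolute_value_equiv `` {a}"
    using equiv_class_eq[OF equiv_absolute_value_equiv b(1)] b(2) by simp
qed

lemma place_abs_mem: "v \<in> places \<Longrightarrow> place_abs v \<in> v"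
  unfolding place_abs_def places_def
  by (metis equiv_absolute_value_equiv equiv_class_self quotientE someI_ex)

lemma place_abs_nontrivial: "v \<in> places \<Longrightarrow> place_abs v \<in> nontrivial_absolute_values"
  using place_abs_mem place_eq_class by blast

lemma abs_value_place_abs: "v \<in> places \<Longrightarrow> abs_value (place_abs v)"
  using place_abs_nontrivial by (auto simp: abs_value_def nontrivial_absolute_values_def)

lemma place_eq_iff:
  assumes "v \<in> places" "w \<in> places"
  shows "v = w \<longleftrightarrow> (\<exists>s>0. \<forall>x. place_abs w x = place_abs v x powr s)"
proof -
  have "v = w \<longleftrightarrow> (place_abs v, place_abs w) \<in> absolute_value_equiv"
    using place_eq_class(2)[OF assms(1) place_abs_mem[OF assms(1)]]
      place_eq_class(2)[OF assms(2) place_abs_mem[OF assms(2)]]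
      eq_equiv_class_iff[OF equiv_absolute_value_equiv place_abs_nontrivial place_abs_nontrivial]
      assms by metis
  then show ?thesis using assms by (simp add: absolute_value_equiv_def place_abs_nontrivial)
qed

section \<open>Separation of primes and weak approximation\<close>

text \<open>By the preceding criterion distinct primes violate the implication between "value below
  1" in both directions. This provides \<open>x\<close> small at \<open>v\<close> but not at
  \<open>w\<close>, and \<open>y\<close> small at \<open>w\<close> but not at \<open>v\<close>; the
  quotient \<open>y / x\<close> separates strictly.\<close>

lemma places_separated:
  assumes v: "v \<in> places" and w: "w \<in> places" and "v \<noteq> w"
  obtains x where "place_abs v x > 1" "place_abs w x < 1"
proof -
  have sep: "\<exists>u. place_abs v u < 1 \<and> place_abs w u \<ge> 1"
    if vw: "v \<in> places" "w \<in> places" "v \<noteq> w" for v w :: "'a place"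
  proof (rule ccontr)
    assume *: "\<not> ?thesis"
    obtain y where "place_abs v y > 1"
      using nontrivial_absolute_value_gt_1[OF place_abs_nontrivial[OF vw(1)]] by blast
    then have "\<exists>s>0. \<forall>x. place_abs w x = place_abs v x powr s"
      using * vw abs_value_place_abs
      by (intro absolute_value_powr_of_less_1[of _ _ y]) (auto simp: abs_value_def not_le)
    then show False using place_eq_iff vw by blast
  qed
  interpret v: abs_value "place_abs v" by (rule abs_value_place_abs[OF v])
  interpret w: abs_value "place_abs w" by (rule abs_value_place_abs[OF w])
  obtain x y where xy: "place_abs v x < 1" "place_abs w x \<ge> 1" "place_abs w y < 1" "place_abs v y \<ge> 1"
    using sep[OF v w \<open>v \<noteq> w\<close>] sep[OF w v] \<open>v \<noteq> w\<close> by blast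
  then have "x \<noteq> 0" by auto
  then have "place_abs v x > 0" by simp
  then have "place_abs v (y / x) > 1" "place_abs w (y / x) < 1"
    using xy by (auto simp: v.divide w.divide field_simps)
  then show thesis by (rule that)
qed

text \<open>The induction of Artin and Whaples. Let \<open>x\<close> separate \<open>v\<close> from
  \<open>T\<close> and \<open>y\<close> separate \<open>v\<close> from the new prime
  \<open>w\<close>. If \<open>x\<close> has value below 1 at \<open>w\<close>, it already works. If
  the value is 1, then \<open>x ^ n * y\<close> works for large \<open>n\<close>. If it is above 1,
  the power is replaced by the fraction \<open>x ^ n / (1 + x ^ n)\<close>, which tends to 1 at
  \<open>v\<close> and \<open>w\<close> and to 0 on \<open>T\<close>.\<close>

lemma places_separated_finite:
  assumes v: "v \<in> places" and T: "finite T" "T \<subseteq> places - {v}"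
  shows "\<exists>x. place_abs v x > 1 \<and> (\<forall>w\<in>T. place_abs w x < 1)"
  using T
proof (induction T)
  case empty
  then show ?case using nontrivial_absolute_value_gt_1[OF place_abs_nontrivial[OF v]] by auto
next
  case (insert w T)
  then have w: "w \<in> places" "w \<noteq> v" by auto
  interpret v: abs_value "place_abs v" by (rule abs_value_place_abs[OF v])
  interpret w: abs_value "place_abs w" by (rule abs_value_place_abs[OF w(1)])
  obtain x where x: "place_abs v x > 1" "\<forall>u\<in>T. place_abs u x < 1" using insert by auto
  obtain y where y: "place_abs v y > 1" "place_abs w y < 1"
    using places_separated[OF v w(1)] w(2) by metis
  consider "place_abs w x < 1" | "place_abs w x = 1" | "place_abs w x > 1" by linarith
  then show ?case
  proof cases
    case 1
    then show ?thesis using x by blast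
  next
    case 2
    have "eventually (\<lambda>n. \<forall>u\<in>T. place_abs u (x ^ n * y) < 1) sequentially"
    proof (rule eventually_ball_finite[OF insert(1)], rule ballI)
      fix u assume u: "u \<in> T"
      then interpret u: abs_value "place_abs u" using insert abs_value_place_abs by auto
      have "(\<lambda>n. place_abs u x ^ n * place_abs u y) \<longlonglongrightarrow> 0 * place_abs u y"
        using x u by (intro tendsto_intros LIMSEQ_realpow_zero) auto
      then show "eventually (\<lambda>n. place_abs u (x ^ n * y) < 1) sequentially"
        by (intro order_tendstoD(2)[of _ 0]) (auto simp: u.mult u.power)
    qed
    then obtain n where n: "\<forall>u\<in>T. place_abs u (x ^ n * y) < 1"
      using eventually_happens'[OF sequentially_bot] by blast
    moreover have "place_abs v (x ^ n * y) > 1"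
      using y(1) mult_right_mono[OF one_le_power[of "place_abs v x" n], of "place_abs v y"] x(1)
      by (simp add: v.mult v.power)
    moreover have "place_abs w (x ^ n * y) < 1"
      using 2 y(2) by (simp add: w.mult w.power)
    ultimately show ?thesis by blast
  next
    case 3
    let ?e = "\<lambda>n. x ^ n / (1 + x ^ n)"
    \<comment> \<open>Where \<open>x\<close> has value above 1 the factor tends to 1, so any open
      condition satisfied by the value of \<open>y\<close> is eventually inherited. It is used at
      \<open>v\<close> for being above 1 and at \<open>w\<close> for being below 1.\<close>
    have one: "eventually (\<lambda>n. place_abs u (?e n * y) \<in> S) sequentially"
      if u: "u \<in> places" and "place_abs u x > 1" "open S" "place_abs u y \<in> S" for u S
    proof -
      interpret u: abs_value "place_abs u" using u by (rule abs_value_place_abs)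
      have "(\<lambda>n. place_abs u (?e n)) \<longlonglongrightarrow> 1"
      proof (rule tendsto_dist_iff[THEN iffD2], rule tendsto_sandwich[OF _ _ tendsto_const])
        show "(\<lambda>n. place_abs u (?e n - 1)) \<longlonglongrightarrow> 0"
          using that by (intro u.tendsto_power_fraction_1)
        show "eventually (\<lambda>n. dist (place_abs u (?e n)) 1 \<le> place_abs u (?e n - 1)) sequentially"
          using u.reverse_triangle[of _ 1] by (simp add: dist_real_def)
      qed auto
      then have "(\<lambda>n. place_abs u (?e n) * place_abs u y) \<longlonglongrightarrow> 1 * place_abs u y"
        by (intro tendsto_intros)
      then have "(\<lambda>n. place_abs u (?e n * y)) \<longlonglongrightarrow> place_abs u y" by (simp only: u.mult mult_1)
      then show ?thesis using that by (auto dest: topological_tendstoD)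
    qed
    have "eventually (\<lambda>n. \<forall>u\<in>T. place_abs u (?e n * y) < 1) sequentially"
    proof (rule eventually_ball_finite[OF insert(1)], rule ballI)
      fix u assume u: "u \<in> T"
      then interpret u: abs_value "place_abs u" using insert abs_value_place_abs by auto
      have "(\<lambda>n. place_abs u (?e n) * place_abs u y) \<longlonglongrightarrow> 0 * place_abs u y"
        using x u by (intro tendsto_intros u.tendsto_power_fraction_0) auto
      then have "(\<lambda>n. place_abs u (?e n * y)) \<longlonglongrightarrow> 0" by (simp only: u.mult mult_zero_left)
      then show "eventually (\<lambda>n. place_abs u (?e n * y) < 1) sequentially"
        by (rule order_tendstoD(2)) simp
    qed
    moreover have "eventually (\<lambda>n. place_abs v (?e n * y) \<in> {1<..}) sequentially"
      using x y by (intro one[OF v]) auto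
    moreover have "eventually (\<lambda>n. place_abs w (?e n * y) \<in> {..<1}) sequentially"
      using 3 y by (intro one[OF w(1)]) auto
    ultimately have "eventually (\<lambda>n. place_abs v (?e n * y) > 1 \<and>
        (\<forall>u\<in>insert w T. place_abs u (?e n * y) < 1)) sequentially"
      by eventually_elim auto
    then show ?thesis using eventually_happens'[OF sequentially_bot] by blast
  qed
qed

text \<open>The element separating \<open>w\<close> from the rest of \<open>T\<close> yields
  fractions tending to 1 at \<open>w\<close> and to 0 at the other primes of \<open>T\<close>.
  Weighting them with the targets \<open>t w\<close> and adding gives the approximation, as in the
  Chinese remainder theorem.\<close>

lemma weak_approximation_eps:
  assumes T: "finite T" "T \<subseteq> places" and "e > 0"
  shows "\<exists>y. \<forall>v\<in>T. place_abs v (y - t v) < e"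
proof -
  have "\<forall>v\<in>T. \<exists>x. place_abs v x > 1 \<and> (\<forall>w\<in>T - {v}. place_abs w x < 1)"
    using T by (intro ballI places_separated_finite) auto
  then obtain x where x: "\<And>v. v \<in> T \<Longrightarrow> place_abs v (x v) > 1"
    "\<And>v w. v \<in> T \<Longrightarrow> w \<in> T \<Longrightarrow> w \<noteq> v \<Longrightarrow> place_abs w (x v) < 1"
    unfolding bchoice_iff by blast
  let ?e = "\<lambda>v n. x v ^ n / (1 + x v ^ n)"
  let ?y = "\<lambda>n. \<Sum>w\<in>T. t w * ?e w n"
  have "eventually (\<lambda>n. \<forall>v\<in>T. place_abs v (?y n - t v) < e) sequentially"
  proof (rule eventually_ball_finite[OF T(1)], rule ballI)
    fix v assume v: "v \<in> T"
    then interpret abs_value "place_abs v" using T abs_value_place_abs by auto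
    let ?d = "\<lambda>w. if w = v then 1 else 0"
    have lim: "(\<lambda>n. place_abs v (?e w n - ?d w)) \<longlonglongrightarrow> 0" if "w \<in> T" for w
      using that v x tendsto_power_fraction_0[of "x w"] tendsto_power_fraction_1[of "x w"] by auto
    have "(\<lambda>n. \<Sum>w\<in>T. place_abs v (t w) * place_abs v (?e w n - ?d w)) \<longlonglongrightarrow>
        (\<Sum>w\<in>T. place_abs v (t w) * 0)"
      using lim by (intro tendsto_intros)
    then have "eventually (\<lambda>n. (\<Sum>w\<in>T. place_abs v (t w) * place_abs v (?e w n - ?d w)) < e) sequentially"
      using \<open>e > 0\<close> by (intro order_tendstoD(2)[of _ 0]) auto
    then show "eventually (\<lambda>n. place_abs v (?y n - t v) < e) sequentially"
    proof eventually_elim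
      case (elim n)
      have "t v = (\<Sum>w\<in>T. t w * ?d w)" using v T(1) by (simp add: if_distrib cong: if_cong)
      then have "?y n - t v = (\<Sum>w\<in>T. t w * (?e w n - ?d w))"
        by (simp add: sum_subtractf right_diff_distrib)
      then have "place_abs v (?y n - t v) \<le> (\<Sum>w\<in>T. place_abs v (t w * (?e w n - ?d w)))"
        by (simp only: sum)
      then show ?case using elim by (simp add: mult)
    qed
  qed
  then show ?thesis using eventually_happens'[OF sequentially_bot] by blast
qed

text \<open>Term \<open>n\<close> is approximated at all primes of \<open>T\<close> with error below
  \<open>1 / (n + 1)\<close>, so a single sequence of field elements agrees with each prescribed
  sequence up to a null sequence.\<close>

theorem weak_approximation:
  assumes T: "finite T" "T \<subseteq> places"
  obtains y where "\<And>v. v \<in> T \<Longrightarrow> (\<lambda>n. y n - x v n) \<in> null_ideal v"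
proof -
  have "\<exists>y. \<forall>v\<in>T. place_abs v (y - x v n) < inverse (real (Suc n))" for n
    using weak_approximation_eps[OF T, of _ "\<lambda>v. x v n"] by simp
  then obtain y where y: "\<And>n v. v \<in> T \<Longrightarrow> place_abs v (y n - x v n) < inverse (real (Suc n))"
    by metis
  show thesis
  proof (rule that)
    fix v assume v: "v \<in> T"
    then interpret abs_value "place_abs v" using T abs_value_place_abs by auto
    show "(\<lambda>n. y n - x v n) \<in> null_ideal v"
      unfolding null_ideal_def mem_Collect_eq
      using y[OF v] by (intro tendsto_sandwich[OF _ _ tendsto_const LIMSEQ_inverse_real_of_nat])
        (auto intro!: always_eventually less_imp_le)
  qed
qed


section \<open>Completions\<close>

abbreviation completion_class :: "'f::field place \<Rightarrow> (nat \<Rightarrow> 'f) \<Rightarrow> (nat \<Rightarrow> 'f) set" where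
  "completion_class v x \<equiv> null_ideal v +>\<^bsub>cauchy_ring v\<^esub> x"

lemma carrier_cauchy_ring: "x \<in> carrier (cauchy_ring v) \<longleftrightarrow>
    (\<forall>e>0. \<exists>N. \<forall>m\<ge>N. \<forall>n\<ge>N. place_abs v (x m - x n) < e)"
  by (simp add: cauchy_ring_def)

lemma cauchy_ring_simps [simp]:
  "x \<otimes>\<^bsub>cauchy_ring v\<^esub> y = (\<lambda>n. x n * y n)" "\<one>\<^bsub>cauchy_ring v\<^esub> = (\<lambda>n. 1)"
  "x \<oplus>\<^bsub>cauchy_ring v\<^esub> y = (\<lambda>n. x n + y n)" "\<zero>\<^bsub>cauchy_ring v\<^esub> = (\<lambda>n. 0)"
  by (simp_all add: cauchy_ring_def)

lemma completion_class_iff: "y \<in> completion_class v x \<longleftrightarrow> (\<lambda>n. y n - x n) \<in> null_ideal v"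
proof
  assume "(\<lambda>n. y n - x n) \<in> null_ideal v"
  then show "y \<in> completion_class v x"
    by (auto simp: a_r_coset_def r_coset_def cauchy_ring_def
        intro!: bexI[of _ "\<lambda>n. y n - x n"])
qed (auto simp: a_r_coset_def r_coset_def cauchy_ring_def)

section \<open>The completion at one prime\<close>

locale place =
  fixes v :: "'f::field place"
  assumes place: "v \<in> places"
begin

sublocale abs_value "place_abs v"
  by (rule abs_value_place_abs[OF place])

lemma null_zero: "(\<lambda>n. 0) \<in> null_ideal v"
  by (simp add: null_ideal_def)

lemma null_add:
  assumes "x \<in> null_ideal v" "y \<in> null_ideal v"
  shows "(\<lambda>n. x n + y n) \<in> null_ideal v"
  unfolding null_ideal_def mem_Collect_eq
proof (rule tendsto_sandwich[OF _ _ tendsto_const])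
  show "(\<lambda>n. place_abs v (x n) + place_abs v (y n)) \<longlonglongrightarrow> 0"
    using tendsto_add[of _ 0 _ _ 0] assms by (auto simp: null_ideal_def)
qed (auto simp: triangle)

lemma null_minus: "x \<in> null_ideal v \<Longrightarrow> (\<lambda>n. - x n) \<in> null_ideal v"
  by (simp add: null_ideal_def)

lemma null_diff:
  "x \<in> null_ideal v \<Longrightarrow> y \<in> null_ideal v \<Longrightarrow> (\<lambda>n. x n - y n) \<in> null_ideal v"
  using null_add[OF _ null_minus] by simp

lemma null_sum:
  assumes "\<And>i. i \<in> A \<Longrightarrow> x i \<in> null_ideal v"
  shows "(\<lambda>n. \<Sum>i\<in>A. x i n) \<in> null_ideal v"
  using assms by (induction A rule: infinite_finite_induct) (auto simp: null_zero null_add)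

lemma null_cmult:
  assumes "x \<in> null_ideal v"
  shows "(\<lambda>n. c * x n) \<in> null_ideal v"
  using assms tendsto_mult_left[of "\<lambda>n. place_abs v (x n)" 0 sequentially "place_abs v c"]
  by (simp add: null_ideal_def mult)

lemma null_diff_commute:
  "(\<lambda>n. x n - y n) \<in> null_ideal v \<longleftrightarrow> (\<lambda>n. y n - x n) \<in> null_ideal v"
  by (simp add: null_ideal_def diff_commute)

lemma null_diff_trans:
  assumes "(\<lambda>n. x n - y n) \<in> null_ideal v" "(\<lambda>n. y n - z n) \<in> null_ideal v"
  shows "(\<lambda>n. x n - z n) \<in> null_ideal v"
  using null_add[OF assms] by simp

lemma completion_class_eq_iff:
  "completion_class v x = completion_class v y \<longleftrightarrow> (\<lambda>n. x n - y n) \<in> null_ideal v"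
proof
  assume "completion_class v x = completion_class v y"
  moreover have "x \<in> completion_class v x" by (simp add: completion_class_iff null_zero)
  ultimately show "(\<lambda>n. x n - y n) \<in> null_ideal v" by (simp add: completion_class_iff)
next
  assume *: "(\<lambda>n. x n - y n) \<in> null_ideal v"
  then have "(\<lambda>n. z n - x n) \<in> null_ideal v \<longleftrightarrow> (\<lambda>n. z n - y n) \<in> null_ideal v" for z
    using null_diff_trans[of z x y] null_diff_trans[of z y x] null_diff_commute by blast
  then show "completion_class v x = completion_class v y"
    by (auto simp: completion_class_iff)
qed

lemma cauchy_abs_convergent:
  assumes "x \<in> carrier (cauchy_ring v)"
  shows "convergent (\<lambda>n. place_abs v (x n))"
proof (rule Cauchy_convergent, rule CauchyI)
  fix e :: real assume "e > 0"
  then obtain N where N: "\<forall>m\<ge>N. \<forall>n\<ge>N. place_abs v (x m - x n) < e"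
    using assms by (auto simp: carrier_cauchy_ring)
  have "norm (place_abs v (x m) - place_abs v (x n)) < e" if "m \<ge> N" "n \<ge> N" for m n
    using N that reverse_triangle[of "x m" "x n"] by fastforce
  then show "\<exists>M. \<forall>m\<ge>M. \<forall>n\<ge>M. norm (place_abs v (x m) - place_abs v (x n)) < e" by blast
qed

lemma cauchy_bounded:
  assumes "x \<in> carrier (cauchy_ring v)"
  obtains M where "M > 0" "\<And>n. place_abs v (x n) \<le> M"
  using convergent_imp_Bseq[OF cauchy_abs_convergent[OF assms]] by (auto simp: Bseq_def)

lemma null_mult:
  assumes x: "x \<in> null_ideal v" and y: "y \<in> carrier (cauchy_ring v)"
  shows "(\<lambda>n. x n * y n) \<in> null_ideal v"
proof -
  obtain M where M: "\<And>n. place_abs v (y n) \<le> M" using cauchy_bounded[OF y] by metis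
  show ?thesis
    unfolding null_ideal_def mem_Collect_eq
  proof (rule tendsto_sandwich[OF _ _ tendsto_const])
    show "(\<lambda>n. place_abs v (x n) * M) \<longlonglongrightarrow> 0"
      using x tendsto_mult_right[of _ 0 _ M] by (auto simp: null_ideal_def)
    show "eventually (\<lambda>n. place_abs v (x n * y n) \<le> place_abs v (x n) * M) sequentially"
      using M by (auto simp: mult intro!: always_eventually mult_left_mono)
  qed auto
qed

lemma cauchy_const [simp]: "(\<lambda>n. c) \<in> carrier (cauchy_ring v)"
  by (simp add: carrier_cauchy_ring)

lemma cauchy_add:
  assumes "x \<in> carrier (cauchy_ring v)" "y \<in> carrier (cauchy_ring v)"
  shows "(\<lambda>n. x n + y n) \<in> carrier (cauchy_ring v)"
  unfolding carrier_cauchy_ring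
proof (intro allI impI)
  fix e :: real assume "e > 0"
  then have "e / 2 > 0" by simp
  then obtain N N' where N: "\<forall>m\<ge>N. \<forall>n\<ge>N. place_abs v (x m - x n) < e / 2"
      "\<forall>m\<ge>N'. \<forall>n\<ge>N'. place_abs v (y m - y n) < e / 2"
    using assms unfolding carrier_cauchy_ring by metis
  have "place_abs v (x m + y m - (x n + y n)) < e" if "m \<ge> max N N'" "n \<ge> max N N'" for m n
  proof -
    have "place_abs v (x m - x n) < e / 2" "place_abs v (y m - y n) < e / 2" using N that by auto
    then show ?thesis
      using triangle[of "x m - x n" "y m - y n"] by (simp add: algebra_simps)
  qed
  then show "\<exists>N. \<forall>m\<ge>N. \<forall>n\<ge>N. place_abs v (x m + y m - (x n + y n)) < e" by blast
qed

lemma cauchy_minus: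
  assumes "x \<in> carrier (cauchy_ring v)"
  shows "(\<lambda>n. - x n) \<in> carrier (cauchy_ring v)"
proof -
  have "place_abs v (- x m - - x n) = place_abs v (x m - x n)" for m n
    using diff_commute[of "x m" "x n"] by simp
  then show ?thesis using assms by (simp add: carrier_cauchy_ring)
qed

lemma cauchy_mult:
  assumes x: "x \<in> carrier (cauchy_ring v)" and y: "y \<in> carrier (cauchy_ring v)"
  shows "(\<lambda>n. x n * y n) \<in> carrier (cauchy_ring v)"
  unfolding carrier_cauchy_ring
proof (intro allI impI)
  fix e :: real assume e: "e > 0"
  obtain M M' where M: "M > 0" "\<And>n. place_abs v (x n) \<le> M" "M' > 0" "\<And>n. place_abs v (y n) \<le> M'"
    using cauchy_bounded[OF x] cauchy_bounded[OF y] by metis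
  have "e / (2 * M) > 0" "e / (2 * M') > 0" using e M by auto
  then obtain N N' where N: "\<forall>m\<ge>N. \<forall>n\<ge>N. place_abs v (x m - x n) < e / (2 * M')"
      "\<forall>m\<ge>N'. \<forall>n\<ge>N'. place_abs v (y m - y n) < e / (2 * M)"
    using assms unfolding carrier_cauchy_ring by metis
  have "place_abs v (x m * y m - x n * y n) < e" if "m \<ge> max N N'" "n \<ge> max N N'" for m n
  proof -
    have "x m * y m - x n * y n = x m * (y m - y n) + (x m - x n) * y n"
      by (simp add: algebra_simps)
    then have "place_abs v (x m * y m - x n * y n) \<le>
        place_abs v (x m) * place_abs v (y m - y n) + place_abs v (x m - x n) * place_abs v (y n)"
      using triangle[of "x m * (y m - y n)" "(x m - x n) * y n"] by (simp add: mult)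
    also have "\<dots> \<le> M * place_abs v (y m - y n) + place_abs v (x m - x n) * M'"
      using M by (intro add_mono mult_mono) (auto intro: less_imp_le)
    also have "\<dots> < M * (e / (2 * M)) + e / (2 * M') * M'"
      using M N that by (intro add_strict_mono mult_strict_left_mono mult_strict_right_mono) auto
    also have "\<dots> = e" using M by simp
    finally show ?thesis .
  qed
  then show "\<exists>N. \<forall>m\<ge>N. \<forall>n\<ge>N. place_abs v (x m * y m - x n * y n) < e" by blast
qed

lemma null_imp_cauchy:
  assumes "x \<in> null_ideal v"
  shows "x \<in> carrier (cauchy_ring v)"
  unfolding carrier_cauchy_ring
proof (intro allI impI)
  fix e :: real assume "e > 0"
  then have "eventually (\<lambda>n. place_abs v (x n) < e / 2) sequentially"
    using assms by (intro order_tendstoD(2)[of _ 0]) (auto simp: null_ideal_def)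
  then obtain N where "\<forall>n\<ge>N. place_abs v (x n) < e / 2" by (auto simp: eventually_sequentially)
  then have "place_abs v (x m - x n) < e" if "m \<ge> N" "n \<ge> N" for m n
    using that diff[of "x m" "x n"] by (smt (verit) field_sum_of_halves)
  then show "\<exists>N. \<forall>m\<ge>N. \<forall>n\<ge>N. place_abs v (x m - x n) < e" by blast
qed

lemma cauchy_cong:
  assumes "(\<lambda>n. x n - y n) \<in> null_ideal v" "y \<in> carrier (cauchy_ring v)"
  shows "x \<in> carrier (cauchy_ring v)"
  using cauchy_add[OF null_imp_cauchy[OF assms(1)] assms(2)] by simp

lemma cring_cauchy_ring: "cring (cauchy_ring v)"
proof (rule cringI)
  show "abelian_group (cauchy_ring v)"
  proof (rule abelian_groupI)
    fix x assume "x \<in> carrier (cauchy_ring v)"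
    then show "\<exists>y\<in>carrier (cauchy_ring v). y \<oplus>\<^bsub>cauchy_ring v\<^esub> x = \<zero>\<^bsub>cauchy_ring v\<^esub>"
      by (intro bexI[OF _ cauchy_minus]) auto
  qed (auto simp: cauchy_add algebra_simps)
  show "comm_monoid (cauchy_ring v)"
    by (rule comm_monoidI) (auto simp: cauchy_mult algebra_simps)
qed (auto simp: algebra_simps)

lemma ideal_null_ideal: "ideal (null_ideal v) (cauchy_ring v)"
proof -
  interpret R: cring "cauchy_ring v" by (rule cring_cauchy_ring)
  show ?thesis
  proof (rule idealI)
    show "ring (cauchy_ring v)" by (rule R.ring_axioms)
    show "subgroup (null_ideal v) (add_monoid (cauchy_ring v))"
    proof (rule group.subgroupI)
      show "group (add_monoid (cauchy_ring v))" by (rule R.add.is_group)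
      show "null_ideal v \<noteq> {}" using null_zero by blast
      fix x assume x: "x \<in> null_ideal v"
      have "\<ominus>\<^bsub>cauchy_ring v\<^esub> x = (\<lambda>n. - x n)"
        using x by (intro R.minus_equality) (auto simp: null_imp_cauchy null_minus)
      then show "inv\<^bsub>add_monoid (cauchy_ring v)\<^esub> x \<in> null_ideal v"
        using null_minus[OF x] by (simp add: a_inv_def)
    qed (auto simp: null_imp_cauchy null_add)
  next
    fix a x assume "a \<in> null_ideal v" "x \<in> carrier (cauchy_ring v)"
    then show "x \<otimes>\<^bsub>cauchy_ring v\<^esub> a \<in> null_ideal v" "a \<otimes>\<^bsub>cauchy_ring v\<^esub> x \<in> null_ideal v"
      using null_mult[of a x] by (auto simp: mult.commute)
  qed
qed

sublocale completion: cring "completion v"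
  unfolding completion_def by (rule ideal.quotient_is_cring[OF ideal_null_ideal cring_cauchy_ring])

lemma carrier_completion: "carrier (completion v) = completion_class v ` carrier (cauchy_ring v)"
  by (auto simp: completion_def FactRing_def A_RCOSETS_def')

lemma completion_classI [intro]:
  "x \<in> carrier (cauchy_ring v) \<Longrightarrow> completion_class v x \<in> carrier (completion v)"
  by (simp add: carrier_completion)

lemma completionE:
  assumes "\<xi> \<in> carrier (completion v)"
  obtains x where "x \<in> carrier (cauchy_ring v)" "\<xi> = completion_class v x"
  using assms by (auto simp: carrier_completion)

lemma completion_one: "\<one>\<^bsub>completion v\<^esub> = completion_class v (\<lambda>n. 1)"
  by (simp add: completion_def FactRing_def)

lemma completion_mult:
  assumes "x \<in> carrier (cauchy_ring v)" "y \<in> carrier (cauchy_ring v)"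
  shows "completion_class v x \<otimes>\<^bsub>completion v\<^esub> completion_class v y =
    completion_class v (\<lambda>n. x n * y n)"
  using ideal.rcoset_mult_add[OF ideal_null_ideal assms] by (simp add: completion_def FactRing_def)

text \<open>This discharges the definite description in \<open>completion_abs\<close>: values along
  a Cauchy sequence converge, and by the reverse triangle inequality all members of a class share
  the limit.\<close>

lemma completion_abs_tendsto:
  assumes x: "x \<in> carrier (cauchy_ring v)"
  shows "(\<lambda>n. place_abs v (x n)) \<longlonglongrightarrow> completion_abs v (completion_class v x)"
proof -
  obtain r where r: "(\<lambda>n. place_abs v (x n)) \<longlonglongrightarrow> r"
    using cauchy_abs_convergent[OF x] by (auto simp: convergent_def)
  have all: "(\<lambda>n. place_abs v (y n)) \<longlonglongrightarrow> r" if "y \<in> completion_class v x" for y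
  proof (rule Lim_transform2[OF r])
    show "(\<lambda>n. place_abs v (x n) - place_abs v (y n)) \<longlonglongrightarrow> 0"
    proof (rule tendsto_rabs_zero_cancel, rule tendsto_sandwich[OF _ _ tendsto_const])
      show "(\<lambda>n. place_abs v (x n - y n)) \<longlonglongrightarrow> 0"
        using that unfolding completion_class_iff by (subst diff_commute) (simp add: null_ideal_def)
    qed (auto simp: reverse_triangle)
  qed
  have mem: "x \<in> completion_class v x" by (simp add: completion_class_iff null_zero)
  have "completion_abs v (completion_class v x) = r"
    unfolding completion_abs_def
    by (rule the_equality) (use all mem LIMSEQ_unique in blast)+
  then show ?thesis using r by simp
qed

lemma completion_abs_mult:
  assumes "\<xi> \<in> carrier (completion v)" "\<eta> \<in> carrier (completion v)"
  shows "completion_abs v (\<xi> \<otimes>\<^bsub>completion v\<^esub> \<eta>) = completion_abs v \<xi> * completion_abs v \<eta>"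
proof -
  obtain x y where x: "x \<in> carrier (cauchy_ring v)" "\<xi> = completion_class v x"
    and y: "y \<in> carrier (cauchy_ring v)" "\<eta> = completion_class v y"
    using assms completionE by metis
  have "(\<lambda>n. place_abs v (x n * y n)) \<longlonglongrightarrow> completion_abs v \<xi> * completion_abs v \<eta>"
    using tendsto_mult[OF completion_abs_tendsto[OF x(1)] completion_abs_tendsto[OF y(1)]] x y
    by (simp add: mult)
  then show ?thesis
    using completion_abs_tendsto[OF cauchy_mult[OF x(1) y(1)]] x y
    by (simp add: completion_mult LIMSEQ_unique)
qed

lemma completion_abs_const [simp]: "completion_abs v (completion_class v (\<lambda>n. c)) = place_abs v c"
  using completion_abs_tendsto[OF cauchy_const, of c] by (metis LIMSEQ_unique tendsto_const)

lemma completion_abs_nonneg: "\<xi> \<in> carrier (completion v) \<Longrightarrow> completion_abs v \<xi> \<ge> 0"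
  by (metis completionE completion_abs_tendsto LIMSEQ_le_const nonneg)

section \<open>Local units\<close>

text \<open>The units of \<open>valuation_ring v\<close> are formed from its multiplication alone.
  Values at most 1 are stable under products because the completed absolute value is multiplicative,
  even at a prime where they are not stable under sums.\<close>

lemma local_factor_comm_group: "comm_group (local_factor S v)"
proof (cases "v \<in> S")
  case True
  then show ?thesis
    using comm_monoid.units_comm_group[OF completion.comm_monoid_axioms] by (simp add: local_factor_def)
next
  case False
  have "comm_monoid (valuation_ring v)"
  proof (rule comm_monoidI)
    fix \<xi> \<eta> assume "\<xi> \<in> carrier (valuation_ring v)" "\<eta> \<in> carrier (valuation_ring v)"
    then show "\<xi> \<otimes>\<^bsub>valuation_ring v\<^esub> \<eta> \<in> carrier (valuation_ring v)"
      by (auto simp: valuation_ring_def completion_abs_mult completion_abs_nonneg intro!: mult_le_one)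
  next
    show "\<one>\<^bsub>valuation_ring v\<^esub> \<in> carrier (valuation_ring v)"
      using completion.one_closed by (simp add: valuation_ring_def completion_one)
  next
    fix \<xi> \<eta> assume "\<xi> \<in> carrier (valuation_ring v)" "\<eta> \<in> carrier (valuation_ring v)"
    then show "\<xi> \<otimes>\<^bsub>valuation_ring v\<^esub> \<eta> = \<eta> \<otimes>\<^bsub>valuation_ring v\<^esub> \<xi>"
      by (simp add: valuation_ring_def completion.m_comm)
  qed (simp_all add: valuation_ring_def completion.m_assoc)
  then show ?thesis
    using False comm_monoid.units_comm_group by (simp add: local_factor_def)
qed

lemma local_factor_mult [simp]: "x \<otimes>\<^bsub>local_factor S v\<^esub> y = x \<otimes>\<^bsub>completion v\<^esub> y"
  by (simp add: local_factor_def units_of_def valuation_ring_def)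

lemma local_factor_one [simp]: "\<one>\<^bsub>local_factor S v\<^esub> = \<one>\<^bsub>completion v\<^esub>"
  by (simp add: local_factor_def units_of_def valuation_ring_def)

text \<open>One criterion covers both cases of the definition. Outside \<open>S\<close> it bounds an
  element and its inverse by 1; such inequalities can be carried along maps of completions.\<close>

lemma local_factor_iff: "\<xi> \<in> carrier (local_factor S v) \<longleftrightarrow>
    \<xi> \<in> carrier (completion v) \<and> (\<exists>\<eta>\<in>carrier (completion v). \<xi> \<otimes>\<^bsub>completion v\<^esub> \<eta> = \<one>\<^bsub>completion v\<^esub> \<and>
      (v \<notin> S \<longrightarrow> completion_abs v \<xi> \<le> 1 \<and> completion_abs v \<eta> \<le> 1))"
proof -
  let ?C = "carrier (completion v)"
  have "(\<exists>\<eta>\<in>?C. P \<eta> \<and> \<eta> \<otimes>\<^bsub>completion v\<^esub> \<xi> = \<one>\<^bsub>completion v\<^esub> \<and> \<xi> \<otimes>\<^bsub>completion v\<^esub> \<eta> = \<one>\<^bsub>completion v\<^esub>) \<longleftrightarrow>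
      (\<exists>\<eta>\<in>?C. \<xi> \<otimes>\<^bsub>completion v\<^esub> \<eta> = \<one>\<^bsub>completion v\<^esub> \<and> P \<eta>)" if "\<xi> \<in> ?C" for P
    using that completion.m_comm by metis
  from this[of "\<lambda>_. True"] this[of "\<lambda>\<eta>. completion_abs v \<eta> \<le> 1"] show ?thesis
    by (auto simp: local_factor_def units_of_def Units_def valuation_ring_def)
qed

lemma local_factor_subset: "\<xi> \<in> carrier (local_factor S v) \<Longrightarrow> \<xi> \<in> carrier (completion v)"
  by (simp add: local_factor_iff)

lemma completion_embed_local_factor:
  assumes "x \<noteq> 0" "v \<notin> S \<Longrightarrow> place_abs v x = 1"
  shows "completion_embed v x \<in> carrier (local_factor S v)"
  unfolding local_factor_iff completion_embed_def
  using assms by (auto simp: completion_mult completion_one inverse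
      intro!: bexI[of _ "completion_class v (\<lambda>n. inverse x)"])

lemma completion_embed_mult:
  "completion_embed v (x * y) = completion_embed v x \<otimes>\<^bsub>completion v\<^esub> completion_embed v y"
  by (simp add: completion_embed_def completion_mult)

lemma completion_embed_inj: "completion_embed v x = completion_embed v y \<longleftrightarrow> x = y"
  unfolding completion_embed_def completion_class_eq_iff by (simp add: null_ideal_def LIMSEQ_const_iff)

end

section \<open>Maps of completions induced by field embeddings\<close>

text \<open>The representatives \<open>place_abs\<close> are chosen independently at each prime, so they are
  compatible with \<open>f\<close> only up to a power.\<close>

locale lies_over =
  fixes f :: "'k::field \<Rightarrow> 'l::field" and u :: "'k place" and w :: "'l place"
  assumes u_place: "u \<in> places" and w_place: "w \<in> places" and hom: "field_hom f"
    and ex_powr: "\<exists>s>0. \<forall>x. place_abs w (f x) = place_abs u x powr s"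
begin

sublocale u: place u by unfold_locales (rule u_place)
sublocale w: place w by unfold_locales (rule w_place)

lemma add: "f (x + y) = f x + f y" and mult: "f (x * y) = f x * f y" and one: "f 1 = 1"
  using hom by (auto simp: field_hom_def)

lemma diff: "f (x - y) = f x - f y"
  using add[of "x - y" y] by simp

text \<open>Raising to a positive power and its inverse are both continuous at 0. Both directions
  matter: upwards to map completions, downwards to conclude that a sequence of K is null at the
  prime below when its image is null in L.\<close>

lemma null_iff: "f \<circ> x \<in> null_ideal w \<longleftrightarrow> x \<in> null_ideal u"
proof -
  obtain s where s: "s > 0" "\<And>x. place_abs w (f x) = place_abs u x powr s" using ex_powr by blast
  have "(\<lambda>n. place_abs u (x n) powr s) \<longlonglongrightarrow> 0 \<longleftrightarrow> (\<lambda>n. place_abs u (x n)) \<longlonglongrightarrow> 0"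
  proof
    assume "(\<lambda>n. place_abs u (x n) powr s) \<longlonglongrightarrow> 0"
    then have "(\<lambda>n. (place_abs u (x n) powr s) powr (1 / s)) \<longlonglongrightarrow> 0"
      by (rule tendsto_zero_powrI[where b = "1 / s", OF _ tendsto_const]) (use s(1) in auto)
    then show "(\<lambda>n. place_abs u (x n)) \<longlonglongrightarrow> 0" using s(1) by (simp add: powr_powr)
  next
    assume "(\<lambda>n. place_abs u (x n)) \<longlonglongrightarrow> 0"
    then show "(\<lambda>n. place_abs u (x n) powr s) \<longlonglongrightarrow> 0"
      by (rule tendsto_zero_powrI[where b = s, OF _ tendsto_const]) (use s(1) in auto)
  qed
  then show ?thesis by (simp add: null_ideal_def s(2))
qed

lemma null_diff_iff: "(\<lambda>n. f (x n) - f (y n)) \<in> null_ideal w \<longleftrightarrow> (\<lambda>n. x n - y n) \<in> null_ideal u"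
  using null_iff[of "\<lambda>n. x n - y n"] by (simp add: o_def diff)

text \<open>A tolerance \<open>e\<close> on one side corresponds to its power with exponent
  \<open>s\<close> or \<open>1 / s\<close> on the other.\<close>

lemma cauchy_iff: "f \<circ> x \<in> carrier (cauchy_ring w) \<longleftrightarrow> x \<in> carrier (cauchy_ring u)"
proof -
  obtain s where s: "s > 0" "\<And>x. place_abs w (f x) = place_abs u x powr s" using ex_powr by blast
  have less: "place_abs u y powr s < e powr s \<longleftrightarrow> place_abs u y < e" if "e > 0" for y e
    using s(1) that by (metis less_imp_le not_le powr_less_mono2 powr_mono2 u.nonneg)
  have "(\<forall>e>0. \<exists>N. \<forall>m\<ge>N. \<forall>n\<ge>N. place_abs u (x m - x n) powr s < e) \<longleftrightarrow>
      (\<forall>e>0. \<exists>N. \<forall>m\<ge>N. \<forall>n\<ge>N. place_abs u (x m - x n) < e)" (is "?l \<longleftrightarrow> ?r")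
  proof
    assume l: ?l
    show ?r
    proof (intro allI impI)
      fix e :: real assume e: "e > 0"
      then have "e powr s > 0" by simp
      then show "\<exists>N. \<forall>m\<ge>N. \<forall>n\<ge>N. place_abs u (x m - x n) < e"
        using l less[OF e] by metis
    qed
  next
    assume r: ?r
    show ?l
    proof (intro allI impI)
      fix e :: real assume e: "e > 0"
      then have e': "e powr (1 / s) > 0" "(e powr (1 / s)) powr s = e" using s(1) by (auto simp: powr_powr)
      then show "\<exists>N. \<forall>m\<ge>N. \<forall>n\<ge>N. place_abs u (x m - x n) powr s < e"
        using r less[OF e'(1)] by metis
    qed
  qed
  then show ?thesis by (simp add: carrier_cauchy_ring s(2) flip: diff)
qed

text \<open>The union defining \<open>completion_map\<close> is over all representatives; they
  contribute one and the same coset, since \<open>f\<close> preserves null differences.\<close>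

lemma completion_map_class: "completion_map f w (completion_class u x) = completion_class w (f \<circ> x)"
proof -
  have "completion_class w (f \<circ> y) = completion_class w (f \<circ> x)" if "y \<in> completion_class u x" for y
    using that by (simp add: w.completion_class_eq_iff null_diff_iff completion_class_iff)
  moreover have "x \<in> completion_class u x" by (simp add: completion_class_iff u.null_zero)
  ultimately show ?thesis unfolding completion_map_def by blast
qed

lemma completion_map_closed:
  assumes "\<xi> \<in> carrier (completion u)"
  shows "completion_map f w \<xi> \<in> carrier (completion w)"
  using assms cauchy_iff by (metis u.completionE completion_map_class w.completion_classI)

lemma completion_map_mult:
  assumes "\<xi> \<in> carrier (completion u)" "\<eta> \<in> carrier (completion u)"
  shows "completion_map f w (\<xi> \<otimes>\<^bsub>completion u\<^esub> \<eta>) =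
    completion_map f w \<xi> \<otimes>\<^bsub>completion w\<^esub> completion_map f w \<eta>"
proof -
  obtain x y where x: "x \<in> carrier (cauchy_ring u)" "\<xi> = completion_class u x"
    and y: "y \<in> carrier (cauchy_ring u)" "\<eta> = completion_class u y"
    using assms u.completionE by metis
  have "f \<circ> x \<in> carrier (cauchy_ring w)" "f \<circ> y \<in> carrier (cauchy_ring w)"
    using x y by (simp_all add: cauchy_iff)
  then show ?thesis
    using x y by (simp add: completion_map_class u.completion_mult w.completion_mult) (simp add: o_def mult)
qed

lemma completion_map_one: "completion_map f w \<one>\<^bsub>completion u\<^esub> = \<one>\<^bsub>completion w\<^esub>"
  by (simp add: u.completion_one w.completion_one completion_map_class o_def one)

lemma completion_map_embed: "completion_map f w (completion_embed u x) = completion_embed w (f x)"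
  by (simp add: completion_embed_def completion_map_class o_def)

lemma completion_map_inj:
  assumes "\<xi> \<in> carrier (completion u)" "\<eta> \<in> carrier (completion u)"
    "completion_map f w \<xi> = completion_map f w \<eta>"
  shows "\<xi> = \<eta>"
proof -
  obtain x y where x: "\<xi> = completion_class u x" and y: "\<eta> = completion_class u y"
    using assms u.completionE by metis
  show ?thesis
    using assms(3) unfolding x y completion_map_class w.completion_class_eq_iff u.completion_class_eq_iff
    by (simp add: null_diff_iff)
qed

text \<open>The completed absolute values are again related by the power \<open>s\<close>, and a
  positive power does not change whether a value is at most 1.\<close>

lemma completion_abs_map_le_1_iff:
  assumes "\<xi> \<in> carrier (completion u)"
  shows "completion_abs w (completion_map f w \<xi>) \<le> 1 \<longleftrightarrow> completion_abs u \<xi> \<le> 1"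
proof -
  obtain s where s: "s > 0" "\<And>x. place_abs w (f x) = place_abs u x powr s" using ex_powr by blast
  obtain x where x: "x \<in> carrier (cauchy_ring u)" "\<xi> = completion_class u x"
    using assms u.completionE by blast
  have "(\<lambda>n. place_abs u (x n) powr s) \<longlonglongrightarrow> completion_abs u \<xi> powr s"
    using u.completion_abs_tendsto[OF x(1)] x(2) s(1) by (intro tendsto_powr') auto
  then have "(\<lambda>n. place_abs w ((f \<circ> x) n)) \<longlonglongrightarrow> completion_abs u \<xi> powr s" by (simp add: s(2))
  then have "completion_abs w (completion_map f w \<xi>) = completion_abs u \<xi> powr s"
    using w.completion_abs_tendsto[of "f \<circ> x"] x by (simp add: cauchy_iff completion_map_class LIMSEQ_unique)
  then show ?thesis
    using s(1) u.completion_abs_nonneg[OF assms] powr_mono2[of s "completion_abs u \<xi>" 1]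
      gr_one_powr[of "completion_abs u \<xi>" s] by (cases "completion_abs u \<xi> \<le> 1") (auto simp: not_le)
qed

lemma completion_map_local_factor:
  assumes "u \<in> S \<longleftrightarrow> w \<in> S'" "\<xi> \<in> carrier (local_factor S u)"
  shows "completion_map f w \<xi> \<in> carrier (local_factor S' w)"
proof -
  obtain \<eta> where \<eta>: "\<xi> \<in> carrier (completion u)" "\<eta> \<in> carrier (completion u)"
    "\<xi> \<otimes>\<^bsub>completion u\<^esub> \<eta> = \<one>\<^bsub>completion u\<^esub>"
    "u \<notin> S \<longrightarrow> completion_abs u \<xi> \<le> 1 \<and> completion_abs u \<eta> \<le> 1"
    using assms(2) by (auto simp: u.local_factor_iff)
  then have "completion_map f w \<xi> \<otimes>\<^bsub>completion w\<^esub> completion_map f w \<eta> = \<one>\<^bsub>completion w\<^esub>"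
    by (simp flip: completion_map_mult add: completion_map_one)
  then show ?thesis
    using \<eta> assms(1) unfolding w.local_factor_iff
    by (auto simp: completion_map_closed completion_abs_map_le_1_iff
        intro!: bexI[of _ "completion_map f w \<eta>"])
qed

end

lemma lies_over_compose:
  assumes "lies_over f u v" "lies_over g v w"
  shows "lies_over (g \<circ> f) u w"
proof -
  interpret f: lies_over f u v by fact
  interpret g: lies_over g v w by fact
  obtain s t where "s > 0" "t > 0" "\<forall>x. place_abs v (f x) = place_abs u x powr s"
    "\<forall>x. place_abs w (g x) = place_abs v x powr t"
    using f.ex_powr g.ex_powr by blast
  then have "s * t > 0 \<and> (\<forall>x. place_abs w ((g \<circ> f) x) = place_abs u x powr (s * t))"
    by (simp add: powr_powr)
  then show ?thesis
    using f.u_place g.w_place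
    by unfold_locales (auto simp: field_hom_def f.one f.add f.mult g.one g.add g.mult)
qed

lemma completion_map_compose:
  assumes "lies_over f u v" "lies_over g v w" "\<xi> \<in> carrier (completion u)"
  shows "completion_map (g \<circ> f) w \<xi> = completion_map g w (completion_map f v \<xi>)"
proof -
  interpret f: lies_over f u v by fact
  interpret g: lies_over g v w by fact
  interpret gf: lies_over "g \<circ> f" u w using assms by (intro lies_over_compose)
  show ?thesis using assms(3)
    by (auto elim!: f.u.completionE simp: f.completion_map_class g.completion_map_class
        gf.completion_map_class o_assoc)
qed

lemma field_hom_eq_0_iff:
  assumes f: "field_hom f"
  shows "f x = 0 \<longleftrightarrow> x = 0"
proof
  assume fx: "f x = 0"
  have "f (x * inverse x) = f x * f (inverse x)" using f by (simp add: field_hom_def)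
  then show "x = 0" using fx f by (cases "x = 0") (auto simp: field_hom_def)
next
  have "f (0 + 0) = f 0 + f 0" using f unfolding field_hom_def by blast
  then show "x = 0 \<Longrightarrow> f x = 0" by (simp only: add_0_left add_cancel_right_right)
qed

lemma nontrivial_absolute_value_comp:
  assumes a: "a \<in> nontrivial_absolute_values" and f: "field_hom f"
    and "\<exists>x. x \<noteq> 0 \<and> a (f x) \<noteq> 1"
  shows "a \<circ> f \<in> nontrivial_absolute_values"
  using assms field_hom_eq_0_iff[OF f]
  by (auto simp: nontrivial_absolute_values_def absolute_value_def field_hom_def)

text \<open>Composing with \<open>f\<close> commutes with taking powers, so all \<open>a\<close> in
  \<open>w\<close> contribute the same class to the union in \<open>place_below\<close>. The
  assumption \<open>nontriv\<close> is what makes the composed absolute value define a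
  prime.\<close>

lemma lies_over_place_below:
  assumes w: "w \<in> places" and f: "field_hom f" and nontriv: "\<exists>x. x \<noteq> 0 \<and> place_abs w (f x) \<noteq> 1"
  shows "lies_over f (place_below f w) w"
proof -
  interpret w: place w by unfold_locales (rule w)
  let ?b = "place_abs w \<circ> f"
  have b: "?b \<in> nontrivial_absolute_values"
    using nontriv by (intro nontrivial_absolute_value_comp[OF place_abs_nontrivial[OF w] f])
  have "absolute_value_equiv `` {a \<circ> f} = absolute_value_equiv `` {?b}" if a: "a \<in> w" for a
  proof -
    have "(place_abs w, a) \<in> absolute_value_equiv"
      using place_eq_class(2)[OF w place_abs_mem[OF w]] a by blast
    then obtain s where s: "s > 0" "\<forall>x. a x = place_abs w x powr s"
      "a \<in> nontrivial_absolute_values" by (auto simp: absolute_value_equiv_def)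
    obtain x where x: "x \<noteq> 0" "place_abs w (f x) \<noteq> 1" using nontriv by blast
    then have "a (f x) \<noteq> 1"
      using s by (simp add: powr_def field_hom_eq_0_iff[OF f])
    then have "a \<circ> f \<in> nontrivial_absolute_values"
      using x by (intro nontrivial_absolute_value_comp[OF s(3) f]) auto
    then have "(?b, a \<circ> f) \<in> absolute_value_equiv"
      using b s by (auto simp: absolute_value_equiv_def)
    then show ?thesis using equiv_class_eq[OF equiv_absolute_value_equiv] by metis
  qed
  then have pb: "place_below f w = absolute_value_equiv `` {?b}"
    using place_abs_mem[OF w] unfolding place_below_def by blast
  then have p: "place_below f w \<in> places" using absolute_value_equiv_class_in_places[OF b] by simp
  have "(place_abs (place_below f w), ?b) \<in> absolute_value_equiv"
    using place_abs_mem[OF p] equiv_absolute_value_equiv pb by (metis Image_singleton_iff equivE symE)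
  then have "\<exists>s>0. \<forall>x. place_abs w (f x) = place_abs (place_below f w) x powr s"
    by (auto simp: absolute_value_equiv_def)
  then show ?thesis using w f p by unfold_locales
qed


section \<open>Galois action on primes\<close>

lemma field_hom_simps:
  assumes f: "field_hom f"
  shows "f 0 = 0" "f 1 = 1" "f (x + y) = f x + f y" "f (x * y) = f x * f y"
    "f (x - y) = f x - f y" "f (inverse x) = inverse (f x)" "f (of_nat n) = of_nat n"
    "f (x ^ n) = f x ^ n" "f (sum g A) = (\<Sum>i\<in>A. f (g i))"
proof -
  show 0: "f 0 = 0" and 1: "f 1 = 1" and add: "f (x + y) = f x + f y"
    and mult: "f (x * y) = f x * f y" for x y
    using f field_hom_eq_0_iff[OF f] by (auto simp: field_hom_def)
  show "f (x - y) = f x - f y" using add[of "x - y" y] by simp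
  show "f (inverse x) = inverse (f x)"
  proof (cases "x = 0")
    case False
    then have "f x * f (inverse x) = 1" by (simp add: 1 flip: mult)
    then show ?thesis by (simp add: inverse_unique)
  qed (simp add: 0)
  show "f (of_nat n) = of_nat n" by (induction n) (auto simp: 0 1 add)
  show "f (x ^ n) = f x ^ n" by (induction n) (auto simp: 1 mult)
  show "f (sum g A) = (\<Sum>i\<in>A. f (g i))"
    by (induction A rule: infinite_finite_induct) (auto simp: 0 add)
qed

lemma field_hom_comp: "field_hom f \<Longrightarrow> field_hom g \<Longrightarrow> field_hom (f \<circ> g)"
  by (simp add: field_hom_def)

lemma galois_group_simps [simp]:
  "\<sigma> \<otimes>\<^bsub>galois_group \<iota>\<^esub> \<tau> = \<sigma> \<circ> \<tau>" "\<one>\<^bsub>galois_group \<iota>\<^esub> = id"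
  by (simp_all add: galois_group_def)

lemma galois_group_iff: "\<sigma> \<in> carrier (galois_group \<iota>) \<longleftrightarrow>
    bij \<sigma> \<and> field_hom \<sigma> \<and> (\<forall>x. \<sigma> (\<iota> x) = \<iota> x)"
  by (simp add: galois_group_def)

lemma galois_group_inv:
  assumes "\<sigma> \<in> carrier (galois_group \<iota>)"
  shows "inv_into UNIV \<sigma> \<in> carrier (galois_group \<iota>)"
proof -
  have \<sigma>: "bij \<sigma>" "field_hom \<sigma>" "\<And>x. \<sigma> (\<iota> x) = \<iota> x" using assms by (auto simp: galois_group_iff)
  let ?i = "inv_into UNIV \<sigma>"
  have i: "\<sigma> (?i x) = x" "?i (\<sigma> x) = x" for x
    using \<sigma>(1) by (simp_all add: bij_is_inj bij_is_surj surj_f_inv_f)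
  have "?i (x + y) = ?i x + ?i y" "?i (x * y) = ?i x * ?i y" for x y
    by (metis i field_hom_simps(3)[OF \<sigma>(2)]) (metis i field_hom_simps(4)[OF \<sigma>(2)])
  moreover have "?i 1 = 1" by (metis i(2) field_hom_simps(2)[OF \<sigma>(2)])
  moreover have "?i (\<iota> x) = \<iota> x" for x by (metis i(2) \<sigma>(3))
  ultimately show ?thesis
    using \<sigma>(1) by (simp add: galois_group_iff field_hom_def bij_imp_bij_inv)
qed

lemma group_galois_group: "group (galois_group \<iota>)"
proof (rule groupI)
  fix \<sigma> assume \<sigma>: "\<sigma> \<in> carrier (galois_group \<iota>)"
  then have "inv_into UNIV \<sigma> \<circ> \<sigma> = id" by (simp add: galois_group_iff bij_is_inj)
  then show "\<exists>\<tau>\<in>carrier (galois_group \<iota>). \<tau> \<otimes>\<^bsub>galois_group \<iota>\<^esub> \<sigma> = \<one>\<^bsub>galois_group \<iota>\<^esub>"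
    using galois_group_inv[OF \<sigma>] by auto
qed (auto simp: galois_group_iff bij_comp field_hom_comp o_assoc field_hom_def)

lemma place_act_id [simp]: "place_act id w = w"
  by (simp add: place_act_def)

lemma place_act_comp:
  assumes "bij \<sigma>" "bij \<tau>"
  shows "place_act (\<sigma> \<circ> \<tau>) w = place_act \<sigma> (place_act \<tau> w)"
  using assms by (simp add: place_act_def o_inv_distrib image_image o_assoc)

lemma place_act_inv:
  assumes "bij \<sigma>"
  shows "place_act (inv_into UNIV \<sigma>) w = (\<lambda>a. a \<circ> \<sigma>) ` w"
  using assms by (simp add: place_act_def inv_inv_eq)

text \<open>This makes the Galois action an instance of \<open>place_below\<close>, with an
  automorphism as the embedding. Closing under equivalence adds nothing: if \<open>c\<close> is
  equivalent to \<open>a\<close> composed with \<sigma>, then \<open>c\<close> composed with the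
  inverse of \<sigma> is equivalent to \<open>a\<close>, so it already lies in
  \<open>w\<close>.\<close>

lemma place_below_automorphism:
  fixes \<sigma> :: "'l::field \<Rightarrow> 'l"
  assumes w: "w \<in> places" and \<sigma>: "bij \<sigma>" "field_hom \<sigma>" "field_hom (inv_into UNIV \<sigma>)"
  shows "place_below \<sigma> w = place_act (inv_into UNIV \<sigma>) w"
proof -
  let ?i = "inv_into UNIV \<sigma>"
  have i: "\<sigma> (?i x) = x" "?i (\<sigma> x) = x" for x
    using \<sigma>(1) by (simp_all add: bij_is_inj bij_is_surj surj_f_inv_f)
  have nt: "a \<circ> \<tau> \<in> nontrivial_absolute_values"
    if a: "a \<in> nontrivial_absolute_values" "field_hom \<tau>" "surj \<tau>" for a :: "'l \<Rightarrow> real" and \<tau> :: "'l \<Rightarrow> 'l"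
  proof -
    obtain y where "y \<noteq> 0" "a y \<noteq> 1" using a by (auto simp: nontrivial_absolute_values_def)
    then have "\<exists>x. x \<noteq> 0 \<and> a (\<tau> x) \<noteq> 1" using a field_hom_simps(1) by (metis surjD)
    then show ?thesis using a by (intro nontrivial_absolute_value_comp)
  qed
  have "c \<in> place_below \<sigma> w" if c: "c \<in> (\<lambda>a. a \<circ> \<sigma>) ` w" for c
  proof -
    obtain a where a: "a \<in> w" "c = a \<circ> \<sigma>" using c by blast
    then have "c \<in> nontrivial_absolute_values"
      using nt place_eq_class(1)[OF w] \<sigma> by (simp add: bij_is_surj)
    then show ?thesis using a equiv_class_self[OF equiv_absolute_value_equiv]
      by (auto simp: place_below_def)
  qed
  moreover have "c \<in> (\<lambda>a. a \<circ> \<sigma>) ` w" if c: "c \<in> place_below \<sigma> w" for c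
  proof -
    obtain a where a: "a \<in> w" "(a \<circ> \<sigma>, c) \<in> absolute_value_equiv"
      using c by (auto simp: place_below_def)
    then obtain s where "s > 0" "\<forall>x. c x = a (\<sigma> x) powr s" "c \<in> nontrivial_absolute_values"
      by (auto simp: absolute_value_equiv_def)
    then have "(a, c \<circ> ?i) \<in> absolute_value_equiv"
      using nt[of c ?i] \<sigma> place_eq_class(1)[OF w a(1)]
      by (auto simp: absolute_value_equiv_def i bij_is_inj inj_imp_surj_inv)
    then have "c \<circ> ?i \<in> w" using place_eq_class(2)[OF w a(1)] by blast
    moreover have "c = (c \<circ> ?i) \<circ> \<sigma>" by (simp add: i fun_eq_iff)
    ultimately show ?thesis by blast
  qed
  ultimately show ?thesis by (auto simp: place_act_inv[OF \<sigma>(1)])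
qed

text \<open>Since \<sigma> is onto, an absolute value cannot become trivial after composition with
  it. Hence \<sigma> maps the completion at the inverse image of \<open>w\<close> to the one at
  \<open>w\<close>.\<close>

lemma lies_over_place_act:
  assumes w: "w \<in> places" and \<sigma>: "\<sigma> \<in> carrier (galois_group \<iota>)"
  shows "lies_over \<sigma> (place_act (inv_into UNIV \<sigma>) w) w"
proof -
  have \<sigma>': "bij \<sigma>" "field_hom \<sigma>" "field_hom (inv_into UNIV \<sigma>)"
    using \<sigma> galois_group_inv[OF \<sigma>] by (auto simp: galois_group_iff)
  obtain y where "y \<noteq> 0" "place_abs w y \<noteq> 1"
    using place_abs_nontrivial[OF w] by (auto simp: nontrivial_absolute_values_def)
  then have "\<exists>x. x \<noteq> 0 \<and> place_abs w (\<sigma> x) \<noteq> 1"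
    using \<sigma>'(1) field_hom_simps(1)[OF \<sigma>'(2)] by (metis bij_is_surj surjD)
  then show ?thesis
    using lies_over_place_below[OF w \<sigma>'(2)] place_below_automorphism[OF w \<sigma>'] by simp
qed

lemma place_act_place:
  assumes w: "w \<in> places" and \<sigma>: "\<sigma> \<in> carrier (galois_group \<iota>)"
  shows "place_act \<sigma> w \<in> places"
proof -
  have "bij \<sigma>" using \<sigma> by (simp add: galois_group_iff)
  then show ?thesis
    using lies_over.u_place[OF lies_over_place_act[OF w galois_group_inv[OF \<sigma>]]] by (simp add: inv_inv_eq)
qed

lemma place_act_inv_cancel:
  assumes "\<sigma> \<in> carrier (galois_group \<iota>)"
  shows "place_act (inv_into UNIV \<sigma>) (place_act \<sigma> w) = w"
    "place_act \<sigma> (place_act (inv_into UNIV \<sigma>) w) = w"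
proof -
  have \<sigma>: "bij \<sigma>" using assms by (simp add: galois_group_iff)
  show "place_act (inv_into UNIV \<sigma>) (place_act \<sigma> w) = w"
    using \<sigma> by (simp add: bij_imp_bij_inv bij_is_inj flip: place_act_comp)
  show "place_act \<sigma> (place_act (inv_into UNIV \<sigma>) w) = w"
    using \<sigma> surj_iff[THEN iffD1, OF bij_is_surj[OF \<sigma>]]
    by (simp add: bij_imp_bij_inv flip: place_act_comp)
qed

lemma place_below_place_act_inv:
  assumes "\<sigma> \<in> carrier (galois_group \<iota>)"
  shows "place_below \<iota> (place_act (inv_into UNIV \<sigma>) w) = place_below \<iota> w"
proof -
  have "a \<circ> \<sigma> \<circ> \<iota> = a \<circ> \<iota>" for a :: "_ \<Rightarrow> real"
    using assms by (auto simp: galois_group_iff)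
  then show ?thesis using assms by (simp add: galois_group_iff place_act_inv place_below_def)
qed

section \<open>Finiteness of the Galois group and approximation by elements of K\<close>

locale galois_ext =
  fixes \<iota> :: "'k::field_char_0 \<Rightarrow> 'l::field_char_0"
  assumes galois: "galois_extension \<iota>"
begin

abbreviation "G \<equiv> galois_group \<iota>"

sublocale G: group G by (rule group_galois_group)

lemma hom: "field_hom \<iota>"
  using galois by (simp add: galois_extension_def finite_extension_def)

lemma fixed_in_range: "(\<And>\<sigma>. \<sigma> \<in> carrier G \<Longrightarrow> \<sigma> y = y) \<Longrightarrow> y \<in> range \<iota>"
  using galois by (auto simp: galois_extension_def)

sublocale V: vector_space "\<lambda>a x. \<iota> a * x"
  by unfold_locales (simp_all add: field_hom_simps[OF hom] algebra_simps)

lemma finite_span: obtains B where "finite B" "V.span B = UNIV"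
  using galois by (auto simp: galois_extension_def finite_extension_def)

text \<open>The element \<open>b\<close> is algebraic over K, because \<open>card B + 1\<close> of
  its powers lie in the span of \<open>card B\<close> vectors. All its conjugates are roots of one
  nonzero polynomial.\<close>

lemma automorphism_values_finite: "\<exists>R. finite R \<and> (\<forall>\<sigma>\<in>carrier G. \<sigma> b \<in> R)"
proof -
  obtain B where B: "finite B" "V.span B = UNIV" by (rule finite_span)
  obtain p where p: "p \<noteq> 0" "\<And>\<sigma>. \<sigma> \<in> carrier G \<Longrightarrow> poly p (\<sigma> b) = 0"
  \<comment> \<open>Linear dependence is a property of sets and cannot see a repetition; coinciding
    powers therefore get their own polynomial, a difference of two monomials.\<close>
  proof (cases "inj_on (\<lambda>i. b ^ i) {..card B}")
    case False
    then obtain i j where ij: "i \<noteq> j" "b ^ i = b ^ j" by (auto simp: inj_on_def)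
    have "monom 1 i - monom 1 j \<noteq> (0 :: 'l poly)"
      using ij(1) by (metis coeff_monom eq_iff_diff_eq_0 one_neq_zero)
    moreover have "poly (monom 1 i - monom 1 j) (\<sigma> b) = 0" if "\<sigma> \<in> carrier G" for \<sigma>
    proof -
      have "field_hom \<sigma>" using that by (simp add: galois_group_iff)
      then have "\<sigma> b ^ i = \<sigma> b ^ j" using ij(2) field_hom_simps(8) by metis
      then show ?thesis by (simp add: poly_monom)
    qed
    ultimately show thesis by (rule that)
  next
    case True
    let ?P = "(\<lambda>i. b ^ i) ` {..card B}"
    have "card ?P = Suc (card B)" using True by (simp add: card_image)
    then have "V.dependent ?P"
      using V.independent_span_bound[OF B(1), of ?P] B(2) by fastforce
    then obtain u where u: "\<exists>v\<in>?P. u v \<noteq> 0" "(\<Sum>v\<in>?P. \<iota> (u v) * v) = 0"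
      using V.dependent_finite[of ?P] by auto
    let ?p = "\<Sum>i\<le>card B. monom (\<iota> (u (b ^ i))) i"
    obtain i where i: "i \<le> card B" "u (b ^ i) \<noteq> 0" using u(1) by auto
    have "coeff ?p i = \<iota> (u (b ^ i))" using i(1) by (simp add: coeff_sum if_distrib cong: if_cong)
    then have "?p \<noteq> 0" using i(2) field_hom_eq_0_iff[OF hom] by (metis coeff_0)
    moreover have "poly ?p (\<sigma> b) = 0" if "\<sigma> \<in> carrier G" for \<sigma>
    proof -
      have \<sigma>: "field_hom \<sigma>" "\<And>x. \<sigma> (\<iota> x) = \<iota> x" using that by (auto simp: galois_group_iff)
      have "(\<Sum>i\<le>card B. \<iota> (u (b ^ i)) * b ^ i) = 0"
        using u(2) True by (simp add: sum.reindex)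
      then have "\<sigma> (\<Sum>i\<le>card B. \<iota> (u (b ^ i)) * b ^ i) = 0" using field_hom_simps(1)[OF \<sigma>(1)] by simp
      then show ?thesis by (simp add: poly_sum poly_monom field_hom_simps[OF \<sigma>(1)] \<sigma>(2))
    qed
    ultimately show thesis by (rule that)
  qed
  show ?thesis
    using p poly_roots_finite[OF p(1)] by (intro exI[of _ "{x. poly p x = 0}"]) auto
qed

text \<open>An automorphism over K is determined by its values on a finite spanning set, and each of
  these values has finitely many possibilities.\<close>

lemma finite_G: "finite (carrier G)"
proof -
  obtain B where B: "finite B" "V.span B = UNIV" by (rule finite_span)
  obtain R where R: "\<And>b. finite (R b)" "\<And>b \<sigma>. \<sigma> \<in> carrier G \<Longrightarrow> \<sigma> b \<in> R b"
    using automorphism_values_finite by metis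
  have "inj_on (\<lambda>\<sigma>. restrict \<sigma> B) (carrier G)"
  proof (rule inj_onI)
    fix \<sigma> \<tau> assume \<sigma>: "\<sigma> \<in> carrier G" and \<tau>: "\<tau> \<in> carrier G" and eq: "restrict \<sigma> B = restrict \<tau> B"
    have h: "field_hom \<sigma>" "field_hom \<tau>" using \<sigma> \<tau> by (auto simp: galois_group_iff)
    have "V.subspace {x. \<sigma> x = \<tau> x}"
      using \<sigma> \<tau> by (auto simp: V.subspace_def field_hom_simps[OF h(1)] field_hom_simps[OF h(2)] galois_group_iff)
    moreover have "\<sigma> b = \<tau> b" if "b \<in> B" for b using fun_cong[OF eq, of b] that by simp
    then have "B \<subseteq> {x. \<sigma> x = \<tau> x}" by blast
    ultimately have "V.span B \<subseteq> {x. \<sigma> x = \<tau> x}" by (rule V.span_minimal[rotated])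
    then show "\<sigma> = \<tau>" using B(2) by auto
  qed
  moreover have "(\<lambda>\<sigma>. restrict \<sigma> B) ` carrier G \<subseteq> PiE B R" using R(2) by auto
  moreover have "finite (PiE B R)" using B(1) R(1) by (intro finite_PiE) auto
  ultimately show ?thesis by (metis finite_imageD finite_subset)
qed

text \<open>The point is that \<open>w\<close> stays nontrivial on K. Were it trivial there, its
  values on L would be bounded by the sum of its values on a finite spanning set, and a bounded
  absolute value is trivial.\<close>

lemma lies_over_base:
  assumes w: "w \<in> places"
  shows "lies_over \<iota> (place_below \<iota> w) w"
proof (rule lies_over_place_below[OF w hom], rule ccontr)
  assume *: "\<nexists>x. x \<noteq> 0 \<and> place_abs w (\<iota> x) \<noteq> 1"
  interpret place w by unfold_locales (rule w)
  obtain B where B: "finite B" "V.span B = UNIV" by (rule finite_span)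
  have le1: "place_abs w (\<iota> x) \<le> 1" for x
    using * by (cases "x = 0") (auto simp: field_hom_simps(1)[OF hom])
  have "place_abs w y \<le> (\<Sum>b\<in>B. place_abs w b)" for y
  proof -
    obtain c where "y = (\<Sum>b\<in>B. \<iota> (c b) * b)" using V.span_finite[OF B(1)] B(2) by auto
    then have "place_abs w y \<le> (\<Sum>b\<in>B. place_abs w (\<iota> (c b) * b))" by (simp only: sum)
    also have "\<dots> \<le> (\<Sum>b\<in>B. place_abs w b)"
      using le1 by (intro sum_mono) (auto simp: mult intro!: mult_left_le_one_le)
    finally show ?thesis .
  qed
  then have "\<And>x. x \<noteq> 0 \<Longrightarrow> place_abs w x = 1" by (rule bounded_imp_trivial)
  then show False using place_abs_nontrivial[OF w] by (auto simp: nontrivial_absolute_values_def)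
qed

lemma mult_bij:
  assumes "\<tau> \<in> carrier G"
  shows "bij_betw (\<lambda>\<sigma>. \<tau> \<otimes>\<^bsub>G\<^esub> \<sigma>) (carrier G) (carrier G)"
  using assms G.inj_on_cmult G.surj_const_mult by (simp add: bij_betw_def)

text \<open>Approximate the family in \<open>L\<close> at all primes of \<open>T\<close> at once, then average over \<open>G\<close>: since
  the family is invariant up to null sequences, the average is as good an approximation, and it
  lies in \<open>K\<close>.\<close>

lemma approximation_by_base:
  assumes fin: "finite T" and T: "T \<subseteq> places"
    and stable: "\<And>\<sigma> w. \<sigma> \<in> carrier G \<Longrightarrow> w \<in> T \<Longrightarrow> place_act (inv_into UNIV \<sigma>) w \<in> T"
    and inv: "\<And>\<sigma> w. \<sigma> \<in> carrier G \<Longrightarrow> w \<in> T \<Longrightarrow>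
      (\<lambda>n. \<sigma> (x (place_act (inv_into UNIV \<sigma>) w) n) - x w n) \<in> null_ideal w"
  obtains k where "\<And>w. w \<in> T \<Longrightarrow> (\<lambda>n. \<iota> (k n) - x w n) \<in> null_ideal w"
proof -
  obtain y where y: "\<And>w. w \<in> T \<Longrightarrow> (\<lambda>n. y n - x w n) \<in> null_ideal w"
    using weak_approximation[OF fin T] by blast
  \<comment> \<open>Every conjugate of \<open>y n\<close> will approximate the same
    \<open>x w n\<close>, so the sum has to be divided by the order of \<open>G\<close>, which is
    nonzero in L by characteristic 0.\<close>
  let ?c = "inverse (of_nat (card (carrier G))) :: 'l"
  have card0: "of_nat (card (carrier G)) \<noteq> (0 :: 'l)"
    using finite_G G.one_closed by (metis card_0_eq empty_iff of_nat_eq_0_iff)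
  define z where "z n = ?c * (\<Sum>\<sigma>\<in>carrier G. \<sigma> (y n))" for n
  have "z n \<in> range \<iota>" for n
  proof (rule fixed_in_range)
    fix \<tau> assume \<tau>: "\<tau> \<in> carrier G"
    then have h: "field_hom \<tau>" by (simp add: galois_group_iff)
    have "(\<Sum>\<sigma>\<in>carrier G. \<tau> (\<sigma> (y n))) = (\<Sum>\<sigma>\<in>carrier G. \<sigma> (y n))"
      using sum.reindex_bij_betw[OF mult_bij[OF \<tau>], of "\<lambda>\<sigma>. \<sigma> (y n)"] by simp
    then show "\<tau> (z n) = z n" by (simp add: z_def field_hom_simps[OF h])
  qed
  then have "\<forall>n. \<exists>k. z n = \<iota> k" by blast
  then obtain k where k: "\<And>n. z n = \<iota> (k n)" unfolding choice_iff by blast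
  show thesis
  proof (rule that)
    fix w assume w: "w \<in> T"
    then interpret place w using T by unfold_locales auto
    have "(\<lambda>n. \<sigma> (y n) - x w n) \<in> null_ideal w" if \<sigma>: "\<sigma> \<in> carrier G" for \<sigma>
    proof -
      interpret \<sigma>: lies_over \<sigma> "place_act (inv_into UNIV \<sigma>) w" w
        using lies_over_place_act w T \<sigma> by blast
      have "(\<lambda>n. \<sigma> (y n) - \<sigma> (x (place_act (inv_into UNIV \<sigma>) w) n)) \<in> null_ideal w"
        unfolding \<sigma>.null_diff_iff by (rule y[OF stable[OF \<sigma> w]])
      then show ?thesis using inv[OF \<sigma> w] by (rule null_diff_trans)
    qed
    then have "(\<lambda>n. ?c * (\<Sum>\<sigma>\<in>carrier G. \<sigma> (y n) - x w n)) \<in> null_ideal w"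
      by (intro null_cmult null_sum)
    moreover have "?c * (\<Sum>\<sigma>\<in>carrier G. \<sigma> (y n) - x w n) = \<iota> (k n) - x w n" for n
      using card0 by (simp add: sum_subtractf right_diff_distrib z_def flip: k)
    ultimately show "(\<lambda>n. \<iota> (k n) - x w n) \<in> null_ideal w" by simp
  qed
qed

section \<open>Transitivity on the primes above a prime\<close>

definition orbit :: "'l place \<Rightarrow> 'l place set" where
  "orbit w = (\<lambda>\<sigma>. place_act \<sigma> w) ` carrier G"

lemma orbit_self: "w \<in> orbit w"
  using G.one_closed by (force simp: orbit_def)

lemma finite_orbit: "finite (orbit w)"
  by (simp add: orbit_def finite_G)

lemma orbit_places: "w \<in> places \<Longrightarrow> orbit w \<subseteq> places"
  by (auto simp: orbit_def intro: place_act_place)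

lemma place_act_mult:
  "\<sigma> \<in> carrier G \<Longrightarrow> \<tau> \<in> carrier G \<Longrightarrow> place_act (\<sigma> \<otimes>\<^bsub>G\<^esub> \<tau>) w = place_act \<sigma> (place_act \<tau> w)"
  by (simp add: galois_group_iff place_act_comp)

lemma orbit_act:
  assumes "\<sigma> \<in> carrier G"
  shows "place_act \<sigma> u \<in> orbit w \<longleftrightarrow> u \<in> orbit w"
proof -
  have *: "place_act \<tau> u \<in> orbit w" if u: "u \<in> orbit w" and \<tau>: "\<tau> \<in> carrier G" for \<tau> u
  proof -
    obtain \<rho> where \<rho>: "\<rho> \<in> carrier G" "u = place_act \<rho> w" using u by (auto simp: orbit_def)
    then have "place_act \<tau> u = place_act (\<tau> \<otimes>\<^bsub>G\<^esub> \<rho>) w" using \<tau> place_act_mult by simp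
    moreover have "\<tau> \<otimes>\<^bsub>G\<^esub> \<rho> \<in> carrier G" using \<tau> \<rho>(1) by (rule G.m_closed)
    ultimately show ?thesis unfolding orbit_def by blast
  qed
  show ?thesis
    using *[of u \<sigma>] *[of "place_act \<sigma> u" "inv_into UNIV \<sigma>"] assms galois_group_inv[OF assms]
    by (auto simp: place_act_inv_cancel)
qed

lemma transitive:
  assumes w: "w \<in> places" and w': "w' \<in> places" and eq: "place_below \<iota> w = place_below \<iota> w'"
  obtains \<tau> where "\<tau> \<in> carrier G" "w' = place_act \<tau> w"
proof -
  have "w' \<in> orbit w"
  proof (rule ccontr)
    assume nw': "w' \<notin> orbit w"
    \<comment> \<open>A sequence of \<open>K\<close> tending to 0 at \<open>w\<close> and to 1 at \<open>w'\<close> would tend to both at the prime below.\<close>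
    let ?x = "\<lambda>u (n::nat). if u \<in> orbit w then 0 else (1 :: 'l)"
    obtain k where k: "\<And>u. u \<in> orbit w \<union> orbit w' \<Longrightarrow> (\<lambda>n. \<iota> (k n) - ?x u n) \<in> null_ideal u"
    proof (rule approximation_by_base[of "orbit w \<union> orbit w'" ?x])
      fix \<sigma> u assume \<sigma>: "\<sigma> \<in> carrier G" and u: "u \<in> orbit w \<union> orbit w'"
      then show "place_act (inv_into UNIV \<sigma>) u \<in> orbit w \<union> orbit w'"
        using orbit_act[OF galois_group_inv[OF \<sigma>]] by blast
      \<comment> \<open>The family is invariant exactly: \<sigma> fixes 0 and 1, and lying in the
        orbit of \<open>w\<close> does not change under \<sigma>.\<close>
      have "field_hom \<sigma>" using \<sigma> by (simp add: galois_group_iff)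
      moreover have "u \<in> places" using u orbit_places w w' by blast
      ultimately show "(\<lambda>n. \<sigma> (?x (place_act (inv_into UNIV \<sigma>) u) n) - ?x u n) \<in> null_ideal u"
        using orbit_act[OF galois_group_inv[OF \<sigma>]] place.null_zero[of u] field_hom_simps(1,2)[of \<sigma>]
        by (auto simp: place_def)
    qed (use finite_orbit orbit_places w w' in auto)
    interpret w: lies_over \<iota> "place_below \<iota> w" w by (rule lies_over_base[OF w])
    interpret w': lies_over \<iota> "place_below \<iota> w" w' using lies_over_base[OF w'] eq by simp
    have "(\<lambda>n. \<iota> (k n) - \<iota> 0) \<in> null_ideal w"
      using k[of w] orbit_self[of w] by (simp add: field_hom_simps[OF hom])
    then have 0: "(\<lambda>n. k n - 0) \<in> null_ideal (place_below \<iota> w)" unfolding w.null_diff_iff .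
    have "(\<lambda>n. \<iota> (k n) - \<iota> 1) \<in> null_ideal w'"
      using k[of w'] orbit_self[of w'] nw' by (simp add: field_hom_simps[OF hom])
    then have 1: "(\<lambda>n. k n - 1) \<in> null_ideal (place_below \<iota> w)" unfolding w'.null_diff_iff .
    have "(\<lambda>n. 1) \<in> null_ideal (place_below \<iota> w)"
      using w.u.null_diff[OF 0 1] by simp
    then show False by (simp add: null_ideal_def LIMSEQ_const_iff)
  qed
  then show thesis using that by (auto simp: orbit_def)
qed

end


section \<open>Ideles\<close>

lemma S_units_simps [simp]:
  "x \<in> carrier (S_units T) \<longleftrightarrow> x \<noteq> 0 \<and> (\<forall>v\<in>places - T. place_abs v x = 1)"
  "x \<otimes>\<^bsub>S_units T\<^esub> y = x * y" "\<one>\<^bsub>S_units T\<^esub> = 1"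
  by (simp_all add: S_units_def)

lemma comm_group_S_units: "comm_group (S_units T)"
proof (rule comm_groupI)
  fix x y assume *: "x \<in> carrier (S_units T)" "y \<in> carrier (S_units T)"
  have "place_abs v (x * y) = 1" if "v \<in> places - T" for v
  proof -
    interpret place v using that by unfold_locales simp
    show ?thesis using * that by (simp add: mult)
  qed
  then show "x \<otimes>\<^bsub>S_units T\<^esub> y \<in> carrier (S_units T)" using * by simp
next
  show "\<one>\<^bsub>S_units T\<^esub> \<in> carrier (S_units T)"
    using abs_value.one[OF abs_value_place_abs] by auto
next
  fix x assume *: "x \<in> carrier (S_units T)"
  have "place_abs v (inverse x) = 1" if "v \<in> places - T" for v
  proof -
    interpret place v using that by unfold_locales simp
    show ?thesis using * that by (simp add: inverse)
  qed
  then show "\<exists>y\<in>carrier (S_units T). y \<otimes>\<^bsub>S_units T\<^esub> x = \<one>\<^bsub>S_units T\<^esub>"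
    using * by (intro bexI[of _ "inverse x"]) auto
qed (auto simp: mult_ac)

lemma S_ideles_iff: "x \<in> carrier (S_ideles T) \<longleftrightarrow>
    x \<in> extensional places \<and> (\<forall>v\<in>places. x v \<in> carrier (local_factor T v))"
  by (auto simp: S_ideles_def PiE_iff)

lemma S_ideles_mult: "x \<otimes>\<^bsub>S_ideles T\<^esub> y = (\<lambda>v\<in>places. x v \<otimes>\<^bsub>completion v\<^esub> y v)"
  by (auto simp: S_ideles_def place.local_factor_mult[unfolded place_def] intro!: restrict_ext)

lemma S_ideles_one: "\<one>\<^bsub>S_ideles T\<^esub> = (\<lambda>v\<in>places. \<one>\<^bsub>completion v\<^esub>)"
  by (auto simp: S_ideles_def place.local_factor_one[unfolded place_def] intro!: restrict_ext)

lemma S_ideles_completion: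
  "x \<in> carrier (S_ideles T) \<Longrightarrow> v \<in> places \<Longrightarrow> x v \<in> carrier (completion v)"
  using place.local_factor_subset[of v] by (auto simp: S_ideles_iff place_def)

lemma comm_group_S_ideles: "comm_group (S_ideles T)"
proof -
  have cg: "comm_group (local_factor T v)" if "v \<in> places" for v
    using that by (intro place.local_factor_comm_group) (simp add: place_def)
  interpret group "S_ideles T"
    unfolding S_ideles_def using cg by (intro product_group) (simp add: comm_group.axioms(2))
  show ?thesis
  proof (rule group_comm_groupI)
    fix x y assume *: "x \<in> carrier (S_ideles T)" "y \<in> carrier (S_ideles T)"
    have "x v \<otimes>\<^bsub>completion v\<^esub> y v = y v \<otimes>\<^bsub>completion v\<^esub> x v" if v: "v \<in> places" for v
    proof -
      interpret place v using v by unfold_locales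
      show ?thesis using * v by (intro completion.m_comm S_ideles_completion)
    qed
    then show "x \<otimes>\<^bsub>S_ideles T\<^esub> y = y \<otimes>\<^bsub>S_ideles T\<^esub> x"
      unfolding S_ideles_mult by (intro restrict_ext)
  qed
qed

lemma completion_map_id:
  assumes "w \<in> places" "\<xi> \<in> carrier (completion w)"
  shows "completion_map id w \<xi> = \<xi>"
proof -
  interpret place w using assms(1) by unfold_locales
  interpret lies_over id w w
    using assms(1) place by unfold_locales (auto simp: field_hom_def intro!: exI[of _ "1::real"])
  obtain x where "\<xi> = completion_class w x" using assms(2) completionE by blast
  then show ?thesis by (simp add: completion_map_class)
qed

text \<open>Replacing \<open>x\<close> by \<open>y * x\<close> and subtracting \<rho>
  \<open>y\<close> times the relation eliminates \<rho>, while the coefficient at \<tau> is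
  multiplied by the difference of \<tau> \<open>y\<close> and \<rho> \<open>y\<close>. Choosing
  \<open>y\<close> with this difference nonzero, induction kills the coefficient at \<tau>.
  Evaluation at 1 then leaves the coefficient at \<rho>.\<close>

lemma dedekind_independence:
  fixes A :: "('l::field \<Rightarrow> 'l) set"
  assumes "finite A" "\<And>\<sigma>. \<sigma> \<in> A \<Longrightarrow> field_hom \<sigma>" "\<And>x. (\<Sum>\<sigma>\<in>A. c \<sigma> * \<sigma> x) = 0" "\<sigma> \<in> A"
  shows "c \<sigma> = 0"
  using assms
proof (induction A arbitrary: c \<sigma>)
  case (insert \<rho> A)
  have lin: "c \<rho> * \<rho> x + (\<Sum>\<sigma>\<in>A. c \<sigma> * \<sigma> x) = 0" for x
    using insert by (simp flip: insert.prems(2))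
  have A0: "c \<tau> = 0" if \<tau>: "\<tau> \<in> A" for \<tau>
  proof -
    obtain y where y: "\<tau> y \<noteq> \<rho> y" using \<tau> insert.hyps by (metis ext)
    have "(\<Sum>\<sigma>\<in>A. c \<sigma> * (\<sigma> y - \<rho> y) * \<sigma> x) = 0" for x
    proof -
      have "\<sigma> (y * x) = \<sigma> y * \<sigma> x" if "\<sigma> \<in> insert \<rho> A" for \<sigma>
        using insert.prems(1)[OF that] by (simp add: field_hom_def)
      then have "c \<rho> * (\<rho> y * \<rho> x) + (\<Sum>\<sigma>\<in>A. c \<sigma> * (\<sigma> y * \<sigma> x)) = 0"
        using lin[of "y * x"] by (simp cong: sum.cong)
      also have "0 = \<rho> y * (c \<rho> * \<rho> x + (\<Sum>\<sigma>\<in>A. c \<sigma> * \<sigma> x))" using lin[of x] by simp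
      also have "\<dots> = c \<rho> * (\<rho> y * \<rho> x) + \<rho> y * (\<Sum>\<sigma>\<in>A. c \<sigma> * \<sigma> x)" by (simp add: algebra_simps)
      finally have "(\<Sum>\<sigma>\<in>A. c \<sigma> * (\<sigma> y * \<sigma> x)) - \<rho> y * (\<Sum>\<sigma>\<in>A. c \<sigma> * \<sigma> x) = 0" by simp
      then show ?thesis by (simp add: sum_distrib_left sum_subtractf algebra_simps)
    qed
    then have "c \<tau> * (\<tau> y - \<rho> y) = 0"
      using insert.prems(1) \<tau> by (intro insert.IH[of "\<lambda>\<sigma>. c \<sigma> * (\<sigma> y - \<rho> y)"]) auto
    then show ?thesis using y by simp
  qed
  have "(\<Sum>\<sigma>\<in>A. c \<sigma> * \<sigma> 1) = 0" by (rule sum.neutral) (simp add: A0)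
  moreover have "\<rho> 1 = 1" using insert.prems(1)[of \<rho>] by (simp add: field_hom_def)
  ultimately have "c \<rho> = 0" using lin[of 1] by simp
  show ?case
  proof (rule insertE[OF insert.prems(3)])
    show "\<sigma> = \<rho> \<Longrightarrow> c \<sigma> = 0" using \<open>c \<rho> = 0\<close> by (simp only:)
  next
    show "\<sigma> \<in> A \<Longrightarrow> c \<sigma> = 0" using A0 .
  qed
next
  case empty
  from empty.prems(3) show ?case by (rule emptyE)
qed

section \<open>S-units and S-ideles as Galois modules\<close>

context galois_ext
begin

lemma places_above_iff: "w \<in> places \<Longrightarrow> w \<in> places_above \<iota> S \<longleftrightarrow> place_below \<iota> w \<in> S"
  by (simp add: places_above_def)

lemma place_act_inv_place:
  "w \<in> places \<Longrightarrow> \<sigma> \<in> carrier G \<Longrightarrow> place_act (inv_into UNIV \<sigma>) w \<in> places"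
  using place_act_place galois_group_inv by blast

lemma places_above_act:
  "w \<in> places \<Longrightarrow> \<sigma> \<in> carrier G \<Longrightarrow>
    place_act (inv_into UNIV \<sigma>) w \<in> places_above \<iota> S \<longleftrightarrow> w \<in> places_above \<iota> S"
  by (simp add: places_above_iff place_act_inv_place place_below_place_act_inv)

lemma base_place: "w \<in> places \<Longrightarrow> place_below \<iota> w \<in> places"
  using lies_over.u_place[OF lies_over_base] .

text \<open>The value of a conjugate at \<open>w\<close> is a power of the value of the element at
  the inverse image of \<open>w\<close>, a prime over the same prime of K.\<close>

lemma S_units_module: "group_module G (S_units (places_above \<iota> S)) (\<lambda>\<sigma> x. \<sigma> x)"
proof (intro group_module.intro group_module_axioms.intro)
  show "group G" by (rule G.is_group)
  show "comm_group (S_units (places_above \<iota> S))" by (rule comm_group_S_units)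
  fix \<sigma> assume \<sigma>: "\<sigma> \<in> carrier G"
  then have h: "field_hom \<sigma>" by (simp add: galois_group_iff)
  have "place_abs w (\<sigma> x) = 1"
    if x: "x \<in> carrier (S_units (places_above \<iota> S))" and w: "w \<in> places - places_above \<iota> S" for w x
  proof -
    interpret lies_over \<sigma> "place_act (inv_into UNIV \<sigma>) w" w using lies_over_place_act w \<sigma> by blast
    have "place_act (inv_into UNIV \<sigma>) w \<in> places - places_above \<iota> S"
      using w u_place places_above_act \<sigma> by blast
    then have "place_abs (place_act (inv_into UNIV \<sigma>) w) x = 1" using x by simp
    then show ?thesis using ex_powr by auto
  qed
  then show "\<sigma> \<in> hom (S_units (places_above \<iota> S)) (S_units (places_above \<iota> S))"
    by (auto simp: hom_def field_hom_eq_0_iff[OF h] field_hom_simps[OF h])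
qed auto

text \<open>The action law combines two facts: maps of completions compose, and the inverse of a
  composite moves \<open>w\<close> first by the inverse of \<sigma>, then by that of \<tau>.\<close>

lemma S_ideles_module: "group_module G (S_ideles (places_above \<iota> S)) idele_act"
proof (intro group_module.intro group_module_axioms.intro)
  let ?I = "S_ideles (places_above \<iota> S)"
  show "group G" by (rule G.is_group)
  show "comm_group ?I" by (rule comm_group_S_ideles)
  fix x assume x: "x \<in> carrier ?I"
  show "idele_act \<one>\<^bsub>G\<^esub> x = x"
  proof (rule extensionalityI[of _ places])
    fix w :: "'l place" assume w: "w \<in> places"
    then show "idele_act \<one>\<^bsub>G\<^esub> x w = x w"
      using S_ideles_completion[OF x w] by (simp add: idele_act_def completion_map_id)
  qed (use x in \<open>auto simp: idele_act_def S_ideles_iff\<close>)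
  fix \<sigma> \<tau> assume \<sigma>: "\<sigma> \<in> carrier G" and \<tau>: "\<tau> \<in> carrier G"
  have b: "bij \<sigma>" "bij \<tau>" using \<sigma> \<tau> by (auto simp: galois_group_iff)
  show "idele_act (\<sigma> \<otimes>\<^bsub>G\<^esub> \<tau>) x = idele_act \<sigma> (idele_act \<tau> x)"
    unfolding idele_act_def
  proof (rule restrict_ext)
    fix w :: "'l place" assume w: "w \<in> places"
    let ?w = "place_act (inv_into UNIV \<sigma>) w"
    have w': "?w \<in> places" using place_act_inv_place w \<sigma> .
    have "place_act (inv_into UNIV (\<sigma> \<circ> \<tau>)) w = place_act (inv_into UNIV \<tau>) ?w"
      using b by (simp add: o_inv_distrib place_act_comp bij_imp_bij_inv)
    moreover have "x (place_act (inv_into UNIV \<tau>) ?w) \<in> carrier (completion (place_act (inv_into UNIV \<tau>) ?w))"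
      using S_ideles_completion[OF x place_act_inv_place[OF w' \<tau>]] .
    ultimately show "completion_map (\<sigma> \<otimes>\<^bsub>G\<^esub> \<tau>) w (x (place_act (inv_into UNIV (\<sigma> \<otimes>\<^bsub>G\<^esub> \<tau>)) w)) =
        completion_map \<sigma> w ((\<lambda>w\<in>places. completion_map \<tau> w (x (place_act (inv_into UNIV \<tau>) w))) ?w)"
      using completion_map_compose[OF lies_over_place_act[OF w' \<tau>] lies_over_place_act[OF w \<sigma>]] w'
      by simp
  qed
next
  let ?I = "S_ideles (places_above \<iota> S)"
  fix \<sigma> assume \<sigma>: "\<sigma> \<in> carrier G"
  have closed: "idele_act \<sigma> x \<in> carrier ?I" if x: "x \<in> carrier ?I" for x
    unfolding S_ideles_iff
  proof (intro conjI ballI)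
    fix w :: "'l place" assume w: "w \<in> places"
    interpret lies_over \<sigma> "place_act (inv_into UNIV \<sigma>) w" w using lies_over_place_act w \<sigma> by blast
    show "idele_act \<sigma> x w \<in> carrier (local_factor (places_above \<iota> S) w)"
      using w x u_place places_above_act[OF w \<sigma>]
      by (auto simp: idele_act_def S_ideles_iff intro!: completion_map_local_factor[of "places_above \<iota> S"])
  qed (simp add: idele_act_def)
  have "idele_act \<sigma> (x \<otimes>\<^bsub>?I\<^esub> y) = idele_act \<sigma> x \<otimes>\<^bsub>?I\<^esub> idele_act \<sigma> y"
    if x: "x \<in> carrier ?I" and y: "y \<in> carrier ?I" for x y
    unfolding S_ideles_mult idele_act_def
  proof (rule restrict_ext)
    fix w :: "'l place" assume w: "w \<in> places"
    interpret lies_over \<sigma> "place_act (inv_into UNIV \<sigma>) w" w using lies_over_place_act w \<sigma> by blast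
    show "completion_map \<sigma> w ((\<lambda>v\<in>places. x v \<otimes>\<^bsub>completion v\<^esub> y v) (place_act (inv_into UNIV \<sigma>) w)) =
        (\<lambda>w\<in>places. completion_map \<sigma> w (x (place_act (inv_into UNIV \<sigma>) w))) w \<otimes>\<^bsub>completion w\<^esub>
        (\<lambda>w\<in>places. completion_map \<sigma> w (y (place_act (inv_into UNIV \<sigma>) w))) w"
      using w u_place S_ideles_completion[OF x u_place] S_ideles_completion[OF y u_place]
      by (simp add: completion_map_mult)
  qed
  then show "idele_act \<sigma> \<in> hom ?I ?I" using closed by (auto simp: hom_def)
qed

text \<open>A single completion separates the elements of L, which is why some prime must exist;
  over an empty set of primes all elements would give the same idele.\<close>

lemma principal_embedding:
  assumes "places \<noteq> ({} :: 'l place set)"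
  shows "equivariant_embedding G (S_units (places_above \<iota> S)) (S_ideles (places_above \<iota> S))
    (\<lambda>\<sigma> x. \<sigma> x) idele_act (\<lambda>x. \<lambda>v\<in>places. completion_embed v x)"
proof (intro equivariant_embedding.intro equivariant_embedding_axioms.intro
    S_units_module S_ideles_module)
  let ?U = "S_units (places_above \<iota> S)" and ?I = "S_ideles (places_above \<iota> S)"
  let ?j = "\<lambda>x::'l. \<lambda>v\<in>places. completion_embed v x"
  have "?j x \<in> carrier ?I" if "x \<in> carrier ?U" for x
    using that by (auto simp: S_ideles_iff place_def intro!: place.completion_embed_local_factor)
  then show "?j \<in> hom ?U ?I"
    by (auto simp: hom_def S_ideles_mult place_def place.completion_embed_mult intro!: restrict_ext)
  obtain w :: "'l place" where w: "w \<in> places" using assms by blast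
  show "inj_on ?j (carrier ?U)"
  proof (rule inj_onI)
    fix x y assume "?j x = ?j y"
    then have "?j x w = ?j y w" by simp
    then show "x = y" using w by (simp add: place.completion_embed_inj[unfolded place_def])
  qed
  fix \<sigma> u assume \<sigma>: "\<sigma> \<in> carrier G"
  show "?j (\<sigma> u) = idele_act \<sigma> (?j u)"
    unfolding idele_act_def
  proof (rule restrict_ext)
    fix w :: "'l place" assume w: "w \<in> places"
    interpret lies_over \<sigma> "place_act (inv_into UNIV \<sigma>) w" w using lies_over_place_act w \<sigma> by blast
    show "completion_embed w (\<sigma> u) = completion_map \<sigma> w (?j u (place_act (inv_into UNIV \<sigma>) w))"
      using u_place by (simp add: completion_map_embed)
  qed
qed

text \<open>Independence of automorphisms gives an \<open>x\<close> for which the sum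
  \<open>c\<close> of the \<open>f\<close> \<sigma> times \<sigma> \<open>x\<close> is nonzero.
  Reindexing the sum by the cocycle identity gives \<open>f\<close> \<tau> times \<tau>
  \<open>c\<close> equal to \<open>c\<close>, so the inverse of \<open>c\<close> satisfies the
  required equation.\<close>

lemma hilbert_90:
  assumes nz: "\<And>\<sigma>. \<sigma> \<in> carrier G \<Longrightarrow> f \<sigma> \<noteq> 0"
    and cocycle: "\<And>\<sigma> \<tau>. \<sigma> \<in> carrier G \<Longrightarrow> \<tau> \<in> carrier G \<Longrightarrow> f (\<sigma> \<circ> \<tau>) = f \<sigma> * \<sigma> (f \<tau>)"
  obtains b where "b \<noteq> 0" "\<And>\<tau>. \<tau> \<in> carrier G \<Longrightarrow> \<tau> b = f \<tau> * b"
proof -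
  have "\<exists>x. (\<Sum>\<sigma>\<in>carrier G. f \<sigma> * \<sigma> x) \<noteq> 0"
  proof (rule ccontr)
    assume "\<not> ?thesis"
    then have "f id = 0"
      using G.one_closed finite_G
      by (intro dedekind_independence[of "carrier G" f]) (auto simp: galois_group_iff)
    then show False using nz G.one_closed by simp
  qed
  then obtain x where x: "(\<Sum>\<sigma>\<in>carrier G. f \<sigma> * \<sigma> x) \<noteq> 0" by blast
  define c where "c = (\<Sum>\<sigma>\<in>carrier G. f \<sigma> * \<sigma> x)"
  have eq: "f \<tau> * \<tau> c = c" if \<tau>: "\<tau> \<in> carrier G" for \<tau>
  proof -
    have h: "field_hom \<tau>" using \<tau> by (simp add: galois_group_iff)
    have "f \<tau> * \<tau> c = (\<Sum>\<sigma>\<in>carrier G. f (\<tau> \<circ> \<sigma>) * (\<tau> \<circ> \<sigma>) x)"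
      using \<tau> by (simp add: c_def field_hom_simps[OF h] sum_distrib_left cocycle mult.assoc cong: sum.cong)
    also have "\<dots> = c"
      unfolding c_def
      using sum.reindex_bij_betw[OF mult_bij[OF \<tau>], of "\<lambda>\<sigma>. f \<sigma> * \<sigma> x"] by simp
    finally show ?thesis .
  qed
  show thesis
  proof (rule that)
    show "inverse c \<noteq> 0" using x by (simp add: c_def)
    fix \<tau> assume \<tau>: "\<tau> \<in> carrier G"
    have h: "field_hom \<tau>" using \<tau> by (simp add: galois_group_iff)
    have "\<tau> c = inverse (f \<tau>) * c" using eq[OF \<tau>] nz[OF \<tau>] by (simp add: field_simps)
    then show "\<tau> (inverse c) = f \<tau> * inverse c" by (simp add: field_hom_simps[OF h])
  qed
qed

section \<open>The invariant ideles of L are those of K\<close>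

lemma idele_map_closed:
  assumes x: "x \<in> carrier (S_ideles S)"
  shows "idele_map \<iota> x \<in> carrier (S_ideles (places_above \<iota> S))"
  unfolding S_ideles_iff
proof (intro conjI ballI)
  fix w :: "'l place" assume w: "w \<in> places"
  interpret lies_over \<iota> "place_below \<iota> w" w by (rule lies_over_base[OF w])
  show "idele_map \<iota> x w \<in> carrier (local_factor (places_above \<iota> S) w)"
    using w x u_place
    by (auto simp: idele_map_def S_ideles_iff places_above_iff intro!: completion_map_local_factor[of S])
qed (simp add: idele_map_def)

lemma idele_map_mult:
  assumes x: "x \<in> carrier (S_ideles S)" and y: "y \<in> carrier (S_ideles S)"
  shows "idele_map \<iota> (x \<otimes>\<^bsub>S_ideles S\<^esub> y) = idele_map \<iota> x \<otimes>\<^bsub>S_ideles (places_above \<iota> S)\<^esub> idele_map \<iota> y"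
  unfolding S_ideles_mult idele_map_def
proof (rule restrict_ext)
  fix w :: "'l place" assume w: "w \<in> places"
  interpret lies_over \<iota> "place_below \<iota> w" w by (rule lies_over_base[OF w])
  show "completion_map \<iota> w ((\<lambda>v\<in>places. x v \<otimes>\<^bsub>completion v\<^esub> y v) (place_below \<iota> w)) =
      (\<lambda>w\<in>places. completion_map \<iota> w (x (place_below \<iota> w))) w \<otimes>\<^bsub>completion w\<^esub>
      (\<lambda>w\<in>places. completion_map \<iota> w (y (place_below \<iota> w))) w"
    using w u_place S_ideles_completion[OF x u_place] S_ideles_completion[OF y u_place]
    by (simp add: completion_map_mult)
qed

lemma idele_map_principal:
  "idele_map \<iota> (\<lambda>v\<in>places. completion_embed v u) = (\<lambda>w\<in>places. completion_embed w (\<iota> u))"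
  unfolding idele_map_def
proof (rule restrict_ext)
  fix w :: "'l place" assume w: "w \<in> places"
  interpret lies_over \<iota> "place_below \<iota> w" w by (rule lies_over_base[OF w])
  show "completion_map \<iota> w ((\<lambda>v\<in>places. completion_embed v u) (place_below \<iota> w)) = completion_embed w (\<iota> u)"
    using u_place by (simp add: completion_map_embed)
qed

lemma S_units_base:
  assumes u: "u \<in> carrier (S_units S)"
  shows "\<iota> u \<in> carrier (S_units (places_above \<iota> S))"
proof -
  have "place_abs w (\<iota> u) = 1" if w: "w \<in> places - places_above \<iota> S" for w
  proof -
    interpret lies_over \<iota> "place_below \<iota> w" w using w by (intro lies_over_base) simp
    have "place_abs (place_below \<iota> w) u = 1" using u w u_place places_above_iff by auto
    then show ?thesis using ex_powr by auto
  qed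
  then show ?thesis using u by (simp add: field_hom_eq_0_iff[OF hom])
qed

text \<open>Cauchy representatives of the components of \<open>y\<close> along the orbit of
  \<open>w\<close> form a family invariant up to null sequences, so a sequence of K approximates all
  of them. It is Cauchy at \<open>w\<close>, hence at the prime below, and its class there is the
  wanted element. One element serves every prime above because, by transitivity, these primes make
  up the orbit.\<close>

lemma fixed_idele_component:
  assumes y: "y \<in> carrier (S_ideles (places_above \<iota> S))"
    and fixed: "\<And>\<sigma>. \<sigma> \<in> carrier G \<Longrightarrow> idele_act \<sigma> y = y"
    and w: "w \<in> places"
  shows "\<exists>\<eta>\<in>carrier (completion (place_below \<iota> w)).
    \<forall>w'\<in>places. place_below \<iota> w' = place_below \<iota> w \<longrightarrow> completion_map \<iota> w' \<eta> = y w'"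
proof -
  have "\<forall>u\<in>places. \<exists>x. x \<in> carrier (cauchy_ring u) \<and> y u = completion_class u x"
    using S_ideles_completion[OF y] by (metis place.completionE place.intro)
  then obtain x where x: "\<And>u. u \<in> places \<Longrightarrow> x u \<in> carrier (cauchy_ring u)"
    "\<And>u. u \<in> places \<Longrightarrow> y u = completion_class u (x u)"
    unfolding bchoice_iff by blast
  obtain k where k: "\<And>u. u \<in> orbit w \<Longrightarrow> (\<lambda>n. \<iota> (k n) - x u n) \<in> null_ideal u"
  proof (rule approximation_by_base[of "orbit w" x])
    fix \<sigma> u assume \<sigma>: "\<sigma> \<in> carrier G" and u: "u \<in> orbit w"
    then show "place_act (inv_into UNIV \<sigma>) u \<in> orbit w"
      using orbit_act[OF galois_group_inv[OF \<sigma>]] by blast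
    have up: "u \<in> places" using u orbit_places w by blast
    interpret lies_over \<sigma> "place_act (inv_into UNIV \<sigma>) u" u using lies_over_place_act up \<sigma> by blast
    have "idele_act \<sigma> y u = y u" using fixed[OF \<sigma>] by simp
    then have "completion_class u (\<sigma> \<circ> x (place_act (inv_into UNIV \<sigma>) u)) = completion_class u (x u)"
      using up u_place by (simp add: idele_act_def x(2) completion_map_class)
    then show "(\<lambda>n. \<sigma> (x (place_act (inv_into UNIV \<sigma>) u) n) - x u n) \<in> null_ideal u"
      by (simp add: w.completion_class_eq_iff)
  qed (use finite_orbit orbit_places w in auto)
  interpret w: lies_over \<iota> "place_below \<iota> w" w by (rule lies_over_base[OF w])
  have "\<iota> \<circ> k \<in> carrier (cauchy_ring w)"
    by (rule w.w.cauchy_cong[OF _ x(1)[OF w]]) (use k[OF orbit_self] in simp)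
  then have "k \<in> carrier (cauchy_ring (place_below \<iota> w))" by (simp add: w.cauchy_iff)
  then have "completion_class (place_below \<iota> w) k \<in> carrier (completion (place_below \<iota> w))" by blast
  moreover have "completion_map \<iota> w' (completion_class (place_below \<iota> w) k) = y w'"
    if w': "w' \<in> places" "place_below \<iota> w' = place_below \<iota> w" for w'
  proof -
    interpret w': lies_over \<iota> "place_below \<iota> w" w' using lies_over_base[OF w'(1)] w'(2) by simp
    have "w' \<in> orbit w" using transitive[OF w w'(1)] w'(2) by (auto simp: orbit_def)
    then show ?thesis
      using k[of w'] by (simp add: x(2)[OF w'(1)] w'.completion_map_class w'.w.completion_class_eq_iff)
  qed
  ultimately show ?thesis by blast
qed

text \<open>The component lemma yields elements of completions of K, not yet units. Applied also to
  the inverse of the invariant idele, it yields a second element, and the product of the two is 1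
  because maps of completions are injective. Outside \<open>S\<close> the bounds by 1 are pulled
  back from the prime \<open>pl v\<close>.\<close>

lemma fixed_ideles:
  assumes pl: "\<And>v. v \<in> places \<Longrightarrow> pl v \<in> places \<and> place_below \<iota> (pl v) = v"
  shows "carrier (fixed_points G idele_act (S_ideles (places_above \<iota> S))) =
    idele_map \<iota> ` carrier (S_ideles S)" (is "?l = ?r")
proof
  let ?I = "S_ideles (places_above \<iota> S)"
  interpret I: group_module G ?I idele_act by (rule S_ideles_module)
  show "?l \<subseteq> ?r"
  proof
    fix x assume "x \<in> ?l"
    then have x: "x \<in> carrier ?I" "\<And>\<sigma>. \<sigma> \<in> carrier G \<Longrightarrow> idele_act \<sigma> x = x"
      by (auto simp: fixed_points_def)
    let ?y = "inv\<^bsub>?I\<^esub> x"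
    have y: "?y \<in> carrier ?I" "\<And>\<sigma>. \<sigma> \<in> carrier G \<Longrightarrow> idele_act \<sigma> ?y = ?y"
      using x by (auto simp: I.act_inv)
    have xy: "x w \<otimes>\<^bsub>completion w\<^esub> ?y w = \<one>\<^bsub>completion w\<^esub>" if "w \<in> places" for w
      using fun_cong[OF I.A.r_inv[OF x(1)], of w] that unfolding S_ideles_mult S_ideles_one by simp
    have ex: "\<exists>\<eta>. \<eta> \<in> carrier (local_factor S v) \<and>
        (\<forall>w\<in>places. place_below \<iota> w = v \<longrightarrow> completion_map \<iota> w \<eta> = x w)" if v: "v \<in> places" for v
    proof -
      let ?w = "pl v"
      have w: "?w \<in> places" "place_below \<iota> ?w = v" using pl v by auto
      obtain \<eta> where \<eta>: "\<eta> \<in> carrier (completion v)"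
        "\<forall>w\<in>places. place_below \<iota> w = v \<longrightarrow> completion_map \<iota> w \<eta> = x w"
        using fixed_idele_component[OF x w(1)] w(2) by auto
      obtain \<theta> where \<theta>: "\<theta> \<in> carrier (completion v)"
        "\<forall>w\<in>places. place_below \<iota> w = v \<longrightarrow> completion_map \<iota> w \<theta> = ?y w"
        using fixed_idele_component[OF y w(1)] w(2) by auto
      interpret lies_over \<iota> v ?w using lies_over_base[OF w(1)] w(2) by simp
      have "completion_map \<iota> ?w (\<eta> \<otimes>\<^bsub>completion v\<^esub> \<theta>) = completion_map \<iota> ?w \<one>\<^bsub>completion v\<^esub>"
        using \<eta> \<theta> w xy by (simp add: completion_map_mult completion_map_one)
      then have one: "\<eta> \<otimes>\<^bsub>completion v\<^esub> \<theta> = \<one>\<^bsub>completion v\<^esub>"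
        using \<eta> \<theta> by (intro completion_map_inj) auto
      have "completion_abs v \<eta> \<le> 1 \<and> completion_abs v \<theta> \<le> 1" if "v \<notin> S"
      proof -
        have nS: "?w \<notin> places_above \<iota> S" using that w by (simp add: places_above_iff)
        have "x ?w \<in> carrier (local_factor (places_above \<iota> S) ?w)"
          "?y ?w \<in> carrier (local_factor (places_above \<iota> S) ?w)"
          using x(1) y(1) w unfolding S_ideles_iff by auto
        then have "completion_abs ?w (x ?w) \<le> 1" "completion_abs ?w (?y ?w) \<le> 1"
          using nS by (auto simp: w.local_factor_iff)
        then show ?thesis
          using \<eta> \<theta> w completion_abs_map_le_1_iff[OF \<eta>(1)] completion_abs_map_le_1_iff[OF \<theta>(1)] by simp
      qed
      then have "\<eta> \<in> carrier (local_factor S v)" using one \<eta>(1) \<theta>(1) by (auto simp: u.local_factor_iff)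
      then show ?thesis using \<eta>(2) by blast
    qed
    obtain e where e': "\<forall>v\<in>places. e v \<in> carrier (local_factor S v) \<and>
        (\<forall>w\<in>places. place_below \<iota> w = v \<longrightarrow> completion_map \<iota> w (e v) = x w)"
      using bchoice[of places "\<lambda>v \<eta>. \<eta> \<in> carrier (local_factor S v) \<and>
        (\<forall>w\<in>places. place_below \<iota> w = v \<longrightarrow> completion_map \<iota> w \<eta> = x w)"] ex by metis
    have e: "e v \<in> carrier (local_factor S v)" if "v \<in> places" for v using e' that by blast
    have e_map: "completion_map \<iota> w (e (place_below \<iota> w)) = x w" if w: "w \<in> places" for w
      using e' base_place[OF w] w by simp
    have "restrict e places \<in> carrier (S_ideles S)" using e by (simp add: S_ideles_iff)
    moreover have "x = idele_map \<iota> (restrict e places)"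
      using x(1) e_map base_place
      by (intro extensionalityI[of x places]) (auto simp: idele_map_def S_ideles_iff)
    ultimately show "x \<in> ?r" by blast
  qed
  show "?r \<subseteq> ?l"
  proof clarify
    fix x assume x: "x \<in> carrier (S_ideles S)"
    have "idele_act \<sigma> (idele_map \<iota> x) = idele_map \<iota> x" if \<sigma>: "\<sigma> \<in> carrier G" for \<sigma>
      unfolding idele_act_def idele_map_def
    proof (rule restrict_ext)
      fix w :: "'l place" assume w: "w \<in> places"
      let ?w = "place_act (inv_into UNIV \<sigma>) w"
      have w': "?w \<in> places" using place_act_inv_place w \<sigma> .
      have below: "place_below \<iota> ?w = place_below \<iota> w" by (rule place_below_place_act_inv[OF \<sigma>])
      have "\<sigma> \<circ> \<iota> = \<iota>" using \<sigma> by (auto simp: galois_group_iff)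
      then have "completion_map \<sigma> w (completion_map \<iota> ?w (x (place_below \<iota> w))) =
          completion_map \<iota> w (x (place_below \<iota> w))"
        using completion_map_compose[OF lies_over_base[OF w'] lies_over_place_act[OF w \<sigma>]]
          S_ideles_completion[OF x base_place[OF w]] below by simp
      then show "completion_map \<sigma> w ((\<lambda>w\<in>places. completion_map \<iota> w (x (place_below \<iota> w))) ?w) =
          completion_map \<iota> w (x (place_below \<iota> w))"
        using w' below by simp
    qed
    then show "idele_map \<iota> x \<in> ?l" using idele_map_closed[OF x] by (simp add: fixed_points_def)
  qed
qed

text \<open>Representatives of one class differ by an S-unit of K, which becomes an S-unit of L, so
  the union in \<open>idele_class_map\<close> is a single coset. The image of the idele classes of K
  thereby takes the form of the subgroup divided out in
  \<open>invariants_quotient_iso\<close>.\<close>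

lemma idele_class_map_image:
  assumes "places \<noteq> ({} :: 'l place set)"
  shows "idele_class_map \<iota> S ` carrier (S_idele_classes S) =
    (\<lambda>x. principal_ideles (places_above \<iota> S) #>\<^bsub>S_ideles (places_above \<iota> S)\<^esub> x) `
      idele_map \<iota> ` carrier (S_ideles S)"
proof -
  let ?P = "principal_ideles (places_above \<iota> S)" and ?I = "S_ideles (places_above \<iota> S)"
  let ?j = "\<lambda>x::'l. \<lambda>v\<in>places. completion_embed v x" and ?jK = "\<lambda>x::'k. \<lambda>v\<in>places. completion_embed v x"
  interpret equivariant_embedding G "S_units (places_above \<iota> S)" ?I "\<lambda>\<sigma> x. \<sigma> x" idele_act ?j
    by (rule principal_embedding[OF assms])
  have jK: "?jK u \<in> carrier (S_ideles S)" if "u \<in> carrier (S_units S)" for u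
    using that by (auto simp: S_ideles_iff place_def intro!: place.completion_embed_local_factor)
  have "idele_class_map \<iota> S (principal_ideles S #>\<^bsub>S_ideles S\<^esub> x) = ?P #>\<^bsub>?I\<^esub> idele_map \<iota> x"
    if x: "x \<in> carrier (S_ideles S)" for x
  proof -
    have "?P #>\<^bsub>?I\<^esub> idele_map \<iota> y = ?P #>\<^bsub>?I\<^esub> idele_map \<iota> x"
      if y: "y \<in> principal_ideles S #>\<^bsub>S_ideles S\<^esub> x" for y
    proof -
      obtain u where u: "u \<in> carrier (S_units S)" "y = ?jK u \<otimes>\<^bsub>S_ideles S\<^esub> x"
        using y by (auto simp: r_coset_def principal_ideles_def)
      then have "idele_map \<iota> y = ?j (\<iota> u) \<otimes>\<^bsub>?I\<^esub> idele_map \<iota> x"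
        using idele_map_mult[OF jK[OF u(1)] x] by (simp add: idele_map_principal)
      then have "idele_map \<iota> y \<in> ?P #>\<^bsub>?I\<^esub> idele_map \<iota> x"
        using S_units_base[OF u(1)] unfolding r_coset_def principal_ideles_def by blast
      then show ?thesis
        using I.A.repr_independence idele_map_closed[OF x] range_subgroup
        unfolding principal_ideles_def by blast
    qed
    moreover have "principal_ideles S #>\<^bsub>S_ideles S\<^esub> x \<noteq> {}"
      using comm_group.axioms(2)[OF comm_group_S_units, THEN group.is_monoid, THEN monoid.one_closed, of S]
      unfolding r_coset_def principal_ideles_def by blast
    ultimately show ?thesis unfolding idele_class_map_def by blast
  qed
  then show ?thesis
    unfolding S_idele_classes_def carrier_FactGroup image_image by (intro image_cong) auto
qed

end


section \<open>The localization map\<close>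

text \<open>Each mapped cocycle lies in its own coset. If the union of these cosets is the group of
  coboundaries, then every mapped cocycle is a coboundary; conversely every coset in the nonempty
  union is then that group.\<close>

lemma (in group_module) H1_map_trivial_iff:
  assumes "\<xi> \<noteq> {}" and cocycle: "\<And>f. f \<in> \<xi> \<Longrightarrow> (\<lambda>g\<in>carrier G. \<phi> (f g)) \<in> carrier (cocycles1 G A act)"
  shows "H1_map G A act \<phi> \<xi> = \<one>\<^bsub>H1 G A act\<^esub> \<longleftrightarrow>
    (\<forall>f\<in>\<xi>. \<exists>a\<in>carrier A. \<forall>g\<in>carrier G. act g a = \<phi> (f g) \<otimes>\<^bsub>A\<^esub> a)"
proof -
  let ?B = "coboundaries1 G A act" and ?Z = "cocycles1 G A act"
  let ?c = "\<lambda>f. \<lambda>g\<in>carrier G. \<phi> (f g)"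
  have "H1_map G A act \<phi> \<xi> = ?B \<longleftrightarrow> (\<forall>f\<in>\<xi>. ?c f \<in> ?B)"
  proof
    assume eq: "H1_map G A act \<phi> \<xi> = ?B"
    show "\<forall>f\<in>\<xi>. ?c f \<in> ?B"
    proof
      fix f assume f: "f \<in> \<xi>"
      have "?c f \<in> ?B #>\<^bsub>?Z\<^esub> ?c f"
        using cocycles.rcos_self[OF cocycle[OF f] coboundaries1_subgroup] .
      then show "?c f \<in> ?B" using f eq unfolding H1_map_def by blast
    qed
  next
    assume "\<forall>f\<in>\<xi>. ?c f \<in> ?B"
    then have "?B #>\<^bsub>?Z\<^esub> ?c f = ?B" if "f \<in> \<xi>" for f
      using that cocycles.coset_join2[OF cocycle[OF that] coboundaries1_subgroup] by blast
    then show "H1_map G A act \<phi> \<xi> = ?B" using \<open>\<xi> \<noteq> {}\<close> unfolding H1_map_def by simp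
  qed
  moreover have "?c f \<in> ?B \<longleftrightarrow> (\<exists>a\<in>carrier A. \<forall>g\<in>carrier G. act g a = \<phi> (f g) \<otimes>\<^bsub>A\<^esub> a)"
    if f: "f \<in> \<xi>" for f
    using cocycles1_closed[OF cocycle[OF f]] by (auto simp: coboundaries1_iff)
  ultimately show ?thesis by (simp add: H1_def)
qed

lemma trivial_is_iso:
  assumes "carrier A = {a}" "carrier B = {b}" "b \<otimes>\<^bsub>B\<^esub> b = b"
  shows "A \<cong> B"
proof -
  have "(\<lambda>_. b) \<in> iso A B" using assms by (auto simp: iso_def hom_def bij_betw_def)
  then show ?thesis unfolding is_iso_def by blast
qed

section \<open>Decomposition groups and Shapiro's lemma\<close>

context galois_ext
begin

lemma G_inv: "\<sigma> \<in> carrier G \<Longrightarrow> inv\<^bsub>G\<^esub> \<sigma> = inv_into UNIV \<sigma>"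
  using galois_group_inv by (intro G.inv_equality) (auto simp: galois_group_iff bij_is_inj)

lemma decomposition_group_simps [simp]:
  "\<sigma> \<in> carrier (decomposition_group \<iota> w) \<longleftrightarrow> \<sigma> \<in> carrier G \<and> place_act \<sigma> w = w"
  "\<sigma> \<otimes>\<^bsub>decomposition_group \<iota> w\<^esub> \<tau> = \<sigma> \<circ> \<tau>" "\<one>\<^bsub>decomposition_group \<iota> w\<^esub> = id"
  by (auto simp: decomposition_group_def)

lemma group_decomposition_group: "group (decomposition_group \<iota> w)"
proof -
  have "subgroup {\<sigma> \<in> carrier G. place_act \<sigma> w = w} G"
  proof (rule G.subgroupI)
    show "{\<sigma> \<in> carrier G. place_act \<sigma> w = w} \<noteq> {}" using G.one_closed by auto
    fix \<sigma> assume "\<sigma> \<in> {\<sigma> \<in> carrier G. place_act \<sigma> w = w}"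
    then show "inv\<^bsub>G\<^esub> \<sigma> \<in> {\<sigma> \<in> carrier G. place_act \<sigma> w = w}"
      using place_act_inv_cancel(1)[of \<sigma> \<iota> w] galois_group_inv[of \<sigma> \<iota>] by (simp add: G_inv)
  next
    fix \<sigma> \<tau> assume *: "\<sigma> \<in> {\<sigma> \<in> carrier G. place_act \<sigma> w = w}" "\<tau> \<in> {\<sigma> \<in> carrier G. place_act \<sigma> w = w}"
    then show "\<sigma> \<otimes>\<^bsub>G\<^esub> \<tau> \<in> {\<sigma> \<in> carrier G. place_act \<sigma> w = w}"
      using G.m_closed[of \<sigma> \<tau>] place_act_mult[of \<sigma> \<tau> w] by simp
  qed auto
  then show ?thesis unfolding decomposition_group_def by (rule G.subgroup_imp_group)
qed

lemma decomposition_lies_over: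
  assumes "w \<in> places" "\<sigma> \<in> carrier (decomposition_group \<iota> w)"
  shows "lies_over \<sigma> w w"
  using lies_over_place_act[of w \<sigma> \<iota>] place_act_inv_cancel(1)[of \<sigma> \<iota> w] assms by simp

lemma local_module:
  assumes w: "w \<in> places"
  shows "group_module (decomposition_group \<iota> w) (local_factor T w) (\<lambda>\<sigma>. completion_map \<sigma> w)"
proof (intro group_module.intro group_module_axioms.intro group_decomposition_group)
  interpret place w using w by unfold_locales
  show "comm_group (local_factor T w)" by (rule local_factor_comm_group)
  fix \<sigma> assume \<sigma>: "\<sigma> \<in> carrier (decomposition_group \<iota> w)"
  interpret \<sigma>: lies_over \<sigma> w w by (rule decomposition_lies_over[OF w \<sigma>])
  show "completion_map \<sigma> w \<in> hom (local_factor T w) (local_factor T w)"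
    by (auto simp: hom_def \<sigma>.completion_map_mult local_factor_subset intro: \<sigma>.completion_map_local_factor)
  fix \<tau> a assume \<tau>: "\<tau> \<in> carrier (decomposition_group \<iota> w)" and a: "a \<in> carrier (local_factor T w)"
  show "completion_map (\<sigma> \<otimes>\<^bsub>decomposition_group \<iota> w\<^esub> \<tau>) w a = completion_map \<sigma> w (completion_map \<tau> w a)"
    using completion_map_compose[OF decomposition_lies_over[OF w \<tau>] \<sigma>.lies_over_axioms]
      local_factor_subset[OF a] by simp
next
  fix a assume "a \<in> carrier (local_factor T w)"
  then show "completion_map \<one>\<^bsub>decomposition_group \<iota> w\<^esub> w a = a"
    using w place.local_factor_subset[of w] by (simp add: completion_map_id place_def)
qed

text \<open>Injectivity in Shapiro's lemma: local trivialisations \<open>b v\<close> at one prime \<open>w\<close> above each \<open>v\<close>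
  are spread over the orbit of \<open>w\<close> by \<open>a (\<tau> w) = \<tau> (b v) / f \<tau>\<close>.\<close>

lemma locally_trivial_iff:
  assumes pl: "\<And>v. v \<in> places \<Longrightarrow> pl v \<in> places \<and> place_below \<iota> (pl v) = v"
    and f: "f \<in> carrier (cocycles1 G (S_units (places_above \<iota> S)) (\<lambda>\<sigma> x. \<sigma> x))"
  shows "(\<forall>v\<in>places. \<exists>a\<in>carrier (local_factor (places_above \<iota> S) (pl v)).
      \<forall>\<sigma>\<in>carrier (decomposition_group \<iota> (pl v)).
        completion_map \<sigma> (pl v) a =
          completion_embed (pl v) (f \<sigma>) \<otimes>\<^bsub>local_factor (places_above \<iota> S) (pl v)\<^esub> a) \<longleftrightarrow>
    (\<exists>a\<in>carrier (S_ideles (places_above \<iota> S)). \<forall>\<sigma>\<in>carrier G.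
      idele_act \<sigma> a = (\<lambda>w\<in>places. completion_embed w (f \<sigma>)) \<otimes>\<^bsub>S_ideles (places_above \<iota> S)\<^esub> a)"
    (is "?l \<longleftrightarrow> ?r")
proof
  let ?U = "S_units (places_above \<iota> S)"
  interpret U: group_module G ?U "\<lambda>\<sigma> x. \<sigma> x" by (rule S_units_module)
  have fU: "f \<sigma> \<in> carrier ?U" if "\<sigma> \<in> carrier G" for \<sigma> using that by (rule U.cocycles1_closed[OF f])
  then have f0: "f \<sigma> \<noteq> 0" if "\<sigma> \<in> carrier G" for \<sigma> using that by simp
  have cocycle: "f (\<sigma> \<circ> \<tau>) = f \<sigma> * \<sigma> (f \<tau>)" if "\<sigma> \<in> carrier G" "\<tau> \<in> carrier G" for \<sigma> \<tau>
    using f that by (simp add: U.cocycles1_iff)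
  assume ?l
  then obtain b where b: "\<forall>v\<in>places. b v \<in> carrier (local_factor (places_above \<iota> S) (pl v)) \<and>
      (\<forall>\<sigma>\<in>carrier (decomposition_group \<iota> (pl v)).
        completion_map \<sigma> (pl v) (b v) =
          completion_embed (pl v) (f \<sigma>) \<otimes>\<^bsub>local_factor (places_above \<iota> S) (pl v)\<^esub> b v)"
    unfolding Bex_def by (drule_tac bchoice) blast
  have "\<forall>w\<in>places. \<exists>\<tau>. \<tau> \<in> carrier G \<and> w = place_act \<tau> (pl (place_below \<iota> w))"
  proof
    fix w :: "'l place" assume w: "w \<in> places"
    have "pl (place_below \<iota> w) \<in> places" "place_below \<iota> (pl (place_below \<iota> w)) = place_below \<iota> w"
      using pl[OF base_place[OF w]] by auto
    then show "\<exists>\<tau>. \<tau> \<in> carrier G \<and> w = place_act \<tau> (pl (place_below \<iota> w))"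
      using transitive[OF _ w] by metis
  qed
  \<comment> \<open>The automorphisms carrying the chosen prime to \<open>w\<close> form a coset of
    its decomposition group. The choice \<open>t w\<close> is arbitrary in it, even when
    \<open>w\<close> is the chosen prime itself.\<close>
  then obtain t where t: "\<forall>w\<in>places. t w \<in> carrier G \<and> w = place_act (t w) (pl (place_below \<iota> w))"
    by (drule_tac bchoice) blast
  define a where "a = (\<lambda>w\<in>places. completion_embed w (inverse (f (t w))) \<otimes>\<^bsub>completion w\<^esub>
      completion_map (t w) w (b (place_below \<iota> w)))"
  have t_lies_over: "lies_over (t w) (pl (place_below \<iota> w)) w" if w: "w \<in> places" for w
  proof -
    have tw: "t w \<in> carrier G" "w = place_act (t w) (pl (place_below \<iota> w))" using t w by auto
    then have "place_act (inv_into UNIV (t w)) w = pl (place_below \<iota> w)"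
      using place_act_inv_cancel(1)[OF tw(1)] by metis
    then show ?thesis using lies_over_place_act[OF w tw(1)] by simp
  qed
  have b_local: "b (place_below \<iota> w) \<in> carrier (local_factor (places_above \<iota> S) (pl (place_below \<iota> w)))"
    if "w \<in> places" for w using b base_place[OF that] by blast
  have a_mem: "a \<in> carrier (S_ideles (places_above \<iota> S))"
    unfolding S_ideles_iff
  proof (intro conjI ballI)
    fix w :: "'l place" assume w: "w \<in> places"
    interpret lies_over "t w" "pl (place_below \<iota> w)" w by (rule t_lies_over[OF w])
    interpret L: comm_group "local_factor (places_above \<iota> S) w" by (rule w.local_factor_comm_group)
    have tG: "t w \<in> carrier G" using t w by blast
    have "completion_embed w (inverse (f (t w))) \<in> carrier (local_factor (places_above \<iota> S) w)"
      using fU[OF tG] w by (intro w.completion_embed_local_factor) (auto simp: w.inverse)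
    moreover have "pl (place_below \<iota> w) \<in> places_above \<iota> S \<longleftrightarrow> w \<in> places_above \<iota> S"
      using pl[OF base_place[OF w]] w by (simp add: places_above_iff)
    then have "completion_map (t w) w (b (place_below \<iota> w)) \<in> carrier (local_factor (places_above \<iota> S) w)"
      using b_local[OF w] by (rule completion_map_local_factor)
    ultimately show "a w \<in> carrier (local_factor (places_above \<iota> S) w)"
      using L.m_closed w by (simp add: a_def)
  qed (simp add: a_def)
  have "idele_act \<sigma> a = (\<lambda>w\<in>places. completion_embed w (f \<sigma>)) \<otimes>\<^bsub>S_ideles (places_above \<iota> S)\<^esub> a"
    if \<sigma>: "\<sigma> \<in> carrier G" for \<sigma>
    unfolding idele_act_def S_ideles_mult
  proof (rule restrict_ext)
    fix w :: "'l place" assume w: "w \<in> places"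
    let ?v = "place_below \<iota> w"
    let ?w = "place_act (inv_into UNIV \<sigma>) w"
    have v: "?v \<in> places" by (rule base_place[OF w])
    have w': "?w \<in> places" using place_act_inv_place[OF w \<sigma>] .
    have below: "place_below \<iota> ?w = ?v" by (rule place_below_place_act_inv[OF \<sigma>])
    have t1: "t w \<in> carrier G" "w = place_act (t w) (pl ?v)" using t w by auto
    have t2: "t ?w \<in> carrier G" "?w = place_act (t ?w) (pl ?v)" using t w' below by auto
    interpret t1: lies_over "t w" "pl ?v" w by (rule t_lies_over[OF w])
    interpret t2: lies_over "t ?w" "pl ?v" ?w using t_lies_over[OF w'] below by simp
    interpret \<sigma>: lies_over \<sigma> ?w w by (rule lies_over_place_act[OF w \<sigma>])
    \<comment> \<open>Both \<open>t w\<close> and \<sigma> after \<open>t ?w\<close> carry the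
      chosen prime to \<open>w\<close>. They differ by an element of its decomposition group, to
      which the local solution \<open>b ?v\<close> applies.\<close>
    define \<rho> where "\<rho> = inv\<^bsub>G\<^esub> t w \<otimes>\<^bsub>G\<^esub> (\<sigma> \<otimes>\<^bsub>G\<^esub> t ?w)"
    have \<rho>G: "\<rho> \<in> carrier G"
      unfolding \<rho>_def using \<sigma> t1(1) t2(1) by (intro G.m_closed G.inv_closed)
    have \<rho>_eq: "t w \<circ> \<rho> = \<sigma> \<circ> t ?w"
    proof -
      have "t w \<otimes>\<^bsub>G\<^esub> \<rho> = \<sigma> \<otimes>\<^bsub>G\<^esub> t ?w"
        unfolding \<rho>_def G.m_assoc[OF t1(1) G.inv_closed[OF t1(1)] G.m_closed[OF \<sigma> t2(1)], symmetric]
          G.r_inv[OF t1(1)] by (rule G.l_one[OF G.m_closed[OF \<sigma> t2(1)]])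
      then show ?thesis by simp
    qed
    have "place_act (t w) (place_act \<rho> (pl ?v)) = place_act \<sigma> (place_act (t ?w) (pl ?v))"
      using place_act_mult[OF t1(1) \<rho>G, of "pl ?v"] place_act_mult[OF \<sigma> t2(1), of "pl ?v"] \<rho>_eq by simp
    also have "\<dots> = w" using t2(2) place_act_inv_cancel(2)[OF \<sigma>] by metis
    finally have "place_act \<rho> (pl ?v) = pl ?v"
      using place_act_inv_cancel(1)[OF t1(1)] t1(2) by metis
    then have \<rho>D: "\<rho> \<in> carrier (decomposition_group \<iota> (pl ?v))" using \<rho>G by simp
    interpret \<rho>: lies_over \<rho> "pl ?v" "pl ?v" by (rule decomposition_lies_over[OF t1.u_place \<rho>D])
    let ?b = "b ?v"
    have bc: "?b \<in> carrier (completion (pl ?v))" using t1.u.local_factor_subset b v by blast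
    have b\<rho>: "completion_map \<rho> (pl ?v) ?b = completion_embed (pl ?v) (f \<rho>) \<otimes>\<^bsub>completion (pl ?v)\<^esub> ?b"
      using b v \<rho>D by simp
    have emb: "completion_embed u x \<in> carrier (completion u)" if "u \<in> places" for u :: "'l place" and x
      using that place.completion_classI[of u] place.cauchy_const[of u]
      by (simp add: completion_embed_def place_def)
    have h: "field_hom \<sigma>" "field_hom (t w)" using \<sigma> t1(1) by (auto simp: galois_group_iff)
    have "completion_map \<sigma> w (a ?w) = completion_map \<sigma> w (completion_embed ?w (inverse (f (t ?w))))
        \<otimes>\<^bsub>completion w\<^esub> completion_map \<sigma> w (completion_map (t ?w) ?w ?b)"
      using w' below emb[OF w'] t2.completion_map_closed[OF bc] by (simp add: a_def \<sigma>.completion_map_mult)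
    also have "completion_map \<sigma> w (completion_map (t ?w) ?w ?b) = completion_map (t w \<circ> \<rho>) w ?b"
      using completion_map_compose[OF t2.lies_over_axioms \<sigma>.lies_over_axioms bc] \<rho>_eq by simp
    also have "\<dots> = completion_map (t w) w (completion_embed (pl ?v) (f \<rho>) \<otimes>\<^bsub>completion (pl ?v)\<^esub> ?b)"
      using completion_map_compose[OF \<rho>.lies_over_axioms t1.lies_over_axioms bc] b\<rho> by simp
    also have "\<dots> = completion_embed w (t w (f \<rho>)) \<otimes>\<^bsub>completion w\<^esub> completion_map (t w) w ?b"
      using emb[OF t1.u_place] bc by (simp add: t1.completion_map_mult t1.completion_map_embed)
    also have "completion_map \<sigma> w (completion_embed ?w (inverse (f (t ?w)))) =
        completion_embed w (\<sigma> (inverse (f (t ?w))))"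
      by (rule \<sigma>.completion_map_embed)
    also have "completion_embed w (\<sigma> (inverse (f (t ?w)))) \<otimes>\<^bsub>completion w\<^esub>
        (completion_embed w (t w (f \<rho>)) \<otimes>\<^bsub>completion w\<^esub> completion_map (t w) w ?b) =
        completion_embed w (\<sigma> (inverse (f (t ?w))) * t w (f \<rho>)) \<otimes>\<^bsub>completion w\<^esub> completion_map (t w) w ?b"
      using emb[OF w] t1.completion_map_closed[OF bc]
      by (simp add: t1.w.completion_embed_mult t1.w.completion.m_assoc)
    also have "\<sigma> (inverse (f (t ?w))) * t w (f \<rho>) = f \<sigma> * inverse (f (t w))"
    proof -
      \<comment> \<open>The cocycle identity is expanded along the two factorisations of the same
        automorphism given by \<open>\<rho>_eq\<close>.\<close>
      have "f (t w) * t w (f \<rho>) = f \<sigma> * \<sigma> (f (t ?w))"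
        using cocycle[OF t1(1) \<rho>G] cocycle[OF \<sigma> t2(1)] \<rho>_eq by simp
      moreover have "\<sigma> (f (t ?w)) \<noteq> 0" using f0[OF t2(1)] by (simp add: field_hom_eq_0_iff[OF h(1)])
      ultimately show ?thesis
        unfolding field_hom_simps(6)[OF h(1)] using f0[OF t1(1)] by (simp add: field_simps)
    qed
    also have "completion_embed w (f \<sigma> * inverse (f (t w))) \<otimes>\<^bsub>completion w\<^esub> completion_map (t w) w ?b =
        completion_embed w (f \<sigma>) \<otimes>\<^bsub>completion w\<^esub> a w"
      using w emb[OF w] t1.completion_map_closed[OF bc]
      by (simp add: a_def t1.w.completion_embed_mult t1.w.completion.m_assoc)
    finally show "completion_map \<sigma> w (a ?w) =
        (\<lambda>w\<in>places. completion_embed w (f \<sigma>)) w \<otimes>\<^bsub>completion w\<^esub> a w"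
      using w by simp
  qed
  then show ?r using a_mem by blast
next
  assume ?r
  then obtain a where a: "a \<in> carrier (S_ideles (places_above \<iota> S))"
    "\<And>\<sigma>. \<sigma> \<in> carrier G \<Longrightarrow> idele_act \<sigma> a =
      (\<lambda>w\<in>places. completion_embed w (f \<sigma>)) \<otimes>\<^bsub>S_ideles (places_above \<iota> S)\<^esub> a" by blast
  show ?l
  proof (intro ballI bexI)
    fix v :: "'k place" and \<sigma> assume v: "v \<in> places" and \<sigma>: "\<sigma> \<in> carrier (decomposition_group \<iota> (pl v))"
    have w: "pl v \<in> places" using pl[OF v] by blast
    \<comment> \<open>An element of the decomposition group acts on the component at
      \<open>pl v\<close> without moving it to another prime, so the idele equation restricts to a
      local one.\<close>
    have "place_act (inv_into UNIV \<sigma>) (pl v) = pl v"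
      using \<sigma> place_act_inv_cancel(1)[of \<sigma> \<iota> "pl v"] by simp
    then show "completion_map \<sigma> (pl v) (a (pl v)) =
        completion_embed (pl v) (f \<sigma>) \<otimes>\<^bsub>local_factor (places_above \<iota> S) (pl v)\<^esub> a (pl v)"
      using fun_cong[OF a(2)[of \<sigma>], of "pl v"] \<sigma> w
      by (simp add: idele_act_def S_ideles_mult place.local_factor_mult place_def)
  next
    fix v :: "'k place" assume "v \<in> places"
    then show "a (pl v) \<in> carrier (local_factor (places_above \<iota> S) (pl v))"
      using a(1) pl by (auto simp: S_ideles_iff)
  qed
qed

section \<open>The kernel of localization and the final isomorphism\<close>

text \<open>The unit of the direct sum is the family of trivial classes. Triviality at every
  \<open>pl v\<close> is tested on each cocycle of the class; interchanging the quantifiers over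
  primes and cocycles reaches the local side of \<open>locally_trivial_iff\<close>, whose idele side
  is the image found in \<open>invariants_quotient_iso\<close>.\<close>

lemma Sha1_carrier:
  assumes pl: "\<And>v. v \<in> places \<Longrightarrow> pl v \<in> places \<and> place_below \<iota> (pl v) = v"
  shows "carrier (Sha1 \<iota> S pl) = {\<xi> \<in> carrier (H1_S_units \<iota> S). \<forall>f\<in>\<xi>.
    \<exists>a\<in>carrier (S_ideles (places_above \<iota> S)). \<forall>\<sigma>\<in>carrier G.
      idele_act \<sigma> a = (\<lambda>w\<in>places. completion_embed w (f \<sigma>)) \<otimes>\<^bsub>S_ideles (places_above \<iota> S)\<^esub> a}"
proof -
  let ?U = "S_units (places_above \<iota> S)"
  let ?D = "\<lambda>v. decomposition_group \<iota> (pl v)" and ?A = "\<lambda>v. local_factor (places_above \<iota> S) (pl v)"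
  interpret U: group_module G ?U "\<lambda>\<sigma> x. \<sigma> x" by (rule S_units_module)
  have "localization1 \<iota> S pl \<xi> = \<one>\<^bsub>sum_group places (\<lambda>v. H1_local \<iota> S (pl v))\<^esub> \<longleftrightarrow>
      (\<forall>f\<in>\<xi>. \<exists>a\<in>carrier (S_ideles (places_above \<iota> S)). \<forall>\<sigma>\<in>carrier G.
      idele_act \<sigma> a = (\<lambda>w\<in>places. completion_embed w (f \<sigma>)) \<otimes>\<^bsub>S_ideles (places_above \<iota> S)\<^esub> a)"
    if \<xi>: "\<xi> \<in> carrier (H1_S_units \<iota> S)" for \<xi>
  proof -
    have ne: "\<xi> \<noteq> {}" and f: "\<And>f. f \<in> \<xi> \<Longrightarrow> f \<in> carrier (cocycles1 G ?U (\<lambda>\<sigma> x. \<sigma> x))"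
      using \<xi> U.H1_class_nonempty U.H1_coset(1) by (auto simp: H1_S_units_def)
    have "\<one>\<^bsub>sum_group places (\<lambda>v. H1_local \<iota> S (pl v))\<^esub> = (\<lambda>v\<in>places. \<one>\<^bsub>H1_local \<iota> S (pl v)\<^esub>)"
      by (simp add: sum_group_def)
    then have "localization1 \<iota> S pl \<xi> = \<one>\<^bsub>sum_group places (\<lambda>v. H1_local \<iota> S (pl v))\<^esub> \<longleftrightarrow>
        (\<forall>v\<in>places. H1_map (?D v) (?A v) (\<lambda>\<sigma>. completion_map \<sigma> (pl v)) (completion_embed (pl v)) \<xi> =
          \<one>\<^bsub>H1_local \<iota> S (pl v)\<^esub>)"
      by (auto simp: localization1_def fun_eq_iff restrict_def)
    also have "\<dots> \<longleftrightarrow> (\<forall>v\<in>places. \<forall>f\<in>\<xi>. \<exists>a\<in>carrier (?A v). \<forall>\<sigma>\<in>carrier (?D v).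
        completion_map \<sigma> (pl v) a = completion_embed (pl v) (f \<sigma>) \<otimes>\<^bsub>?A v\<^esub> a)"
    proof (rule ball_cong[OF refl])
      fix v :: "'k place" assume v: "v \<in> places"
      let ?w = "pl v"
      have w: "?w \<in> places" using pl[OF v] by blast
      interpret w: place ?w using w by unfold_locales
      interpret group_module "?D v" "?A v" "\<lambda>\<sigma>. completion_map \<sigma> (pl v)" by (rule local_module[OF w])
      have "(\<lambda>\<sigma>\<in>carrier (?D v). completion_embed ?w (f \<sigma>)) \<in>
          carrier (cocycles1 (?D v) (?A v) (\<lambda>\<sigma>. completion_map \<sigma> ?w))" if "f \<in> \<xi>" for f
        unfolding cocycles1_iff
      proof (intro conjI ballI)
        note fZ = f[OF that]
        have "completion_embed ?w (f \<sigma>) \<in> carrier (?A v)" if "\<sigma> \<in> carrier G" for \<sigma>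
          using U.cocycles1_closed[OF fZ that] w by (intro w.completion_embed_local_factor) auto
        then show "(\<lambda>\<sigma>\<in>carrier (?D v). completion_embed ?w (f \<sigma>)) \<in> carrier (?D v) \<rightarrow>\<^sub>E carrier (?A v)"
          by auto
        fix \<sigma> \<tau> assume \<sigma>: "\<sigma> \<in> carrier (?D v)" and \<tau>: "\<tau> \<in> carrier (?D v)"
        interpret \<sigma>: lies_over \<sigma> ?w ?w by (rule decomposition_lies_over[OF w \<sigma>])
        have "\<sigma> \<otimes>\<^bsub>?D v\<^esub> \<tau> \<in> carrier (?D v)" using \<sigma> \<tau>
          by (rule group_decomposition_group[THEN group.is_monoid, THEN monoid.m_closed])
        moreover have "f (\<sigma> \<circ> \<tau>) = f \<sigma> * \<sigma> (f \<tau>)" using fZ \<sigma> \<tau> by (simp add: U.cocycles1_iff)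
        ultimately show "(\<lambda>\<sigma>\<in>carrier (?D v). completion_embed ?w (f \<sigma>)) (\<sigma> \<otimes>\<^bsub>?D v\<^esub> \<tau>) =
            (\<lambda>\<sigma>\<in>carrier (?D v). completion_embed ?w (f \<sigma>)) \<sigma> \<otimes>\<^bsub>?A v\<^esub>
            completion_map \<sigma> ?w ((\<lambda>\<sigma>\<in>carrier (?D v). completion_embed ?w (f \<sigma>)) \<tau>)"
          using \<sigma> \<tau> by (simp add: w.completion_embed_mult \<sigma>.completion_map_embed del: decomposition_group_simps(1))
      qed
      then show "H1_map (?D v) (?A v) (\<lambda>\<sigma>. completion_map \<sigma> (pl v)) (completion_embed (pl v)) \<xi> =
          \<one>\<^bsub>H1_local \<iota> S (pl v)\<^esub> \<longleftrightarrow> (\<forall>f\<in>\<xi>. \<exists>a\<in>carrier (?A v). \<forall>\<sigma>\<in>carrier (?D v).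
          completion_map \<sigma> (pl v) a = completion_embed (pl v) (f \<sigma>) \<otimes>\<^bsub>?A v\<^esub> a)"
        unfolding H1_local_def by (rule H1_map_trivial_iff[OF ne])
    qed
    also have "\<dots> \<longleftrightarrow> (\<forall>f\<in>\<xi>. \<forall>v\<in>places. \<exists>a\<in>carrier (?A v). \<forall>\<sigma>\<in>carrier (?D v).
        completion_map \<sigma> (pl v) a = completion_embed (pl v) (f \<sigma>) \<otimes>\<^bsub>?A v\<^esub> a)" by blast
    finally show ?thesis using locally_trivial_iff[OF pl f] by simp
  qed
  then show ?thesis by (auto simp: Sha1_def kernel_def)
qed

theorem invariant_idele_classes_iso_Sha1:
  assumes pl: "\<And>v. v \<in> places \<Longrightarrow> pl v \<in> places \<and> place_below \<iota> (pl v) = v"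
  shows "invariant_idele_classes \<iota> S Mod (idele_class_map \<iota> S ` carrier (S_idele_classes S)) \<cong> Sha1 \<iota> S pl"
proof (cases "places = ({} :: 'l place set)")
  case False
  let ?U = "S_units (places_above \<iota> S)" and ?I = "S_ideles (places_above \<iota> S)"
  let ?j = "\<lambda>x::'l. \<lambda>v\<in>places. completion_embed v x"
  interpret equivariant_embedding G ?U ?I "\<lambda>\<sigma> x. \<sigma> x" idele_act ?j
    by (rule principal_embedding[OF False])
  have "invariant_idele_classes \<iota> S = fixed_points G (\<lambda>g \<xi>. idele_act g ` \<xi>) (?I Mod ?j ` carrier ?U)"
    by (simp add: invariant_idele_classes_def S_idele_classes_def principal_ideles_def)
  moreover have "idele_class_map \<iota> S ` carrier (S_idele_classes S) =
      (\<lambda>x. ?j ` carrier ?U #>\<^bsub>?I\<^esub> x) ` carrier (fixed_points G idele_act ?I)"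
    unfolding idele_class_map_image[OF False] fixed_ideles[of pl S, OF pl, simplified] principal_ideles_def ..
  moreover have "Sha1 \<iota> S pl = (H1_S_units \<iota> S)\<lparr>carrier := carrier (Sha1 \<iota> S pl)\<rparr>"
    by (simp add: Sha1_def)
  moreover have "carrier (Sha1 \<iota> S pl) = {\<xi> \<in> carrier (H1 G ?U (\<lambda>\<sigma> x. \<sigma> x)). \<forall>f\<in>\<xi>.
      \<exists>a\<in>carrier ?I. \<forall>\<sigma>\<in>carrier G. idele_act \<sigma> a = ?j (f \<sigma>) \<otimes>\<^bsub>?I\<^esub> a}"
    using Sha1_carrier[of pl S, OF pl] by (simp add: H1_S_units_def)
  ultimately show ?thesis using invariants_quotient_iso by (simp add: H1_S_units_def)
next
  text \<open>In this case, which does not occur for number fields, all idele groups are trivial, and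
    Hilbert's Theorem 90 makes \<open>H\<^sup>1\<close> trivial as well.\<close>
  case True
  let ?U = "S_units (places_above \<iota> S)" and ?I = "S_ideles (places_above \<iota> S)"
  let ?Z = "cocycles1 G ?U (\<lambda>\<sigma> x. \<sigma> x)" and ?B = "coboundaries1 G ?U (\<lambda>\<sigma> x. \<sigma> x)"
  interpret U: group_module G ?U "\<lambda>\<sigma> x. \<sigma> x" by (rule S_units_module)
  have K: "places = ({} :: 'k place set)" using True pl by blast
  have I: "carrier ?I = {\<lambda>_. undefined}" using True by (simp add: S_ideles_def)
  have "principal_ideles (places_above \<iota> S) = {\<lambda>_. undefined}"
    using U.A.one_closed True unfolding principal_ideles_def by (auto simp: restrict_def)
  then have "carrier (S_idele_classes (places_above \<iota> S)) = {{\<lambda>_. undefined}}"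
    using I True by (simp add: S_idele_classes_def carrier_FactGroup r_coset_def S_ideles_mult restrict_def)
  moreover have "idele_act \<sigma> ` {\<lambda>_. undefined} = {\<lambda>_. undefined}" for \<sigma> :: "'l \<Rightarrow> 'l"
    using True by (simp add: idele_act_def restrict_def)
  ultimately have "carrier (invariant_idele_classes \<iota> S) = {{\<lambda>_. undefined}}"
    by (auto simp: invariant_idele_classes_def fixed_points_def)
  then obtain c where c: "carrier (invariant_idele_classes \<iota> S Mod
      (idele_class_map \<iota> S ` carrier (S_idele_classes S))) = {c}"
    by (simp add: carrier_FactGroup)
  have ZB: "f \<in> ?B" if f: "f \<in> carrier ?Z" for f
  proof -
    have fU: "f \<sigma> \<in> carrier ?U" if "\<sigma> \<in> carrier G" for \<sigma> using U.cocycles1_closed[OF f that] .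
    \<comment> \<open>With no primes, every nonzero element of L is an S-unit, so this
      \<open>b\<close> is an admissible witness for a coboundary.\<close>
    obtain b where "b \<noteq> 0" "\<And>\<tau>. \<tau> \<in> carrier G \<Longrightarrow> \<tau> b = f \<tau> * b"
      using fU f hilbert_90[of f] by (auto simp: U.cocycles1_iff)
    then show ?thesis
      using f fU True by (auto simp: U.coboundaries1_iff U.cocycles1_iff PiE_iff intro!: bexI[of _ b])
  qed
  then have "carrier (H1_S_units \<iota> S) = {?B}"
    using U.coboundaries1_subgroup U.cocycles.coset_join2 U.cocycles.one_closed
    by (auto simp: H1_S_units_def H1_def carrier_FactGroup image_iff)
  moreover have "localization1 \<iota> S pl ?B = \<one>\<^bsub>sum_group places (\<lambda>v. H1_local \<iota> S (pl v))\<^esub>"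
    using K by (simp add: localization1_def sum_group_def restrict_def)
  ultimately have Sha: "carrier (Sha1 \<iota> S pl) = {?B}" by (auto simp: Sha1_def kernel_def)
  have "?B \<otimes>\<^bsub>Sha1 \<iota> S pl\<^esub> ?B = ?B"
    using U.cocycles.subgroup_mult_id[OF U.coboundaries1_subgroup]
    by (simp add: Sha1_def H1_S_units_def H1_def)
  then show ?thesis using c Sha by (rule trivial_is_iso[rotated 2])
qed

end

theorem theorem3p5:
  fixes \<iota> :: "'k::field_char_0 \<Rightarrow> 'l::field_char_0"
    and S :: "'k place set"
    and pl :: "'k place \<Rightarrow> 'l place"
  assumes "number_field TYPE('k)" and "number_field TYPE('l)"
    and "cyclic_extension \<iota>"
    and "S \<subseteq> places" and "finite S" and "infinite_places \<subseteq> S"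
    and "\<And>v. v \<in> places \<Longrightarrow> pl v \<in> places \<and> place_below \<iota> (pl v) = v"
  shows "invariant_idele_classes \<iota> S Mod (idele_class_map \<iota> S ` carrier (S_idele_classes S))
           \<cong> Sha1 \<iota> S pl"
proof -
  interpret galois_ext \<iota>
    using assms(3) by unfold_locales (simp add: cyclic_extension_def)
  show ?thesis by (rule invariant_idele_classes_iso_Sha1) (rule assms(7))
qed

end
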